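(* Let $b$ be locally integrable on $\mathbb{Q}_p^n$, $0<\alpha<n$, $1<r<n/\alpha$, $0<\lambda<n-\alpha r$. (T.1) If $1/q=1/r-\alpha/(n-\lambda)$, then: $b\in\mathrm{BMO}(\mathbb{Q}_p^n)$ and $b^-\in L^\infty(\mathbb{Q}_p^n)$ if and only if $[b,\mathcal{M}^p_\alpha]$ is bounded from $L^{r,\lambda}(\mathbb{Q}_p^n)$ to $L^{q,\lambda}(\mathbb{Q}_p^n)$. (T.2) If $1/q=1/r-\alpha/n$ and $\lambda/r=\mu/q$, then: $b\in\mathrm{BMO}(\mathbb{Q}_p^n)$ and $b^-\in L^\infty(\mathbb{Q}_p^n)$ if and only if $[b,\mathcal{M}^p_\alpha]$ is bounded from $L^{r,\lambda}(\mathbb{Q}_p^n)$ to $L^{q,\mu}(\mathbb{Q}_p^n)$.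
   Context: Fix a prime $p$; $\mathbb{Q}_p^n$ with $|x|_p=\max_j|x_j|_p$; balls $B_\gamma(x)=\{y:|y-x|_p\le p^\gamma\}$; Haar measure with $|B_\gamma(x)|_h=p^{n\gamma}$; $f_B=|B|_h^{-1}\int_Bf$. $\mathcal{M}^p_\alpha(f)(x)=\sup_{\gamma\in\mathbb{Z}}|B_\gamma(x)|_h^{\alpha/n-1}\int_{B_\gamma(x)}|f|$; $[b,\mathcal{M}^p_\alpha](f)=b\,\mathcal{M}^p_\alpha(f)-\mathcal{M}^p_\alpha(bf)$. $\mathrm{BMO}$: $\sup_{\gamma,x}|B_\gamma(x)|_h^{-1}\int_{B_\gamma(x)}|b-b_{B_\gamma(x)}|<\infty$; $b^-=-\min\{b,0\}$. For $1\le q<\infty$, $\lambda\ge0$, the $p$-adic Morrey space $L^{q,\lambda}(\mathbb{Q}_p^n)$ consists of $f\in L^q_{\mathrm{loc}}$ with $\|f\|_{L^{q,\lambda}}=\sup_{\gamma\in\mathbb{Z},x\in\mathbb{Q}_p^n}\big(|B_\gamma(x)|_h^{-\lambda/n}\int_{B_\gamma(x)}|f(y)|^qdy\big)^{1/q}<\infty$. *)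

theory Defs
  imports "HOL-Analysis.Analysis"
begin

text \<open>A p-adic number a = sum_k d_k p^k (k ranging over the integers, only finitely many
  nonzero digits with negative index) is represented by its digit function
  d :: int => nat with 0 <= d k < p and d k = 0 for all sufficiently small k.
  This is a bijection onto Q_p.\<close>

definition Qp :: "nat \<Rightarrow> (int \<Rightarrow> nat) set" where
  "Qp p = {d. (\<forall>k. d k < p) \<and> (\<exists>N. \<forall>k<N. d k = 0)}"

text \<open>The p-adic absolute value of the difference |a - b|_p: if the expansions of a and b
  first differ at index k then v_p(a - b) = k, hence |a - b|_p = p^(-k).\<close>

definition padic_dist :: "nat \<Rightarrow> (int \<Rightarrow> nat) \<Rightarrow> (int \<Rightarrow> nat) \<Rightarrow> real" where
  "padic_dist p a b =
     (if a = b then 0 else real p powr (- real_of_int (LEAST k. a k \<noteq> b k)))"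

definition Qpn :: "nat \<Rightarrow> nat \<Rightarrow> (nat \<Rightarrow> int \<Rightarrow> nat) set" where
  "Qpn p n = {x. (\<forall>j<n. x j \<in> Qp p) \<and> (\<forall>j\<ge>n. x j = (\<lambda>_. 0))}"

definition padic_vdist :: "nat \<Rightarrow> nat \<Rightarrow> (nat \<Rightarrow> int \<Rightarrow> nat) \<Rightarrow> (nat \<Rightarrow> int \<Rightarrow> nat) \<Rightarrow> real" where
  "padic_vdist p n x y = Max ((\<lambda>j. padic_dist p (x j) (y j)) ` {..<n})"

definition pball :: "nat \<Rightarrow> nat \<Rightarrow> int \<Rightarrow> (nat \<Rightarrow> int \<Rightarrow> nat) \<Rightarrow> (nat \<Rightarrow> int \<Rightarrow> nat) set" where
  "pball p n \<gamma> x = {y \<in> Qpn p n. padic_vdist p n y x \<le> real p powr real_of_int \<gamma>}"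

text \<open>Haar measure on Q_p^n: the measure on the sigma-algebra generated by the balls
  (= the Borel sets) with |B_gamma(x)|_h = p^(n gamma).\<close>

definition haar :: "nat \<Rightarrow> nat \<Rightarrow> (nat \<Rightarrow> int \<Rightarrow> nat) measure" where
  "haar p n = extend_measure (Qpn p n) (UNIV \<times> Qpn p n) (\<lambda>(\<gamma>, x). pball p n \<gamma> x)
                (\<lambda>(\<gamma>, x). ennreal (real p powr (real n * real_of_int \<gamma>)))"

definition loc_integrable :: "nat \<Rightarrow> nat \<Rightarrow> ((nat \<Rightarrow> int \<Rightarrow> nat) \<Rightarrow> real) \<Rightarrow> bool" where
  "loc_integrable p n b \<longleftrightarrow> b \<in> borel_measurable (haar p n) \<and>
     (\<forall>\<gamma>. \<forall>x\<in>Qpn p n. set_integrable (haar p n) (pball p n \<gamma> x) b)"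

definition pavg :: "nat \<Rightarrow> nat \<Rightarrow> ((nat \<Rightarrow> int \<Rightarrow> nat) \<Rightarrow> real) \<Rightarrow> (nat \<Rightarrow> int \<Rightarrow> nat) set \<Rightarrow> real" where
  "pavg p n f B = (\<integral>y\<in>B. f y \<partial>haar p n) / measure (haar p n) B"

definition pBMO :: "nat \<Rightarrow> nat \<Rightarrow> ((nat \<Rightarrow> int \<Rightarrow> nat) \<Rightarrow> real) \<Rightarrow> bool" where
  "pBMO p n b \<longleftrightarrow> loc_integrable p n b \<and>
     (SUP (\<gamma>, x)\<in>UNIV \<times> Qpn p n.
        ennreal (1 / measure (haar p n) (pball p n \<gamma> x)) *
        (\<integral>\<^sup>+ y\<in>pball p n \<gamma> x. ennreal \<bar>b y - pavg p n b (pball p n \<gamma> x)\<bar> \<partial>haar p n)) < \<infinity>"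

definition pLinf :: "nat \<Rightarrow> nat \<Rightarrow> ((nat \<Rightarrow> int \<Rightarrow> nat) \<Rightarrow> real) \<Rightarrow> bool" where
  "pLinf p n f \<longleftrightarrow> f \<in> borel_measurable (haar p n) \<and> (\<exists>C. AE x in haar p n. \<bar>f x\<bar> \<le> C)"

definition frac_max :: "nat \<Rightarrow> nat \<Rightarrow> real \<Rightarrow> ((nat \<Rightarrow> int \<Rightarrow> nat) \<Rightarrow> real) \<Rightarrow> (nat \<Rightarrow> int \<Rightarrow> nat) \<Rightarrow> ennreal" where
  "frac_max p n \<alpha> f x = (SUP \<gamma>. ennreal (measure (haar p n) (pball p n \<gamma> x) powr (\<alpha> / real n - 1)) *
       (\<integral>\<^sup>+ y\<in>pball p n \<gamma> x. ennreal \<bar>f y\<bar> \<partial>haar p n))"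

text \<open>The commutator [b, M_alpha](f) = b M_alpha(f) - M_alpha(b f) (meaningful where both
  maximal functions are finite; finiteness a.e. is required in the boundedness notion).\<close>

definition frac_max_comm :: "nat \<Rightarrow> nat \<Rightarrow> real \<Rightarrow> ((nat \<Rightarrow> int \<Rightarrow> nat) \<Rightarrow> real) \<Rightarrow> ((nat \<Rightarrow> int \<Rightarrow> nat) \<Rightarrow> real) \<Rightarrow> (nat \<Rightarrow> int \<Rightarrow> nat) \<Rightarrow> real" where
  "frac_max_comm p n \<alpha> b f x =
     b x * enn2real (frac_max p n \<alpha> f x) - enn2real (frac_max p n \<alpha> (\<lambda>y. b y * f y) x)"

definition morrey_sup :: "nat \<Rightarrow> nat \<Rightarrow> real \<Rightarrow> real \<Rightarrow> ((nat \<Rightarrow> int \<Rightarrow> nat) \<Rightarrow> real) \<Rightarrow> ennreal" where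
  "morrey_sup p n q lam f = (SUP (\<gamma>, x)\<in>UNIV \<times> Qpn p n.
      ennreal (measure (haar p n) (pball p n \<gamma> x) powr (- lam / real n)) *
      (\<integral>\<^sup>+ y\<in>pball p n \<gamma> x. ennreal (\<bar>f y\<bar> powr q) \<partial>haar p n))"

definition in_morrey :: "nat \<Rightarrow> nat \<Rightarrow> real \<Rightarrow> real \<Rightarrow> ((nat \<Rightarrow> int \<Rightarrow> nat) \<Rightarrow> real) \<Rightarrow> bool" where
  "in_morrey p n q lam f \<longleftrightarrow> f \<in> borel_measurable (haar p n) \<and> morrey_sup p n q lam f < \<infinity>"

definition morrey_norm :: "nat \<Rightarrow> nat \<Rightarrow> real \<Rightarrow> real \<Rightarrow> ((nat \<Rightarrow> int \<Rightarrow> nat) \<Rightarrow> real) \<Rightarrow> real" where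
  "morrey_norm p n q lam f = enn2real (morrey_sup p n q lam f) powr (1 / q)"

definition comm_bounded :: "nat \<Rightarrow> nat \<Rightarrow> real \<Rightarrow> ((nat \<Rightarrow> int \<Rightarrow> nat) \<Rightarrow> real)
      \<Rightarrow> real \<Rightarrow> real \<Rightarrow> real \<Rightarrow> real \<Rightarrow> bool" where
  "comm_bounded p n \<alpha> b r lam q mu \<longleftrightarrow>
     (\<exists>C. \<forall>f. in_morrey p n r lam f \<longrightarrow>
        (AE x in haar p n. frac_max p n \<alpha> f x < \<infinity> \<and> frac_max p n \<alpha> (\<lambda>y. b y * f y) x < \<infinity>) \<and>
        in_morrey p n q mu (frac_max_comm p n \<alpha> b f) \<and>
        morrey_norm p n q mu (frac_max_comm p n \<alpha> b f) \<le> C * morrey_norm p n r lam f)"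

end

theory Submission
  imports Defs "HOL-Real_Asymp.Real_Asymp"
begin

text \<open>
  Sufficiency. The commutator is dominated pointwise by the maximal commutator
  \<open>sup\<^sub>\<gamma> p\<^bsup>\<gamma>(\<alpha> - n)\<^esup> \<integral> \<bar>b(x) - b(y)\<bar> \<bar>f(y)\<bar>\<close> plus \<open>2 b\<^sup>- M f\<close>, and both suprema are bounded by
  the corresponding sums over \<open>\<gamma>\<close> of \<open>q\<close>-th powers. In each summand \<open>b\<close> minus its average over the
  \<open>\<gamma>\<close>-ball has bounded moments by the John--Nirenberg inequality, while the other factor is constant
  on \<open>\<gamma>\<close>-balls, so the weight integrates out. Splitting \<open>f\<close> at the height \<open>p\<^bsup>-\<gamma>(n - \<lambda>)/r\<^esup>\<close> turns
  the remaining sum into geometric series; this replaces the maximal theorem. The second target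
  space contains the first by a Hoelder-type embedding.

  Necessity. Test on the indicator of a ball \<open>B\<close>: on \<open>B\<close> one has \<open>M 1\<^sub>B = \<bar>B\<bar>\<^bsup>\<alpha>/n\<^esup>\<close> and
  \<open>M(b 1\<^sub>B) \<ge> \<bar>B\<bar>\<^bsup>\<alpha>/n\<^esup> A\<close>, where \<open>A\<close> is the average of \<open>\<bar>b\<bar>\<close>. Hence \<open>(A - b)\<^sup>+\<close> has bounded averages;
  since \<open>A\<close> dominates the average of \<open>b\<close>, this bounds the mean oscillation of \<open>b\<close> and the averages
  of \<open>b\<^sup>-\<close>, and Lebesgue differentiation bounds \<open>b\<^sup>-\<close> itself.
\<close>

text \<open>Summing q-th powers over all scales instead of taking a supremum is affordable because r
  < q. Put \<rho> = (n - lam) / r. At a fixed point y the part of f below the height p^(-\<gamma>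
  \<rho>) carries a weight that increases with \<gamma>, the part above it a weight that decreases,
  and both peak at the scale where the height is about |f(y)|; the total is of order |f(y)|^r. An
  exponent s strictly between 1 and r is inserted: s > 1 leaves a finite conjugate exponent for b
  minus its average, s < r makes the second series converge. At scales larger than the ball of
  integration the average of b drifts, but only linearly in the number of levels, while the rest
  decays by p^(-(n - lam)) per level. Balls of one radius partition the space, and coarser ones are
  unions of finer ones. Averaging is therefore a conditional expectation, which replaces all
  covering arguments. Both claims are instances of one equivalence governed by the scaling relation
  (n - mu) / q = (n - lam) / r - \<alpha>, which makes the tests on balls independent of the
  radius.\<close>

locale padic =
  fixes p n :: nat
  assumes p_ge_2: "2 \<le> p" and n_ge_1: "1 \<le> n"
begin

abbreviation "X \<equiv> Qpn p n"
abbreviation "B \<equiv> pball p n"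
abbreviation "\<mu> \<equiv> haar p n"
abbreviation P :: "real \<Rightarrow> real" where "P t \<equiv> real p powr t"

lemma p_pos [simp]: "p \<noteq> 0" "0 < p"
  using p_ge_2 by auto

lemma P_pos [simp]: "0 < P t" "P t \<noteq> 0" "0 \<le> P t"
  using p_ge_2 by auto

lemma P_le_iff [simp]: "P s \<le> P t \<longleftrightarrow> s \<le> t"
  using p_ge_2 by (simp add: powr_le_cancel_iff)

lemma P_less_iff [simp]: "P s < P t \<longleftrightarrow> s < t"
  using p_ge_2 by (simp add: powr_less_cancel_iff)

lemma P_le_1_iff [simp]: "P t \<le> 1 \<longleftrightarrow> t \<le> 0" and one_le_P_iff [simp]: "1 \<le> P t \<longleftrightarrow> 0 \<le> t"
  using P_le_iff[of t 0] P_le_iff[of 0 t] p_ge_2 unfolding powr_zero_eq_one by auto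

subsection \<open>Balls as cylinder sets\<close>

text \<open>\<open>LEAST\<close> over the integers is meaningful here only because both digit
  sequences vanish far to the left, so the indices of disagreement are bounded below.\<close>

lemma padic_dist_le_iff:
  assumes "a \<in> Qp p" "c \<in> Qp p"
  shows "padic_dist p a c \<le> P (of_int \<gamma>) \<longleftrightarrow> (\<forall>k< -\<gamma>. a k = c k)"
proof (cases "a = c")
  case False
  obtain N1 N2 where N: "\<forall>k<N1. a k = 0" "\<forall>k<N2. c k = 0"
    using assms by (auto simp: Qp_def)
  define N where "N = min N1 N2"
  obtain k0 where k0: "a k0 \<noteq> c k0" using False by auto
  have lb: "N \<le> k" if "a k \<noteq> c k" for k
    using N that unfolding N_def by (metis min.strict_boundedE not_le)
  \<comment> \<open>Cutting off at a known disagreement \<open>k0\<close> makes the set finite, so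
    that its minimum exists.\<close>
  define K where "K = {k. a k \<noteq> c k \<and> k \<le> k0}"
  have fin: "finite K"
    by (rule finite_subset[of _ "{N..k0}"]) (auto simp: K_def lb)
  have kin: "k0 \<in> K" using k0 by (simp add: K_def)
  define m where "m = Min K"
  have m: "m \<in> K" "\<And>k. k \<in> K \<Longrightarrow> m \<le> k" unfolding m_def using fin kin by (auto intro: Min_in)
  have least: "(LEAST k. a k \<noteq> c k) = m"
    by (rule Least_equality) (use m kin in \<open>auto simp: K_def\<close>, smt (verit) K_def m(2) mem_Collect_eq)
  have "m \<le> k" if "a k \<noteq> c k" for k
    using m that by (cases "k \<le> k0") (auto simp: K_def)
  then have "- m \<le> \<gamma> \<longleftrightarrow> (\<forall>k < -\<gamma>. a k = c k)"
    using m(1) unfolding K_def by (smt (verit) mem_Collect_eq)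
  moreover have "- real_of_int m \<le> real_of_int \<gamma> \<longleftrightarrow> - m \<le> \<gamma>" by linarith
  ultimately show ?thesis using False least
    by (simp add: padic_dist_def)
qed (simp add: padic_dist_def)

lemma pball_eq:
  assumes "x \<in> X"
  shows "B \<gamma> x = {y \<in> X. \<forall>j<n. \<forall>k< -\<gamma>. y j k = x j k}"
proof -
  have "padic_vdist p n y x \<le> P (of_int \<gamma>) \<longleftrightarrow> (\<forall>j<n. \<forall>k< -\<gamma>. y j k = x j k)" if "y \<in> X" for y
  proof -
    have "padic_vdist p n y x \<le> P (of_int \<gamma>) \<longleftrightarrow> (\<forall>j<n. padic_dist p (y j) (x j) \<le> P (of_int \<gamma>))"
      unfolding padic_vdist_def using n_ge_1 by (subst Max_le_iff) (auto simp: lessThan_empty_iff)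
    also have "\<dots> \<longleftrightarrow> (\<forall>j<n. \<forall>k< -\<gamma>. y j k = x j k)"
      using assms that by (simp add: padic_dist_le_iff Qpn_def)
    finally show ?thesis .
  qed
  then show ?thesis unfolding pball_def by auto
qed

lemma pball_subset: "B \<gamma> x \<subseteq> X"
  by (auto simp: pball_def)

lemma pball_self [simp]: "x \<in> X \<Longrightarrow> x \<in> B \<gamma> x"
  by (simp add: pball_eq)

lemma pball_cong: "x \<in> X \<Longrightarrow> y \<in> B \<gamma> x \<Longrightarrow> B \<gamma> y = B \<gamma> x"
  using pball_subset[of \<gamma> x] by (auto simp: pball_eq)

lemma pball_cong': "x \<in> X \<Longrightarrow> y \<in> B \<gamma> x \<Longrightarrow> \<gamma> \<le> \<gamma>' \<Longrightarrow> B \<gamma>' y = B \<gamma>' x"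
  using pball_subset[of \<gamma> x] by (auto simp: pball_eq)

lemma pball_mono: "x \<in> X \<Longrightarrow> \<gamma> \<le> \<gamma>' \<Longrightarrow> B \<gamma> x \<subseteq> B \<gamma>' x"
  by (auto simp: pball_eq)

subsection \<open>Existence of the Haar measure\<close>

text \<open>The measure is the image of Lebesgue measure on \<open>[0, \<infinity>)\<close> under the map that deals out the
  base \<open>p\<close> digits of a real number to the \<open>n\<close> coordinates in turn: preimages of balls are intervals.\<close>

definition digit :: "real \<Rightarrow> int \<Rightarrow> nat" where
  "digit t m = nat (\<lfloor>t * real p powi (m + 1)\<rfloor> mod int p)"

text \<open>Coordinate \<open>j\<close> receives the positions congruent to \<open>j\<close> modulo
  \<open>n\<close>. Fixing the digits below -\<gamma> in all coordinates thus fixes exactly the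
  positions below -n \<gamma>, an initial segment.\<close>

definition of_real_digits :: "real \<Rightarrow> nat \<Rightarrow> int \<Rightarrow> nat" where
  "of_real_digits t = (\<lambda>j k. if j < n then digit t (int n * k + int j) else 0)"

lemma digit_less: "digit t m < p"
  unfolding digit_def using p_ge_2 by (simp add: nat_less_iff)

lemma floor_step: "\<lfloor>t * real p powi m\<rfloor> = \<lfloor>t * real p powi (m + 1)\<rfloor> div int p"
proof -
  have "t * real p powi m = t * real p powi (m + 1) / real_of_int (int p)"
    using p_ge_2 by (simp add: power_int_add)
  then show ?thesis by (simp only: floor_divide_real_eq_div[OF of_nat_0_le_iff])
qed

lemma digit_step: "\<lfloor>t * real p powi (m + 1)\<rfloor> = int p * \<lfloor>t * real p powi m\<rfloor> + int (digit t m)"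
  unfolding floor_step[of t m] digit_def using p_ge_2 by simp

lemma powi_mono: "m \<le> m' \<Longrightarrow> real p powi m \<le> real p powi m'"
  using p_ge_2 by (intro power_int_increasing) auto

lemma eventually_small:
  assumes "0 \<le> t"
  obtains m0 where "m0 \<le> M" "t * real p powi m0 < 1"
proof -
  obtain N :: nat where "t < real p ^ N"
    using real_arch_pow[of "real p" t] p_ge_2 by auto
  then have "t * real p powi (- int N) < 1"
    using p_ge_2 by (simp add: power_int_minus field_simps)
  moreover have "t * real p powi (min M (- int N)) \<le> t * real p powi (- int N)"
    using assms by (intro mult_left_mono powi_mono) auto
  ultimately show ?thesis by (intro that[of "min M (- int N)"]) auto
qed

text \<open>The reverse direction climbs from a level so coarse that the floor is 0; by
  \<open>digit_step\<close> the floor stays 0 as long as the digits do.\<close>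

lemma floor_zero_iff: 
  assumes "0 \<le> t"
  shows "\<lfloor>t * real p powi M\<rfloor> = 0 \<longleftrightarrow> (\<forall>m<M. digit t m = 0)"
proof
  assume *: "\<lfloor>t * real p powi M\<rfloor> = 0"
  show "\<forall>m<M. digit t m = 0"
  proof (intro allI impI)
    fix m assume "m < M"
    then have "t * real p powi (m + 1) \<le> t * real p powi M"
      using assms by (intro mult_left_mono powi_mono) auto
    moreover have "t * real p powi M < 1" using * by linarith
    moreover have "0 \<le> t * real p powi (m + 1)" using assms p_ge_2 by auto
    ultimately have "\<lfloor>t * real p powi (m + 1)\<rfloor> = 0" by linarith
    then show "digit t m = 0" by (simp add: digit_def)
  qed
next
  assume *: "\<forall>m<M. digit t m = 0"
  obtain m0 where m0: "m0 \<le> M" "t * real p powi m0 < 1" using eventually_small[OF assms] .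
  have "M' \<le> M \<longrightarrow> \<lfloor>t * real p powi M'\<rfloor> = 0" if "m0 \<le> M'" for M'
    using that
  proof (induction M' rule: int_ge_induct)
    case base
    have "0 \<le> t * real p powi m0" using assms p_ge_2 by auto
    then show ?case using m0 by linarith
  next
    case (step i)
    show ?case using step digit_step[of t i] * by auto
  qed
  then show "\<lfloor>t * real p powi M\<rfloor> = 0" using m0 by simp
qed

text \<open>\<open>N\<close> is the integer whose base p digits are those of \<open>d\<close> below
  \<open>M\<close>. Working with floors avoids any question about uniqueness of expansions:
  \<open>digit\<close> never ends in p - 1 forever, which is harmless because only the positions
  below \<open>M\<close> are compared.\<close>

lemma digits_interval:
  assumes "\<forall>m<L. d m = 0" "\<And>m. d m < p"
  obtains N :: int where "0 \<le> N"
    "\<And>t. 0 \<le> t \<Longrightarrow> (\<forall>m<M. digit t m = d m) \<longleftrightarrow> \<lfloor>t * real p powi M\<rfloor> = N"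
proof -
  have "\<exists>N\<ge>0. \<forall>t\<ge>0. (\<forall>m<M. digit t m = d m) \<longleftrightarrow> \<lfloor>t * real p powi M\<rfloor> = N"
  proof (cases "M \<le> L")
    case True
    then have "\<forall>m<M. d m = 0" using assms by auto
    then show ?thesis using floor_zero_iff[of _ M] by (intro exI[of _ 0]) auto
  next
    case False
    then have "L \<le> M" by simp
    then show ?thesis
    proof (induction M rule: int_ge_induct)
      case base
      then show ?case using assms(1) floor_zero_iff[of _ L] by (intro exI[of _ 0]) auto
    next
      case (step M)
      then obtain N where N: "0 \<le> N" "\<forall>t\<ge>0. (\<forall>m<M. digit t m = d m) \<longleftrightarrow> \<lfloor>t * real p powi M\<rfloor> = N"
        by auto
      have split: "(\<forall>m<M+1. Q m) \<longleftrightarrow> (\<forall>m<M. Q m) \<and> Q M" for Q :: "int \<Rightarrow> bool"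
        by (smt (verit))
      have "(\<forall>m<M+1. digit t m = d m) \<longleftrightarrow> \<lfloor>t * real p powi (M+1)\<rfloor> = int p * N + int (d M)"
        if t: "0 \<le> t" for t
      proof -
        have "(\<forall>m<M+1. digit t m = d m) \<longleftrightarrow> \<lfloor>t * real p powi M\<rfloor> = N \<and> digit t M = d M"
          unfolding split using N(2) t by auto
        also have "\<dots> \<longleftrightarrow> \<lfloor>t * real p powi (M+1)\<rfloor> = int p * N + int (d M)"
        proof
          assume "\<lfloor>t * real p powi M\<rfloor> = N \<and> digit t M = d M"
          then show "\<lfloor>t * real p powi (M+1)\<rfloor> = int p * N + int (d M)"
            using digit_step[of t M] by simp
        next
          assume *: "\<lfloor>t * real p powi (M+1)\<rfloor> = int p * N + int (d M)"
          have "d M < p" by (rule assms)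
          then have "\<lfloor>t * real p powi M\<rfloor> = N" "digit t M = d M"
            unfolding floor_step[of t M] digit_def * by auto
          then show "\<lfloor>t * real p powi M\<rfloor> = N \<and> digit t M = d M" by simp
        qed
        finally show ?thesis .
      qed
      then show ?case using N(1) by (intro exI[of _ "int p * N + int (d M)"]) auto
    qed
  qed
  then show ?thesis using that by blast
qed

lemma of_real_digits_in: "0 \<le> t \<Longrightarrow> of_real_digits t \<in> X"
proof -
  assume t: "0 \<le> t"
  obtain m0 where m0: "m0 \<le> (0::int)" "t * real p powi m0 < 1" using eventually_small[OF t] .
  have "0 \<le> t * real p powi m0" using t p_ge_2 by auto
  then have "\<lfloor>t * real p powi m0\<rfloor> = 0" using m0 by linarith
  then have z: "digit t m = 0" if "m < m0" for m using floor_zero_iff[OF t] that by auto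
  \<comment> \<open>The extra 1 absorbs the offset j < n, and m0 <= 0 gives n (m0 - 1) <= m0 -
    1.\<close>
  have "digit t (int n * k + int j) = 0" if "k < m0 - 1" "j < n" for k j
  proof (rule z)
    have "int n * k \<le> int n * (m0 - 1) - int n"
      using that n_ge_1 mult_left_mono[of "k + 1" "m0 - 1" "int n"] by (simp add: algebra_simps)
    moreover have "int n * (m0 - 1) \<le> m0 - 1"
      using mult_right_mono_neg[of 1 "int n" "m0 - 1"] n_ge_1 m0 by simp
    ultimately show "int n * k + int j < m0" using that by linarith
  qed
  then show ?thesis
    by (auto simp: of_real_digits_def Qpn_def Qp_def digit_less intro!: exI[of _ "m0 - 1"])
qed

lemma of_real_digits_vimage:
  assumes "x \<in> X"
  obtains a where "{t\<in>{0..}. of_real_digits t \<in> B \<gamma> x} = {a ..< a + P (real n * of_int \<gamma>)}"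
proof -
  \<comment> \<open>Inverse of the dealing out: position \<open>m\<close> belongs to coordinate m
    mod n, at index m div n.\<close>
  define d where "d m = x (nat (m mod int n)) (m div int n)" for m
  have "\<exists>N. \<forall>k<N. x j k = 0" for j
    using assms by (cases "j < n") (auto simp: Qpn_def Qp_def)
  then obtain N where N: "\<And>j k. k < N j \<Longrightarrow> x j k = 0" by metis
  define N0 where "N0 = Min (N ` {..<n})"
  have dig0: "x j k = 0" if "k < N0" "j < n" for j k
  proof (rule N)
    have "N0 \<le> N j" unfolding N0_def by (rule Min_le) (use that in auto)
    then show "k < N j" using that by simp
  qed
  have mod_n: "nat (m mod int n) < n" for m
    using n_ge_1 by (simp add: nat_less_iff)
  have div_less_iff: "m div int n < k \<longleftrightarrow> m < int n * k" for m k
  proof -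
    have "int n * k \<le> m" if "k \<le> m div int n"
      using n_ge_1 mult_left_mono[OF that, of "int n"]
        mult_div_mod_eq[of "int n" m] pos_mod_sign[of "int n" m] by linarith
    moreover have "k \<le> m div int n" if "int n * k \<le> m"
      using n_ge_1 zdiv_mono1[OF that, of "int n"] by simp
    ultimately show ?thesis by linarith
  qed
  have d1: "\<forall>m<int n * N0. d m = 0"
    unfolding d_def using mod_n by (auto intro!: dig0 simp: div_less_iff)
  have d2: "d m < p" for m
    using assms mod_n[of m] p_ge_2 by (auto simp: d_def Qpn_def Qp_def)
  define M where "M = int n * (-\<gamma>)"
  obtain N1 :: int where N1: "0 \<le> N1"
    "\<And>t. 0 \<le> t \<Longrightarrow> (\<forall>m<M. digit t m = d m) \<longleftrightarrow> \<lfloor>t * real p powi M\<rfloor> = N1"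
    using digits_interval[OF d1 d2, where M = M] by metis
  have iff: "of_real_digits t \<in> B \<gamma> x \<longleftrightarrow> (\<forall>m<M. digit t m = d m)" if t: "0 \<le> t" for t
  proof -
    have "of_real_digits t \<in> B \<gamma> x \<longleftrightarrow> (\<forall>j<n. \<forall>k< -\<gamma>. digit t (int n * k + int j) = x j k)"
      using of_real_digits_in[OF t] assms by (auto simp: pball_eq of_real_digits_def)
    also have "\<dots> \<longleftrightarrow> (\<forall>m<M. digit t m = d m)"
    proof safe
      fix m assume *: "\<forall>j<n. \<forall>k< -\<gamma>. digit t (int n * k + int j) = x j k" "m < M"
      have "m div int n < -\<gamma>" using *(2) by (simp add: div_less_iff M_def)
      then have "digit t (int n * (m div int n) + int (nat (m mod int n))) = d m"
        using * mod_n[of m] unfolding d_def by blast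
      moreover have "int n * (m div int n) + int (nat (m mod int n)) = m"
        using n_ge_1 by simp
      ultimately show "digit t m = d m" by simp
    next
      fix j k assume *: "\<forall>m<M. digit t m = d m" "j < n" "k < -\<gamma>"
      have 1: "(int n * k + int j) div int n = k" "nat ((int n * k + int j) mod int n) = j"
        using *(2) by auto
      have "(int n * k + int j) < M" 
        unfolding M_def div_less_iff[symmetric] 1 using * by simp
      then show "digit t (int n * k + int j) = x j k"
        using * 1 unfolding d_def by auto
    qed
    finally show ?thesis .
  qed
  have pM: "real p powi M = 1 / P (real n * of_int \<gamma>)"
  proof -
    have "real p powi M = P (of_int M)"
      using p_ge_2 by (simp add: powr_real_of_int')
    also have "\<dots> = P (- (real n * of_int \<gamma>))" by (simp add: M_def)
    finally show ?thesis by (simp add: powr_minus_divide)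
  qed
  define c where "c = P (real n * of_int \<gamma>)"
  have c: "0 < c" unfolding c_def by (rule P_pos)
  have "{t\<in>{0..}. of_real_digits t \<in> B \<gamma> x} = {t\<in>{0..}. \<lfloor>t / c\<rfloor> = N1}"
    using iff N1(2) pM by (auto simp: c_def)
  also have "\<dots> = {N1 * c ..< N1 * c + c}"
  proof -
    have "0 \<le> N1 * c" using N1 c by simp
    then show ?thesis using c by (auto simp: floor_eq_iff field_simps)
  qed
  finally show ?thesis using that unfolding c_def by blast
qed

lemma haar_space [simp]: "space \<mu> = X"
  unfolding haar_def by (rule space_extend_measure) (auto simp: pball_subset[THEN subsetD])

lemma haar_sets: "sets \<mu> = sigma_sets X ((\<lambda>(\<gamma>, x). B \<gamma> x) ` (UNIV \<times> X))"
  unfolding haar_def by (rule sets_extend_measure) (auto simp: pball_subset[THEN subsetD])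

lemma pball_sets [measurable]: "x \<in> X \<Longrightarrow> B \<gamma> x \<in> sets \<mu>"
  unfolding haar_sets by (rule sigma_sets.Basic) auto

text \<open>\<open>extend_measure\<close> takes the prescribed values only if some measure on the
  generated sigma-algebra has them. The image \<open>?D\<close> of Lebesgue measure on the half line
  is this witness; \<open>?S\<close> merely supplies the sigma-algebra.\<close>

lemma emeasure_pball:
  assumes "x \<in> X"
  shows "emeasure \<mu> (B \<gamma> x) = ennreal (P (real n * of_int \<gamma>))"
proof -
  let ?G = "\<lambda>(\<gamma>, x). B \<gamma> x"
  let ?R = "restrict_space lborel {0::real..}"
  let ?S = "measure_of X (?G ` (UNIV \<times> X)) (\<lambda>_. 0)"
  have sub: "?G ` (UNIV \<times> X) \<subseteq> Pow X" using pball_subset by auto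
  have vim: "of_real_digits -` B \<gamma> x \<inter> space ?R = {t\<in>{0..}. of_real_digits t \<in> B \<gamma> x}" for \<gamma> x
    by (auto simp: space_restrict_space)
  have meas: "of_real_digits \<in> measurable ?R ?S"
  proof (rule measurable_measure_of[OF sub])
    show "of_real_digits \<in> space ?R \<rightarrow> X"
      by (auto simp: space_restrict_space of_real_digits_in)
    fix y assume "y \<in> ?G ` (UNIV \<times> X)"
    then obtain \<gamma> x where y: "y = B \<gamma> x" "x \<in> X" by auto
    obtain a where "{t\<in>{0..}. of_real_digits t \<in> B \<gamma> x} = {a ..< a + P (real n * of_int \<gamma>)}"
      using of_real_digits_vimage[OF y(2)] .
    moreover from this have "{a ..< a + P (real n * of_int \<gamma>)} \<subseteq> {0..}" by blast
    ultimately show "of_real_digits -` y \<inter> space ?R \<in> sets ?R"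
      unfolding y vim by (subst sets_restrict_space_iff) auto
  qed
  let ?D = "distr ?R ?S of_real_digits"
  have sD: "sets ?D = sets \<mu>" using sub by (simp add: haar_sets)
  have eD: "emeasure ?D (B \<gamma> x) = ennreal (P (real n * of_int \<gamma>))" if x: "x \<in> X" for \<gamma> x
  proof -
    obtain a where a: "{t\<in>{0..}. of_real_digits t \<in> B \<gamma> x} = {a ..< a + P (real n * of_int \<gamma>)}"
      using of_real_digits_vimage[OF x] .
    then have sub0: "{a ..< a + P (real n * of_int \<gamma>)} \<subseteq> {0..}" by blast
    have "of_real_digits -` B \<gamma> x \<inter> {0..} = {a ..< a + P (real n * of_int \<gamma>)}"
      using a by auto
    moreover have "B \<gamma> x \<in> sets ?S" using pball_sets[OF x] sD by simp
    ultimately have "emeasure ?D (B \<gamma> x) = emeasure lborel {a ..< a + P (real n * of_int \<gamma>)}"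
      by (subst emeasure_distr[OF meas]) (auto simp: emeasure_restrict_space sub0 space_restrict_space)
    then show ?thesis by (simp add: less_imp_le)
  qed
  have "emeasure \<mu> (?G (\<gamma>, x)) = (case (\<gamma>, x) of (\<gamma>, x) \<Rightarrow> ennreal (P (real n * of_int \<gamma>)))"
  proof (rule emeasure_extend_measure[where \<mu>' = "emeasure ?D", OF haar_def])
    show "positive (sets \<mu>) (emeasure ?D)" "countably_additive (sets \<mu>) (emeasure ?D)"
      using emeasure_positive[of ?D] emeasure_countably_additive[of ?D] unfolding sD .
  qed (use eD assms sub in auto)
  then show ?thesis by simp
qed

lemma measure_pball: "x \<in> X \<Longrightarrow> measure \<mu> (B \<gamma> x) = P (real n * of_int \<gamma>)"
  by (simp add: measure_def emeasure_pball)

end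

text \<open>The sets that can be approximated form a sigma-algebra: for a countable union,
  continuity of the finite measure reduces to finitely many members at the cost of e / 2.\<close>

lemma (in finite_measure) approximate_by_algebra:
  assumes alg: "algebra (space M) G" and sM: "sets M = sigma_sets (space M) G"
    and A: "A \<in> sets M" and e: "0 < e"
  shows "\<exists>U\<in>G. measure M (sym_diff A U) < e"
proof -
  interpret algebra "space M" G by (rule alg)
  have sub: "G \<subseteq> sets M" unfolding sM by auto
  have "\<forall>e>0. \<exists>U\<in>G. measure M (sym_diff A U) < e"
    using A unfolding sM
  proof (induction rule: sigma_sets.induct)
    case (Basic a)
    then show ?case by (auto intro!: bexI[of _ a])
  next
    case Empty
    then show ?case by (auto intro!: bexI[of _ "{}"])
  next
    case (Compl a)
    show ?case
    proof (intro allI impI)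
      fix e :: real assume "0 < e"
      then obtain U where U: "U \<in> G" "measure M (sym_diff a U) < e" using Compl.IH by auto
      have "a \<subseteq> space M" using Compl.hyps sM sets.sets_into_space by blast
      moreover have "U \<subseteq> space M" using U sub sets.sets_into_space by blast
      ultimately have "sym_diff (space M - a) (space M - U) = sym_diff a U" by auto
      then show "\<exists>U\<in>G. measure M (sym_diff (space M - a) U) < e"
        using U by (intro bexI[of _ "space M - U"]) auto
    qed
  next
    case (Union a)
    have aM: "a i \<in> sets M" for i using Union.hyps sM by auto
    show ?case
    proof (intro allI impI)
      fix e :: real assume e: "0 < e"
      let ?A = "\<lambda>N. \<Union>i<N. a i"
      have "(\<lambda>N. measure M (?A N)) \<longlonglongrightarrow> measure M (\<Union>N. ?A N)"
        using aM by (intro finite_Lim_measure_incseq) (auto simp: incseq_def intro: less_le_trans)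
      moreover have un: "(\<Union>N. ?A N) = (\<Union>i. a i)" by auto
      ultimately have "\<forall>\<^sub>F N in sequentially. measure M (\<Union>i. a i) - e / 2 < measure M (?A N)"
        using e by (intro order_tendstoD(1)[of _ "measure M (\<Union>i. a i)"]) auto
      then obtain N where N: "measure M (\<Union>i. a i) - e / 2 < measure M (?A N)"
        by (auto simp: eventually_sequentially)
      \<comment> \<open>\<open>N\<close> errors of this size add up to at most e / 2; the added 1
        keeps the denominator positive when \<open>N\<close> is 0.\<close>
      have "\<exists>U\<in>G. measure M (sym_diff (a i) U) < e / (2 * (real N + 1))" for i
        using Union.IH e by auto
      then obtain U where U: "\<And>i. U i \<in> G" "\<And>i. measure M (sym_diff (a i) (U i)) < e / (2 * (real N + 1))"
        by metis
      have UM: "U i \<in> sets M" for i using U sub by auto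
      have UG: "(\<Union>i<N. U i) \<in> G" using U by (intro finite_UN) auto
      have "measure M (sym_diff (\<Union>i. a i) (\<Union>i<N. U i)) \<le>
          measure M (((\<Union>i. a i) - ?A N) \<union> (\<Union>i<N. sym_diff (a i) (U i)))"
        using aM UM by (intro finite_measure_mono) auto
      also have "\<dots> \<le> measure M ((\<Union>i. a i) - ?A N) + measure M (\<Union>i<N. sym_diff (a i) (U i))"
        using aM UM by (intro measure_Un_le) auto
      also have "measure M ((\<Union>i. a i) - ?A N) = measure M (\<Union>i. a i) - measure M (?A N)"
        using aM by (intro finite_measure_Diff) auto
      also have "measure M (\<Union>i<N. sym_diff (a i) (U i)) \<le> (\<Sum>i<N. measure M (sym_diff (a i) (U i)))"
        using aM UM by (intro finite_measure_subadditive_finite) auto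
      also have "\<dots> \<le> (\<Sum>i<N. e / (2 * (real N + 1)))"
        using U(2) by (intro sum_mono less_imp_le)
      also have "\<dots> \<le> e / 2" using e by (simp add: field_simps)
      finally have "measure M (sym_diff (\<Union>i. a i) (\<Union>i<N. U i)) < e" using N by simp
      then show "\<exists>U\<in>G. measure M (sym_diff (\<Union>i. a i) U) < e" using UG by blast
    qed
  qed
  then show ?thesis using e by blast
qed

context padic begin

subsection \<open>Functions that are constant on the balls of a given radius\<close>

text \<open>Canonical representative of the \<gamma>-ball of \<open>x\<close>: it indexes the
  partition into balls of one radius by a set that can be shown countable.\<close>

definition centre :: "int \<Rightarrow> (nat \<Rightarrow> int \<Rightarrow> nat) \<Rightarrow> nat \<Rightarrow> int \<Rightarrow> nat" where
  "centre \<gamma> x = (\<lambda>j k. if k < -\<gamma> then x j k else 0)"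

lemma centre_in [simp]: "x \<in> X \<Longrightarrow> centre \<gamma> x \<in> X"
  using p_ge_2 by (fastforce simp: Qpn_def Qp_def centre_def)

lemma mem_pball_iff_centre:
  assumes "x \<in> X" "y \<in> X" shows "y \<in> B \<gamma> x \<longleftrightarrow> centre \<gamma> y = centre \<gamma> x"
proof
  assume "y \<in> B \<gamma> x"
  moreover have "y j k = x j k" if "\<not> j < n" for j k using that assms by (auto simp: Qpn_def)
  ultimately show "centre \<gamma> y = centre \<gamma> x"
    using assms unfolding centre_def by (intro ext) (auto simp: pball_eq)
next
  assume "centre \<gamma> y = centre \<gamma> x"
  then have "y j k = x j k" if "k < -\<gamma>" for j k
    using that unfolding centre_def by (metis (mono_tags, lifting))
  then show "y \<in> B \<gamma> x" using assms by (simp add: pball_eq)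
qed

lemma centre_centre [simp]: "centre \<gamma> (centre \<gamma> x) = centre \<gamma> x"
  unfolding centre_def by (intro ext) simp

text \<open>A centre has nonzero digits only in a window from some N up to -\<gamma> - 1, so each
  integer N accounts for finitely many centres.\<close>

lemma countable_centres: "countable (centre \<gamma> ` X)"
proof -
  let ?\<phi> = "\<lambda>N (f :: nat \<times> int \<Rightarrow> nat) j k. if j < n \<and> N \<le> k \<and> k < -\<gamma> then f (j, k) else 0"
  let ?F = "\<lambda>N. PiE ({..<n} \<times> {N..<-\<gamma>}) (\<lambda>_. {..<p})"
  have "centre \<gamma> ` X \<subseteq> (\<Union>N. ?\<phi> N ` ?F N)"
  proof safe
    fix x assume x: "x \<in> X"
    have "\<exists>N. \<forall>k<N. x j k = 0" for j
      using x by (cases "j < n") (auto simp: Qpn_def Qp_def)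
    then obtain N where N: "\<And>j k. k < N j \<Longrightarrow> x j k = 0" by metis
    define N0 where "N0 = Min (N ` {..<n})"
    have "N0 \<le> N j" if "j < n" for j unfolding N0_def by (rule Min_le) (use that in auto)
    then have z: "x j k = 0" if "j < n" "k < N0" for j k using that N by force
    define f where "f = restrict (\<lambda>(j, k). x j k) ({..<n} \<times> {N0..<-\<gamma>})"
    have "f \<in> ?F N0" using x by (auto simp: f_def Qpn_def Qp_def)
    moreover have "centre \<gamma> x = ?\<phi> N0 f"
    proof (intro ext)
      fix j k show "centre \<gamma> x j k = ?\<phi> N0 f j k"
        using x z[of j k] by (cases "j < n") (auto simp: centre_def f_def Qpn_def not_le)
    qed
    ultimately show "centre \<gamma> x \<in> (\<Union>N. ?\<phi> N ` ?F N)" by blast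
  qed
  moreover have "countable (\<Union>N. ?\<phi> N ` ?F N)"
    by (rule countable_UN[OF countableI_type]) (intro countable_image countable_finite finite_PiE, auto)
  ultimately show ?thesis by (rule countable_subset)
qed

text \<open>Measurability with respect to the partition into \<gamma>-balls; a smaller \<gamma>
  means a finer partition and a weaker condition.\<close>

definition level_const :: "int \<Rightarrow> ((nat \<Rightarrow> int \<Rightarrow> nat) \<Rightarrow> 'b) \<Rightarrow> bool" where
  "level_const \<gamma> g \<longleftrightarrow> (\<forall>x\<in>X. \<forall>y\<in>B \<gamma> x. g y = g x)"

lemma level_constD: "level_const \<gamma> g \<Longrightarrow> x \<in> X \<Longrightarrow> y \<in> B \<gamma> x \<Longrightarrow> g y = g x"
  unfolding level_const_def by blast

lemma level_const_mono: "level_const \<gamma> g \<Longrightarrow> \<gamma>' \<le> \<gamma> \<Longrightarrow> level_const \<gamma>' g"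
  using pball_mono unfolding level_const_def by blast

lemma level_const_compose2: "level_const \<gamma> g \<Longrightarrow> level_const \<gamma> h \<Longrightarrow> level_const \<gamma> (\<lambda>x. F (g x) (h x))"
  unfolding level_const_def by metis

lemma level_const_compose: "level_const \<gamma> g \<Longrightarrow> level_const \<gamma> (\<lambda>x. F (g x))"
  unfolding level_const_def by metis

lemma level_const_ball: "level_const \<gamma> (\<lambda>x. F (B \<gamma> x))"
  unfolding level_const_def by (metis pball_cong)

lemma level_const_mem_pball: "x0 \<in> X \<Longrightarrow> \<gamma> \<le> \<gamma>0 \<Longrightarrow> level_const \<gamma> (\<lambda>x. x \<in> B \<gamma>0 x0)"
  unfolding level_const_def by (metis pball_cong pball_cong' pball_self pball_subset subsetD)

lemma level_const_indicator_pball: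
  "x0 \<in> X \<Longrightarrow> \<gamma> \<le> \<gamma>0 \<Longrightarrow> level_const \<gamma> (indicator (B \<gamma>0 x0) :: _ \<Rightarrow> 'b :: zero_neq_one)"
  using level_const_compose[OF level_const_mem_pball[of x0 \<gamma> \<gamma>0], of of_bool]
  by (simp add: indicator_def[abs_def] of_bool_def)

lemma level_const_measurable:
  assumes "level_const \<gamma> g" "g \<in> X \<rightarrow> space M"
  shows "g \<in> measurable \<mu> M"
proof (rule measurableI)
  fix A assume "A \<in> sets M"
  have "g -` A \<inter> space \<mu> = (\<Union>z\<in>{z\<in>centre \<gamma> ` X. g z \<in> A}. B \<gamma> z)"
  proof (intro equalityI subsetI)
    fix x assume "x \<in> g -` A \<inter> space \<mu>"
    then have x: "x \<in> space \<mu>" "g x \<in> A" by auto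
    then have "x \<in> B \<gamma> (centre \<gamma> x)" by (simp add: mem_pball_iff_centre)
    moreover from this have "g (centre \<gamma> x) \<in> A"
      using level_constD[OF assms(1)] x by (metis centre_in haar_space)
    ultimately show "x \<in> (\<Union>z\<in>{z\<in>centre \<gamma> ` X. g z \<in> A}. B \<gamma> z)" using x by auto
  next
    fix x assume "x \<in> (\<Union>z\<in>{z\<in>centre \<gamma> ` X. g z \<in> A}. B \<gamma> z)"
    then obtain y where *: "g (centre \<gamma> y) \<in> A" "x \<in> B \<gamma> (centre \<gamma> y)" "y \<in> X" by auto
    then have "g x \<in> A" using level_constD[OF assms(1)] by (metis centre_in)
    then show "x \<in> g -` A \<inter> space \<mu>" using * pball_subset by auto
  qed
  also have "\<dots> \<in> sets \<mu>"
    by (intro sets.countable_UN' countable_subset[OF _ countable_centres]) auto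
  finally show "g -` A \<inter> space \<mu> \<in> sets \<mu>" .
qed (use assms in auto)

lemma level_const_borel_measurable:
  "level_const \<gamma> g \<Longrightarrow> g \<in> borel_measurable \<mu>"
  by (rule level_const_measurable) auto

lemma nn_integral_eq_sum_balls:
  assumes [measurable]: "F \<in> borel_measurable \<mu>"
  shows "(\<integral>\<^sup>+x. F x \<partial>\<mu>) = (\<integral>\<^sup>+z. (\<integral>\<^sup>+x\<in>B \<gamma> z. F x \<partial>\<mu>) \<partial>count_space (centre \<gamma> ` X))"
proof -
  have "(\<integral>\<^sup>+x. F x \<partial>\<mu>) = (\<integral>\<^sup>+x. \<integral>\<^sup>+z. F x * indicator (B \<gamma> z) x \<partial>count_space (centre \<gamma> ` X) \<partial>\<mu>)"
  proof (rule nn_integral_cong)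
    fix x assume "x \<in> space \<mu>"
    then have x: "x \<in> X" by simp
    have "(\<integral>\<^sup>+z. F x * indicator (B \<gamma> z) x \<partial>count_space (centre \<gamma> ` X)) =
      (\<integral>\<^sup>+z. F x * indicator {centre \<gamma> x} z \<partial>count_space (centre \<gamma> ` X))"
    proof (rule nn_integral_cong)
      fix z assume "z \<in> space (count_space (centre \<gamma> ` X))"
      then have "x \<in> B \<gamma> z \<longleftrightarrow> z = centre \<gamma> x"
        using x by (auto simp: mem_pball_iff_centre)
      then show "F x * indicator (B \<gamma> z) x = F x * indicator {centre \<gamma> x} z"
        by (simp add: indicator_def)
    qed
    also have "\<dots> = F x"
      using x by (subst nn_integral_cmult_indicator) (auto simp: one_ennreal_def[symmetric])
    finally show "F x = (\<integral>\<^sup>+z. F x * indicator (B \<gamma> z) x \<partial>count_space (centre \<gamma> ` X))" by simp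
  qed
  also have "\<dots> = (\<integral>\<^sup>+z. (\<integral>\<^sup>+x\<in>B \<gamma> z. F x \<partial>\<mu>) \<partial>count_space (centre \<gamma> ` X))"
    by (rule nn_integral_count_space_nn_integral[OF countable_centres]) auto
  finally show ?thesis .
qed

text \<open>Conditional expectation onto the partition into \<gamma>-balls. Values in
  \<open>ennreal\<close> spare all integrability side conditions.\<close>

definition nnavg :: "int \<Rightarrow> ((nat \<Rightarrow> int \<Rightarrow> nat) \<Rightarrow> ennreal) \<Rightarrow> (nat \<Rightarrow> int \<Rightarrow> nat) \<Rightarrow> ennreal" where
  "nnavg \<gamma> h x = ennreal (P (- (real n * of_int \<gamma>))) * (\<integral>\<^sup>+y\<in>B \<gamma> x. h y \<partial>\<mu>)"

lemma P_minus_cancel [simp]: "ennreal (P (- t)) * ennreal (P t) = 1" "ennreal (P t) * ennreal (P (- t)) = 1"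
  using p_ge_2 by (auto simp: ennreal_mult'[symmetric] powr_add[symmetric])

lemma nn_integral_pball: "(\<integral>\<^sup>+y\<in>B \<gamma> x. h y \<partial>\<mu>) = ennreal (P (real n * of_int \<gamma>)) * nnavg \<gamma> h x"
  unfolding nnavg_def mult.assoc[symmetric] by simp

lemma nnavg_level_const: "level_const \<gamma> (nnavg \<gamma> h)"
  using level_const_ball[of \<gamma> "\<lambda>S. ennreal (P (- (real n * of_int \<gamma>))) * (\<integral>\<^sup>+y\<in>S. h y \<partial>\<mu>)"]
  unfolding nnavg_def[abs_def] .

lemma nnavg_measurable [measurable]: "nnavg \<gamma> h \<in> borel_measurable \<mu>"
  by (rule level_const_borel_measurable[OF nnavg_level_const])

text \<open>The defining identity of a conditional expectation: it is checked on each \<gamma>-ball,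
  where \<open>g\<close> is a constant, and summed over the countable partition.\<close>

lemma nn_integral_level_const_mult:
  assumes [measurable]: "h \<in> borel_measurable \<mu>" and g: "level_const \<gamma> g"
  shows "(\<integral>\<^sup>+x. g x * h x \<partial>\<mu>) = (\<integral>\<^sup>+x. g x * nnavg \<gamma> h x \<partial>\<mu>)"
proof -
  have [measurable]: "g \<in> borel_measurable \<mu>" by (rule level_const_borel_measurable[OF g])
  have "(\<integral>\<^sup>+x\<in>B \<gamma> z. g x * h x \<partial>\<mu>) = (\<integral>\<^sup>+x\<in>B \<gamma> z. g x * nnavg \<gamma> h x \<partial>\<mu>)"
    if z: "z \<in> X" for z
  proof -
    have [measurable]: "B \<gamma> z \<in> sets \<mu>" using z by auto
    have "(\<integral>\<^sup>+x\<in>B \<gamma> z. g x * h x \<partial>\<mu>) = (\<integral>\<^sup>+x. g z * (h x * indicator (B \<gamma> z) x) \<partial>\<mu>)"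
      by (intro nn_integral_cong) (auto simp: indicator_def level_constD[OF g z])
    also have "\<dots> = g z * (\<integral>\<^sup>+x\<in>B \<gamma> z. h x \<partial>\<mu>)" by (rule nn_integral_cmult) auto
    also have "\<dots> = (g z * nnavg \<gamma> h z) * emeasure \<mu> (B \<gamma> z)"
      by (simp add: nn_integral_pball emeasure_pball z ac_simps)
    also have "\<dots> = (\<integral>\<^sup>+x. (g z * nnavg \<gamma> h z) * indicator (B \<gamma> z) x \<partial>\<mu>)"
      by (simp add: nn_integral_cmult_indicator)
    also have "\<dots> = (\<integral>\<^sup>+x\<in>B \<gamma> z. g x * nnavg \<gamma> h x \<partial>\<mu>)"
      by (intro nn_integral_cong)
        (auto simp: indicator_def level_constD[OF g z] level_constD[OF nnavg_level_const z])
    finally show ?thesis .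
  qed
  then show ?thesis
    by (subst (1 2) nn_integral_eq_sum_balls[of _ \<gamma>]) (measurable, intro nn_integral_cong[of "count_space _"], auto)
qed

subsection \<open>Lebesgue differentiation\<close>

text \<open>Unions of balls of one common radius. Finite operations preserve a common radius and
  countable ones in general do not, so this is an algebra that only generates the Borel
  sets.\<close>

definition level_sets :: "(nat \<Rightarrow> int \<Rightarrow> nat) set set" where
  "level_sets = {U. U \<subseteq> X \<and> (\<exists>\<gamma>. level_const \<gamma> (\<lambda>x. x \<in> U))}"

lemma algebra_level_sets: "algebra X level_sets"
proof (subst algebra_iff_Un, intro conjI ballI)
  fix a b assume "a \<in> level_sets" "b \<in> level_sets"
  then obtain \<gamma> \<gamma>' where ab: "a \<subseteq> X" "b \<subseteq> X"
    "level_const \<gamma> (\<lambda>x. x \<in> a)" "level_const \<gamma>' (\<lambda>x. x \<in> b)" unfolding level_sets_def by blast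
  have "level_const (min \<gamma> \<gamma>') (\<lambda>x. x \<in> a \<or> x \<in> b)"
    by (rule level_const_compose2[OF level_const_mono[OF ab(3)] level_const_mono[OF ab(4)], of _ "(\<or>)"]) auto
  then show "a \<union> b \<in> level_sets" using ab unfolding level_sets_def by (auto intro!: exI[of _ "min \<gamma> \<gamma>'"])
next
  fix a assume "a \<in> level_sets"
  then obtain \<gamma> where "a \<subseteq> X" "level_const \<gamma> (\<lambda>x. x \<in> a)" by (auto simp: level_sets_def)
  then have "level_const \<gamma> (\<lambda>x. x \<in> X - a)"
    unfolding level_const_def using pball_subset by blast
  then show "X - a \<in> level_sets" by (auto simp: level_sets_def)
qed (auto simp: level_sets_def level_const_def pball_subset[THEN subsetD])

lemma level_sets_sets: "U \<in> level_sets \<Longrightarrow> U \<in> sets \<mu>"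
proof -
  assume "U \<in> level_sets"
  then obtain \<gamma> where U: "U \<subseteq> X" "level_const \<gamma> (\<lambda>x. x \<in> U)" by (auto simp: level_sets_def)
  have "(\<lambda>x. x \<in> U) \<in> measurable \<mu> (count_space UNIV)"
    by (rule level_const_measurable[OF U(2)]) auto
  then have "{x\<in>space \<mu>. x \<in> U} \<in> sets \<mu>" by measurable
  moreover have "{x\<in>space \<mu>. x \<in> U} = U" using U(1) by auto
  ultimately show ?thesis by simp
qed

lemma sets_eq_sigma_level_sets: "sets \<mu> = sigma_sets X level_sets"
proof
  have "(\<lambda>(\<gamma>, x). B \<gamma> x) ` (UNIV \<times> X) \<subseteq> level_sets"
    using pball_subset level_const_mem_pball by (fastforce simp: level_sets_def)
  then show "sets \<mu> \<subseteq> sigma_sets X level_sets"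
    unfolding haar_sets by (rule sigma_sets_mono')
  have "level_sets \<subseteq> sets \<mu>" using level_sets_sets by auto
  then show "sigma_sets X level_sets \<subseteq> sets \<mu>"
    using sets.sigma_sets_subset[of level_sets \<mu>] by simp
qed

text \<open>One-sided Lebesgue differentiation without a maximal theorem: inside a unit ball the
  integral of \<open>h\<close> over a level set is at most c times its measure. Approximation
  carries this to the set where h > c, which is therefore null.\<close>

lemma AE_le_of_ball_averages:
  fixes c :: real
  assumes [measurable]: "h \<in> borel_measurable \<mu>" and c: "0 \<le> c"
    and avg: "\<And>\<gamma> x. x \<in> X \<Longrightarrow> nnavg \<gamma> h x \<le> ennreal c"
  shows "AE x in \<mu>. h x \<le> ennreal c"
proof -
  have loc: "AE x in \<mu>. x \<in> B 0 z \<longrightarrow> h x \<le> ennreal c" if z: "z \<in> X" for z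
  proof -
    let ?S = "B 0 z"
    have [measurable]: "?S \<in> sets \<mu>" using z by auto
    \<comment> \<open>The density 1 + h makes one approximation control both the Haar measure and
      the integral of \<open>h\<close>.\<close>
    define \<rho> where "\<rho> = density \<mu> (\<lambda>x. indicator ?S x * (1 + h x))"
    have sets_\<rho>: "sets \<rho> = sets \<mu>" "space \<rho> = X" by (simp_all add: \<rho>_def)
    have em: "emeasure \<rho> A = (\<integral>\<^sup>+x. indicator A x * indicator ?S x \<partial>\<mu>) + (\<integral>\<^sup>+x. indicator A x * indicator ?S x * h x \<partial>\<mu>)"
      if [measurable]: "A \<in> sets \<mu>" for A
      unfolding \<rho>_def by (subst emeasure_density) (auto simp: nn_integral_add[symmetric] ac_simps distrib_left distrib_right intro!: nn_integral_cong)
    have hS: "(\<integral>\<^sup>+x. indicator ?S x * h x \<partial>\<mu>) \<le> ennreal c"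
      using avg[OF z, of 0] p_ge_2 by (simp add: nnavg_def mult.commute)
    have "emeasure \<rho> X \<le> emeasure \<mu> ?S + ennreal c"
    proof -
      have "emeasure \<rho> X = (\<integral>\<^sup>+x. indicator ?S x \<partial>\<mu>) + (\<integral>\<^sup>+x. indicator ?S x * h x \<partial>\<mu>)"
        by (subst em) (auto intro!: arg_cong2[where f="(+)"] nn_integral_cong
            simp: sets.top[of \<mu>, simplified] nn_integral_indicator[symmetric] simp del: nn_integral_indicator)
      then show ?thesis using hS by (simp add: add_mono)
    qed
    also have "\<dots> < \<infinity>" using z by (simp add: emeasure_pball)
    finally have "finite_measure \<rho>"
      by (intro finite_measureI) (auto simp: sets_\<rho>)
    then interpret \<rho>: finite_measure \<rho> .
    define A where "A = {x \<in> space \<mu>. x \<in> ?S \<and> ennreal c < h x}"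
    have [measurable]: "A \<in> sets \<mu>" unfolding A_def by measurable
    have AS: "A \<subseteq> ?S" by (auto simp: A_def)
    have \<mu>A: "emeasure \<mu> A \<noteq> \<infinity>"
      using emeasure_mono[OF AS, of \<mu>] z by (auto simp: emeasure_pball top_unique)
    \<comment> \<open>\<open>W\<close> exceeds \<open>A\<close> in measure by at most e, which costs
      c e; the integral of \<open>h\<close> over the part of \<open>A\<close> outside
      \<open>W\<close> costs another e.\<close>
    have "(\<integral>\<^sup>+x. indicator A x * h x \<partial>\<mu>) \<le> ennreal c * emeasure \<mu> A + ennreal ((c + 1) * e)" if e: "0 < e" for e
    proof -
      obtain U where U: "U \<in> level_sets" "measure \<rho> (sym_diff A U) < e"
        using \<rho>.approximate_by_algebra[of level_sets A e] algebra_level_sets e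
        by (auto simp: sets_\<rho> sets_eq_sigma_level_sets[symmetric])
      then obtain \<gamma> where \<gamma>: "level_const \<gamma> (\<lambda>x. x \<in> U)" by (auto simp: level_sets_def)
      have [measurable]: "U \<in> sets \<mu>" using U(1) by (rule level_sets_sets)
      define W where "W = U \<inter> ?S"
      have [measurable]: "W \<in> sets \<mu>" by (simp add: W_def)
      have "level_const (min \<gamma> 0) (\<lambda>x. x \<in> U \<and> x \<in> ?S)"
        by (rule level_const_compose2[OF level_const_mono[OF \<gamma>] level_const_mem_pball[OF z], of _ _ "(\<and>)"]) auto
      then have W: "level_const (min \<gamma> 0) (\<lambda>x. indicator W x :: ennreal)"
        using level_const_compose[where F = of_bool and g = "\<lambda>x. x \<in> U \<and> x \<in> ?S" and \<gamma> = "min \<gamma> 0"]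
        by (simp add: W_def indicator_def[abs_def] of_bool_def)
      have sd: "emeasure \<rho> (sym_diff A U) < ennreal e"
        using U(2) \<rho>.emeasure_eq_measure e by (simp add: ennreal_less_iff)
      have "(\<integral>\<^sup>+x. indicator W x * h x \<partial>\<mu>) = (\<integral>\<^sup>+x. indicator W x * nnavg (min \<gamma> 0) h x \<partial>\<mu>)"
        by (rule nn_integral_level_const_mult[OF _ W]) auto
      also have "\<dots> \<le> (\<integral>\<^sup>+x. indicator W x * ennreal c \<partial>\<mu>)"
        by (intro nn_integral_mono mult_left_mono avg) auto
      also have "\<dots> = ennreal c * emeasure \<mu> W" by (simp add: nn_integral_cmult_indicator mult.commute[of "indicator _ _"])
      also have "emeasure \<mu> W \<le> emeasure \<mu> A + ennreal e"
      proof -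
        have "emeasure \<mu> W \<le> emeasure \<mu> (A \<union> (sym_diff A U \<inter> ?S))"
          by (rule emeasure_mono) (auto simp: W_def)
        also have "\<dots> \<le> emeasure \<mu> A + emeasure \<mu> (sym_diff A U \<inter> ?S)"
          by (rule emeasure_subadditive) auto
        also have "emeasure \<mu> (sym_diff A U \<inter> ?S) = (\<integral>\<^sup>+x. indicator (sym_diff A U) x * indicator ?S x \<partial>\<mu>)"
          by (simp only: indicator_inter_arith[symmetric] nn_integral_indicator sets.Int sets.Diff sets.Un
              \<open>A \<in> sets \<mu>\<close> \<open>U \<in> sets \<mu>\<close> \<open>?S \<in> sets \<mu>\<close>)
        also have "\<dots> \<le> emeasure \<rho> (sym_diff A U)" by (subst em) auto
        also have "\<dots> \<le> ennreal e" using sd by simp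
        finally show ?thesis by (simp add: add_mono)
      qed
      finally have 1: "(\<integral>\<^sup>+x. indicator W x * h x \<partial>\<mu>) \<le> ennreal c * (emeasure \<mu> A + ennreal e)"
        by (simp add: mult_left_mono)
      have "(\<integral>\<^sup>+x. indicator A x * h x \<partial>\<mu>) \<le>
          (\<integral>\<^sup>+x. indicator W x * h x + indicator (sym_diff A U) x * indicator ?S x * h x \<partial>\<mu>)"
        using AS by (intro nn_integral_mono) (auto simp: W_def indicator_def)
      also have "\<dots> = (\<integral>\<^sup>+x. indicator W x * h x \<partial>\<mu>) + (\<integral>\<^sup>+x. indicator (sym_diff A U) x * indicator ?S x * h x \<partial>\<mu>)"
        by (rule nn_integral_add) auto
      also have "(\<integral>\<^sup>+x. indicator (sym_diff A U) x * indicator ?S x * h x \<partial>\<mu>) \<le> emeasure \<rho> (sym_diff A U)"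
        by (subst em) auto
      also have "\<dots> \<le> ennreal e" using sd by simp
      finally have "(\<integral>\<^sup>+x. indicator A x * h x \<partial>\<mu>) \<le> (\<integral>\<^sup>+x. indicator W x * h x \<partial>\<mu>) + ennreal e"
        by (simp add: add_mono)
      also have "\<dots> \<le> ennreal c * (emeasure \<mu> A + ennreal e) + ennreal e"
        using 1 by (simp add: add_mono)
      also have "\<dots> = ennreal c * emeasure \<mu> A + ennreal ((c + 1) * e)"
        using c e by (simp add: distrib_left distrib_right ennreal_mult'[symmetric] ennreal_plus[symmetric] add.assoc del: ennreal_plus)
      finally show ?thesis .
    qed
    note le_eps = this
    have le: "(\<integral>\<^sup>+x. indicator A x * h x \<partial>\<mu>) \<le> ennreal c * emeasure \<mu> A"
    proof (rule ennreal_le_epsilon)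
      fix e :: real assume e: "0 < e"
      show "(\<integral>\<^sup>+x. indicator A x * h x \<partial>\<mu>) \<le> ennreal c * emeasure \<mu> A + ennreal e"
        using le_eps[of "e / (c + 1)"] e c by simp
    qed
    have "(\<integral>\<^sup>+x. indicator A x * h x \<partial>\<mu>) =
        (\<integral>\<^sup>+x. indicator A x * (h x - ennreal c) + indicator A x * ennreal c \<partial>\<mu>)"
      by (intro nn_integral_cong) (auto simp: A_def indicator_def diff_add_cancel_ennreal less_imp_le)
    also have "\<dots> = (\<integral>\<^sup>+x. indicator A x * (h x - ennreal c) \<partial>\<mu>) + ennreal c * emeasure \<mu> A"
      by (subst nn_integral_add) (auto simp: nn_integral_cmult_indicator mult.commute[of "indicator _ _" "ennreal c"])
    finally have "(\<integral>\<^sup>+x. indicator A x * (h x - ennreal c) \<partial>\<mu>) + ennreal c * emeasure \<mu> A \<le> 0 + ennreal c * emeasure \<mu> A"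
      using le by simp
    moreover have "ennreal c * emeasure \<mu> A \<noteq> \<infinity>" using \<mu>A by (simp add: ennreal_mult_eq_top_iff)
    ultimately have "(\<integral>\<^sup>+x. indicator A x * (h x - ennreal c) \<partial>\<mu>) = 0"
      by (simp only: add.commute[of _ "ennreal c * emeasure \<mu> A"] ennreal_add_left_cancel_le
          infinity_ennreal_def le_zero_eq simp_thms)
    then have "AE x in \<mu>. indicator A x * (h x - ennreal c) = 0"
      by (subst (asm) nn_integral_0_iff_AE) auto
    then show ?thesis
    proof (rule AE_mp, intro AE_I2 impI)
      fix x assume x: "x \<in> space \<mu>" "indicator A x * (h x - ennreal c) = 0" "x \<in> ?S"
      show "h x \<le> ennreal c"
      proof (rule ccontr)
        assume "\<not> h x \<le> ennreal c"
        then have "x \<in> A" "ennreal c < h x" using x by (auto simp: A_def)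
        then show False using x(2) diff_gr0_ennreal[of "ennreal c" "h x"] by auto
      qed
    qed
  qed
  \<comment> \<open>Countably many unit balls cover the space, so their exceptional sets may be
    united.\<close>
  have "AE x in \<mu>. \<forall>z\<in>centre 0 ` X. x \<in> B 0 z \<longrightarrow> h x \<le> ennreal c"
    using loc by (subst AE_ball_countable[OF countable_centres]) auto
  then show ?thesis
    by (rule AE_mp) (intro AE_I2, auto simp: mem_pball_iff_centre)
qed

end

text \<open>Half of the exponential decay, y = sqrt z, is spent on the power of m; the other half is
  summable.\<close>

lemma summable_powr_geometric:
  fixes c k z :: real
  assumes "0 \<le> z" "z < 1" "0 < c"
  shows "summable (\<lambda>m. ((real m + 1) * c) powr k * z ^ m)"
proof (cases "z = 0")
  case False
  define y where "y = sqrt z"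
  have y: "0 < y" "y < 1" "z = y * y" using assms False by (auto simp: y_def real_sqrt_lt_1_iff)
  have "(\<lambda>m::nat. ((real m + 1) * c) powr k * z ^ m) \<in> O(\<lambda>m. y ^ m)"
  proof -
    have "(\<lambda>m::nat. ((real m + 1) * c) powr k * (y ^ m * y ^ m)) \<in> O(\<lambda>m. y ^ m)"
      using y assms by real_asymp
    then show ?thesis by (simp add: y power_mult_distrib)
  qed
  moreover have "summable (\<lambda>m. norm (y ^ m))" using y by (simp add: summable_geometric)
  ultimately show ?thesis by (rule summable_comparison_test_bigo[rotated])
next
  case True
  then show ?thesis by (intro summable_finite[of "{0}"]) auto
qed

section \<open>Rules for averages over balls\<close>

context padic begin

lemma nnavg_mono: 
  "x \<in> X \<Longrightarrow> (\<And>y. y \<in> B \<gamma> x \<Longrightarrow> h y \<le> h' y) \<Longrightarrow> nnavg \<gamma> h x \<le> nnavg \<gamma> h' x"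
  unfolding nnavg_def by (intro mult_left_mono nn_integral_mono) (auto simp: indicator_def)

lemma nnavg_cong: 
  "x \<in> X \<Longrightarrow> (\<And>y. y \<in> B \<gamma> x \<Longrightarrow> h y = h' y) \<Longrightarrow> nnavg \<gamma> h x = nnavg \<gamma> h' x"
  by (intro antisym nnavg_mono) auto

lemma nnavg_const [simp]: "x \<in> X \<Longrightarrow> nnavg \<gamma> (\<lambda>_. c) x = c"
  by (simp add: nnavg_def nn_integral_cmult_indicator emeasure_pball mult.left_commute)

lemma nnavg_cmult:
  "x \<in> X \<Longrightarrow> h \<in> borel_measurable \<mu> \<Longrightarrow> nnavg \<gamma> (\<lambda>y. c * h y) x = c * nnavg \<gamma> h x"
  by (simp add: nnavg_def mult.assoc nn_integral_cmult mult.left_commute)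

lemma nnavg_add:
  "x \<in> X \<Longrightarrow> h \<in> borel_measurable \<mu> \<Longrightarrow> h' \<in> borel_measurable \<mu> \<Longrightarrow>
    nnavg \<gamma> (\<lambda>y. h y + h' y) x = nnavg \<gamma> h x + nnavg \<gamma> h' x"
  by (simp add: nnavg_def distrib_left distrib_right nn_integral_add)

lemma nnavg_le_nnavg_larger:
  assumes "x \<in> X" "\<gamma> \<le> \<gamma>'"
  shows "nnavg \<gamma> h x \<le> ennreal (P (real n * of_int (\<gamma>' - \<gamma>))) * nnavg \<gamma>' h x"
proof -
  have "nnavg \<gamma> h x \<le> ennreal (P (- (real n * of_int \<gamma>))) * (\<integral>\<^sup>+y\<in>B \<gamma>' x. h y \<partial>\<mu>)"
    unfolding nnavg_def using pball_mono[OF assms]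
    by (intro mult_left_mono nn_integral_mono) (auto simp: indicator_def)
  also have "\<dots> = ennreal (P (real n * of_int (\<gamma>' - \<gamma>))) * nnavg \<gamma>' h x"
    unfolding nn_integral_pball mult.assoc[symmetric]
    by (simp add: ennreal_mult'[symmetric] powr_add[symmetric] algebra_simps)
  finally show ?thesis .
qed

lemma pBMO_iff:
  "pBMO p n b \<longleftrightarrow> loc_integrable p n b \<and>
    (\<exists>D>0. \<forall>\<gamma>. \<forall>x\<in>X. nnavg \<gamma> (\<lambda>y. ennreal \<bar>b y - pavg p n b (B \<gamma> x)\<bar>) x \<le> ennreal D)"
proof -
  let ?f = "\<lambda>\<gamma> x. nnavg \<gamma> (\<lambda>y. ennreal \<bar>b y - pavg p n b (B \<gamma> x)\<bar>) x"
  let ?S = "SUP (\<gamma>, x)\<in>UNIV \<times> X. ?f \<gamma> x"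
  have eq: "(SUP (\<gamma>, x)\<in>UNIV \<times> X. ennreal (1 / measure \<mu> (B \<gamma> x)) *
        (\<integral>\<^sup>+ y\<in>B \<gamma> x. ennreal \<bar>b y - pavg p n b (B \<gamma> x)\<bar> \<partial>\<mu>)) = ?S"
    by (intro SUP_cong refl) (auto simp: nnavg_def measure_pball powr_minus_divide)
  have "?S < \<infinity> \<longleftrightarrow> (\<exists>D>0. \<forall>\<gamma>. \<forall>x\<in>X. ?f \<gamma> x \<le> ennreal D)"
  proof
    assume fin: "?S < \<infinity>"
    have "?f \<gamma> x \<le> ennreal (enn2real ?S + 1)" if "x \<in> X" for \<gamma> x
    proof -
      have "?f \<gamma> x \<le> ?S" by (rule SUP_upper2[of "(\<gamma>, x)"]) (use that in auto)
      also have "?S = ennreal (enn2real ?S)" using fin by simp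
      also have "\<dots> \<le> ennreal (enn2real ?S + 1)" by (rule ennreal_leI) simp
      finally show ?thesis .
    qed
    moreover have "0 < enn2real ?S + 1" using enn2real_nonneg[of ?S] by linarith
    ultimately show "\<exists>D>0. \<forall>\<gamma>. \<forall>x\<in>X. ?f \<gamma> x \<le> ennreal D" by blast
  next
    assume "\<exists>D>0. \<forall>\<gamma>. \<forall>x\<in>X. ?f \<gamma> x \<le> ennreal D"
    then obtain D where "\<forall>\<gamma>. \<forall>x\<in>X. ?f \<gamma> x \<le> ennreal D" by blast
    then have "?S \<le> ennreal D" by (intro SUP_least) auto
    then show "?S < \<infinity>" by (simp add: order_le_less_trans)
  qed
  then show ?thesis unfolding pBMO_def eq by simp
qed

lemma loc_integrable_measurable [measurable_dest]: "loc_integrable p n b \<Longrightarrow> b \<in> borel_measurable \<mu>"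
  by (simp add: loc_integrable_def)

lemma pavg_diff_le:
  assumes b: "loc_integrable p n b" and x: "x \<in> X"
  shows "ennreal \<bar>pavg p n b (B \<gamma> x) - c\<bar> \<le> nnavg \<gamma> (\<lambda>y. ennreal \<bar>b y - c\<bar>) x"
proof -
  let ?V = "P (real n * of_int \<gamma>)"
  have int: "set_integrable \<mu> (B \<gamma> x) b" using b x by (simp add: loc_integrable_def)
  have intc: "set_integrable \<mu> (B \<gamma> x) (\<lambda>_. c)"
    using x by (simp add: set_integrable_def emeasure_pball)
  have intd: "set_integrable \<mu> (B \<gamma> x) (\<lambda>y. b y - c)" by (rule set_integral_diff(1)[OF int intc])
  have "(LINT y:B \<gamma> x|\<mu>. b y - c) = (LINT y:B \<gamma> x|\<mu>. b y) - (LINT y:B \<gamma> x|\<mu>. c)"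
    by (rule set_integral_diff(2)[OF int intc])
  also have "(LINT y:B \<gamma> x|\<mu>. c) = ?V * c"
    using x by (simp add: set_lebesgue_integral_def measure_pball Int_absorb2[OF pball_subset])
  finally have "pavg p n b (B \<gamma> x) - c = (LINT y:B \<gamma> x|\<mu>. b y - c) / ?V"
    unfolding pavg_def measure_pball[OF x] by (simp only: diff_divide_distrib nonzero_mult_div_cancel_left[OF P_pos(2)])
  then have "\<bar>pavg p n b (B \<gamma> x) - c\<bar> = \<bar>LINT y:B \<gamma> x|\<mu>. b y - c\<bar> / ?V"
    by (simp only: abs_divide abs_of_nonneg P_pos)
  also have "\<dots> \<le> (LINT y:B \<gamma> x|\<mu>. \<bar>b y - c\<bar>) / ?V"
  proof (rule divide_right_mono)
    show "\<bar>LINT y:B \<gamma> x|\<mu>. b y - c\<bar> \<le> (LINT y:B \<gamma> x|\<mu>. \<bar>b y - c\<bar>)"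
      using integral_norm_bound[of \<mu> "\<lambda>y. indicator (B \<gamma> x) y *\<^sub>R (b y - c)"]
      unfolding set_lebesgue_integral_def by (simp add: abs_mult)
  qed simp
  finally have "ennreal \<bar>pavg p n b (B \<gamma> x) - c\<bar> \<le> ennreal ((LINT y:B \<gamma> x|\<mu>. \<bar>b y - c\<bar>) / ?V)"
    by (rule ennreal_leI)
  also have "\<dots> = ennreal (P (- (real n * of_int \<gamma>))) * ennreal (LINT y:B \<gamma> x|\<mu>. \<bar>b y - c\<bar>)"
    by (simp add: ennreal_mult'[symmetric] powr_minus_divide)
  also have "ennreal (LINT y:B \<gamma> x|\<mu>. \<bar>b y - c\<bar>) = (\<integral>\<^sup>+y\<in>B \<gamma> x. ennreal \<bar>b y - c\<bar> \<partial>\<mu>)"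
  proof -
    have "set_integrable \<mu> (B \<gamma> x) (\<lambda>y. \<bar>b y - c\<bar>)" by (rule set_integrable_abs[OF intd])
    then show ?thesis
      unfolding set_lebesgue_integral_def set_integrable_def
      by (subst nn_integral_eq_integral[symmetric])
         (auto intro!: nn_integral_cong simp: indicator_def)
  qed
  finally show ?thesis by (simp add: nnavg_def)
qed

subsection \<open>The John--Nirenberg inequality\<close>

text \<open>Calderon-Zygmund stopping at height 2 D. The stopped balls fill at most half of the
  ball; off them |b - a| <= 2 D almost everywhere; on each of them the induction hypothesis applies
  with its own average, which differs from \<open>a\<close> by at most 2 p^n D. Each further step of
  this length thus halves the measure.\<close>

lemma john_nirenberg:
  assumes b: "loc_integrable p n b" and D: "0 < D"
    and bmo: "\<And>\<gamma> x. x \<in> X \<Longrightarrow> nnavg \<gamma> (\<lambda>y. ennreal \<bar>b y - pavg p n b (B \<gamma> x)\<bar>) x \<le> ennreal D"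
    and x0: "x0 \<in> X"
  shows "nnavg \<gamma>0 (\<lambda>y. indicator {y. real m * (2 * P (real n) * D) < \<bar>b y - pavg p n b (B \<gamma>0 x0)\<bar>} y) x0
    \<le> ennreal ((1/2) ^ m)"
  using x0
proof (induction m arbitrary: \<gamma>0 x0)
  case 0
  have "nnavg \<gamma>0 (\<lambda>y. indicator {y. real 0 * (2 * P (real n) * D) < \<bar>b y - pavg p n b (B \<gamma>0 x0)\<bar>} y) x0
     \<le> nnavg \<gamma>0 (\<lambda>_. 1) x0"
    by (rule nnavg_mono) (use 0 in \<open>auto simp: indicator_def\<close>)
  then show ?case using 0 by simp
next
  case (Suc m)
  note x0 = Suc.prems
  note [measurable] = b[THEN loc_integrable_measurable]
  define T where "T = 2 * P (real n) * D"
  define a where "a = pavg p n b (B \<gamma>0 x0)"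
  define h where "h y = ennreal \<bar>b y - a\<bar>" for y
  have [measurable]: "h \<in> borel_measurable \<mu>" unfolding h_def by measurable
  let ?S = "B \<gamma>0 x0"
  have [measurable]: "?S \<in> sets \<mu>" using x0 by simp
  define u where "u \<gamma> x = nnavg \<gamma> h x" for \<gamma> x
  have u_lc: "level_const \<gamma> (u \<gamma>)" for \<gamma> unfolding u_def by (rule nnavg_level_const)
  have [measurable]: "u \<gamma> \<in> borel_measurable \<mu>" for \<gamma> by (rule level_const_borel_measurable[OF u_lc])
  have u0: "u \<gamma>0 x \<le> ennreal D" if "x \<in> ?S" for x
    using bmo[OF x0, of \<gamma>0] level_constD[OF u_lc[of \<gamma>0] x0 that] by (simp add: u_def h_def[abs_def] a_def)
  \<comment> \<open>\<open>E \<gamma>\<close>: the largest ball about \<open>x\<close> on which \<open>\<bar>b - a\<bar>\<close> has average above \<open>2 D\<close> has level \<open>\<gamma>\<close>.\<close>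
  define E where "E \<gamma> = {x\<in>space \<mu>. x \<in> ?S \<and> \<gamma> < \<gamma>0 \<and> ennreal (2 * D) < u \<gamma> x \<and> (\<forall>\<gamma>'\<in>{\<gamma><..\<gamma>0}. u \<gamma>' x \<le> ennreal (2 * D))}" for \<gamma>
  \<comment> \<open>The points at which the stopping never happens.\<close>
  define W where "W = {x\<in>space \<mu>. x \<in> ?S \<and> (\<forall>\<gamma>'\<in>{..\<gamma>0}. u \<gamma>' x \<le> ennreal (2 * D))}"
  define Bad where "Bad = {x\<in>space \<mu>. x \<in> ?S \<and> real (Suc m) * T < \<bar>b x - a\<bar>}"
  have [measurable]: "E \<gamma> \<in> sets \<mu>" for \<gamma> unfolding E_def by measurable
  have [measurable]: "W \<in> sets \<mu>" unfolding W_def by measurable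
  have [measurable]: "Bad \<in> sets \<mu>" unfolding Bad_def by measurable
  have E_lc: "level_const \<gamma> (\<lambda>x. x \<in> E \<gamma>)" for \<gamma>
    unfolding level_const_def
  proof (intro ballI)
    fix x y assume xy: "x \<in> X" "y \<in> B \<gamma> x"
    have "y \<in> X" using xy pball_subset by blast
    moreover have "y \<in> ?S \<longleftrightarrow> x \<in> ?S" if "\<gamma> < \<gamma>0"
      using level_constD[OF level_const_mem_pball[OF x0, of \<gamma> \<gamma>0] xy] that by simp
    moreover have "u \<gamma>' y = u \<gamma>' x" if "\<gamma> \<le> \<gamma>'" for \<gamma>'
      using level_constD[OF level_const_mono[OF u_lc that] xy] .
    ultimately show "(y \<in> E \<gamma>) = (x \<in> E \<gamma>)" using xy unfolding E_def by auto
  qed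
  have E_ind: "level_const \<gamma> (indicator (E \<gamma>) :: _ \<Rightarrow> ennreal)" for \<gamma>
    using level_const_compose[OF E_lc[of \<gamma>], of of_bool] by (simp add: indicator_def[abs_def] of_bool_def)
  have disj: "disjoint_family E"
    unfolding disjoint_family_on_def
  proof (intro ballI impI equals0I)
    fix \<gamma> \<gamma>' x assume "\<gamma> \<noteq> \<gamma>'" "x \<in> E \<gamma> \<inter> E \<gamma>'"
    then show False unfolding E_def by (cases "\<gamma> < \<gamma>'") (force simp: not_le[symmetric])+
  qed
  have cover: "?S \<subseteq> W \<union> (\<Union>\<gamma>. E \<gamma>)"
  proof
    fix x assume x: "x \<in> ?S"
    then have xs: "x \<in> space \<mu>" using pball_subset by auto
    show "x \<in> W \<union> (\<Union>\<gamma>. E \<gamma>)"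
    proof (cases "x \<in> W")
      case False
      then obtain \<gamma>1 where \<gamma>1: "\<gamma>1 \<le> \<gamma>0" "ennreal (2 * D) < u \<gamma>1 x"
        using x xs by (auto simp: W_def not_le)
      \<comment> \<open>The levels lie between \<open>\<gamma>1\<close> and
        \<open>\<gamma>0\<close>, so a largest one exists; it cannot be \<open>\<gamma>0\<close>,
        where the average is at most D.\<close>
      define K where "K = {\<gamma>\<in>{\<gamma>1..\<gamma>0}. ennreal (2 * D) < u \<gamma> x}"
      have "K \<subseteq> {\<gamma>1..\<gamma>0}" by (auto simp: K_def)
      then have K: "finite K" "\<gamma>1 \<in> K" using \<gamma>1 by (auto intro: finite_subset simp: K_def)
      define \<gamma> where "\<gamma> = Max K"
      have \<gamma>: "\<gamma> \<in> K" "\<And>\<gamma>'. \<gamma>' \<in> K \<Longrightarrow> \<gamma>' \<le> \<gamma>"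
        unfolding \<gamma>_def using K by (auto intro: Max_in)
      have "\<gamma> \<noteq> \<gamma>0"
      proof
        assume "\<gamma> = \<gamma>0"
        then have "ennreal (2 * D) < ennreal D" using \<gamma>(1) u0[OF x] by (auto simp: K_def)
        then show False using D by (simp add: ennreal_less_iff)
      qed
      then have "x \<in> E \<gamma>" using \<gamma> x xs unfolding E_def K_def by (auto simp: not_le[symmetric]) (meson less_le_trans not_le order_less_imp_le)
      then show ?thesis by blast
    qed simp
  qed
  \<comment> \<open>A ball of level at most \<open>\<gamma>0\<close> that meets \<open>W\<close>
    inherits the bound from a point of \<open>W\<close>; in a larger ball the integral over
    \<open>?S\<close> is only diluted.\<close>
  have W_ae: "AE x in \<mu>. h x * indicator W x \<le> ennreal (2 * D)"
  proof (rule AE_le_of_ball_averages)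
    show "nnavg \<gamma> (\<lambda>x. h x * indicator W x) x \<le> ennreal (2 * D)" if x: "x \<in> X" for \<gamma> x
    proof (cases "\<exists>y\<in>B \<gamma> x. y \<in> W")
      case True
      then obtain y where y: "y \<in> B \<gamma> x" "y \<in> W" by blast
      have yX: "y \<in> X" using y pball_subset by blast
      show ?thesis
      proof (cases "\<gamma> \<le> \<gamma>0")
        case True
        have "nnavg \<gamma> (\<lambda>x. h x * indicator W x) x \<le> u \<gamma> x"
          unfolding u_def by (rule nnavg_mono[OF x]) (auto simp: indicator_def)
        also have "\<dots> = u \<gamma> y" using level_constD[OF u_lc x y(1)] by simp
        also have "\<dots> \<le> ennreal (2 * D)" using y(2) True by (auto simp: W_def)
        finally show ?thesis .
      next
        case False
        have "nnavg \<gamma> (\<lambda>x. h x * indicator W x) x \<le> 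
          ennreal (P (- (real n * of_int \<gamma>))) * (\<integral>\<^sup>+y\<in>?S. h y \<partial>\<mu>)"
          unfolding nnavg_def by (intro mult_left_mono nn_integral_mono) (auto simp: indicator_def W_def)
        also have "(\<integral>\<^sup>+y\<in>?S. h y \<partial>\<mu>) \<le> ennreal (P (real n * of_int \<gamma>0)) * ennreal D"
          unfolding nn_integral_pball using u0[of x0] x0 by (intro mult_left_mono) (auto simp: u_def)
        also have "ennreal (P (- (real n * of_int \<gamma>))) * (ennreal (P (real n * of_int \<gamma>0)) * ennreal D)
           = ennreal (P (real n * (real_of_int \<gamma>0 - real_of_int \<gamma>)) * D)"
          using D by (simp add: ennreal_mult'[symmetric] mult.assoc[symmetric] powr_add[symmetric] right_diff_distrib)
        also have "\<dots> \<le> ennreal (1 * D)"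
          using False D by (intro ennreal_leI mult_right_mono) (auto simp: mult_le_0_iff)
        also have "\<dots> \<le> ennreal (2 * D)" using D by (intro ennreal_leI) auto
        finally show ?thesis by (simp add: mult_left_mono)
      qed
    next
      case False
      then have "nnavg \<gamma> (\<lambda>x. h x * indicator W x) x = nnavg \<gamma> (\<lambda>_. 0) x"
        by (intro nnavg_cong[OF x]) auto
      then show ?thesis using x by simp
    qed
  qed (use D in auto)
  have T: "2 * D \<le> T" using D n_ge_1 unfolding T_def by (simp add: mult_le_cancel_right1)
  have null: "AE x in \<mu>. x \<notin> W \<inter> Bad"
    using W_ae
    proof (rule AE_mp, intro AE_I2 impI notI)
      fix x assume "h x * indicator W x \<le> ennreal (2 * D)" "x \<in> W \<inter> Bad"
      then have "\<bar>b x - a\<bar> \<le> 2 * D" "real (Suc m) * T < \<bar>b x - a\<bar>"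
        using D by (auto simp: h_def Bad_def ennreal_le_iff)
      moreover have "T \<le> real (Suc m) * T" using T D by (simp add: mult_le_cancel_right1)
      ultimately show False using T by linarith
    qed
  have "emeasure \<mu> (W \<inter> Bad) = 0"
    using null by (subst (asm) AE_iff_null_sets[symmetric]) auto
  moreover have "emeasure \<mu> Bad \<le> emeasure \<mu> ((W \<inter> Bad) \<union> (\<Union>\<gamma>. E \<gamma> \<inter> Bad))"
  proof (rule emeasure_mono)
    show "Bad \<subseteq> (W \<inter> Bad) \<union> (\<Union>\<gamma>. E \<gamma> \<inter> Bad)" using cover by (auto simp: Bad_def)
  qed measurable
  moreover have "\<dots> \<le> emeasure \<mu> (W \<inter> Bad) + emeasure \<mu> (\<Union>\<gamma>. E \<gamma> \<inter> Bad)"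
    by (rule emeasure_subadditive) auto
  ultimately have "emeasure \<mu> Bad \<le> emeasure \<mu> (\<Union>\<gamma>. E \<gamma> \<inter> Bad)" by simp
  also have "\<dots> = (\<integral>\<^sup>+\<gamma>. emeasure \<mu> (E \<gamma> \<inter> Bad) \<partial>count_space UNIV)"
    using disj by (intro emeasure_UN_countable) (auto simp: disjoint_family_on_def)
  also have "\<dots> \<le> (\<integral>\<^sup>+\<gamma>. ennreal ((1/2)^m) * emeasure \<mu> (E \<gamma>) \<partial>count_space UNIV)"
  proof (rule nn_integral_mono)
    fix \<gamma> :: int
    have "emeasure \<mu> (E \<gamma> \<inter> Bad) = (\<integral>\<^sup>+x. indicator (E \<gamma>) x * indicator Bad x \<partial>\<mu>)"
      by (simp only: indicator_inter_arith[symmetric] nn_integral_indicator sets.Int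
          \<open>E \<gamma> \<in> sets \<mu>\<close> \<open>Bad \<in> sets \<mu>\<close>)
    also have "\<dots> = (\<integral>\<^sup>+x. indicator (E \<gamma>) x * nnavg \<gamma> (indicator Bad) x \<partial>\<mu>)"
      by (rule nn_integral_level_const_mult[OF _ E_ind]) auto
    also have "\<dots> \<le> (\<integral>\<^sup>+x. ennreal ((1/2)^m) * indicator (E \<gamma>) x \<partial>\<mu>)"
    proof (rule nn_integral_mono)
      fix x assume "x \<in> space \<mu>"
      then have x: "x \<in> X" by simp
      show "indicator (E \<gamma>) x * nnavg \<gamma> (indicator Bad) x \<le> ennreal ((1/2)^m) * indicator (E \<gamma>) x"
      proof (cases "x \<in> E \<gamma>")
        case True
        define a' where "a' = pavg p n b (B \<gamma> x)"
        have "ennreal \<bar>a' - a\<bar> \<le> u \<gamma> x"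
          unfolding a'_def u_def h_def[abs_def] by (rule pavg_diff_le[OF b x])
        \<comment> \<open>The ball one level up was not stopped, so its average is at most 2 D;
          shrinking to the stopped ball costs the factor p^n.\<close>
        also have "\<dots> \<le> ennreal (P (real n)) * u (\<gamma> + 1) x"
          using nnavg_le_nnavg_larger[OF x, of \<gamma> "\<gamma> + 1" h] by (simp add: u_def)
        also have "\<dots> \<le> ennreal (P (real n)) * ennreal (2 * D)"
          using True by (intro mult_left_mono) (auto simp: E_def)
        also have "\<dots> = ennreal T" using D by (simp add: T_def ennreal_mult'[symmetric] mult.commute mult.left_commute)
        finally have diff: "\<bar>a' - a\<bar> \<le> T" using T D by (subst (asm) ennreal_le_iff) auto
        have "nnavg \<gamma> (indicator Bad) x \<le> nnavg \<gamma> (\<lambda>y. indicator {y. real m * T < \<bar>b y - a'\<bar>} y) x"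
          using diff by (intro nnavg_mono[OF x]) (auto simp: indicator_def Bad_def algebra_simps)
        also have "\<dots> \<le> ennreal ((1/2)^m)"
          unfolding T_def a'_def by (rule Suc.IH[OF x])
        finally show ?thesis using True by simp
      qed simp
    qed
    also have "\<dots> = ennreal ((1/2)^m) * emeasure \<mu> (E \<gamma>)"
      by (simp add: nn_integral_cmult_indicator)
    finally show "emeasure \<mu> (E \<gamma> \<inter> Bad) \<le> ennreal ((1/2)^m) * emeasure \<mu> (E \<gamma>)" .
  qed
  also have "\<dots> = ennreal ((1/2)^m) * emeasure \<mu> (\<Union>\<gamma>. E \<gamma>)"
    using disj by (subst emeasure_UN_countable) (auto simp: nn_integral_cmult)
  finally have Bad_le: "emeasure \<mu> Bad \<le> ennreal ((1/2)^m) * emeasure \<mu> (\<Union>\<gamma>. E \<gamma>)" .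
  \<comment> \<open>Chebyshev on the stopped balls: their averages exceed 2 D while the average over
    \<open>?S\<close> is at most D, whence the factor 1/2.\<close>
  have "ennreal (2 * D) * emeasure \<mu> (\<Union>\<gamma>. E \<gamma>) = (\<integral>\<^sup>+\<gamma>. ennreal (2 * D) * emeasure \<mu> (E \<gamma>) \<partial>count_space UNIV)"
    using disj by (subst emeasure_UN_countable) (auto simp: nn_integral_cmult)
  also have "\<dots> \<le> (\<integral>\<^sup>+\<gamma>. emeasure (density \<mu> h) (E \<gamma>) \<partial>count_space UNIV)"
  proof (rule nn_integral_mono)
    fix \<gamma> :: int
    have "ennreal (2 * D) * emeasure \<mu> (E \<gamma>) = (\<integral>\<^sup>+x. ennreal (2 * D) * indicator (E \<gamma>) x \<partial>\<mu>)"
      by (simp add: nn_integral_cmult_indicator)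
    also have "\<dots> \<le> (\<integral>\<^sup>+x. indicator (E \<gamma>) x * nnavg \<gamma> h x \<partial>\<mu>)"
      by (intro nn_integral_mono) (auto simp: indicator_def E_def u_def less_imp_le)
    also have "\<dots> = (\<integral>\<^sup>+x. indicator (E \<gamma>) x * h x \<partial>\<mu>)"
      by (rule nn_integral_level_const_mult[OF _ E_ind, symmetric]) auto
    also have "\<dots> = emeasure (density \<mu> h) (E \<gamma>)"
      by (subst emeasure_density) (auto simp: mult.commute)
    finally show "ennreal (2 * D) * emeasure \<mu> (E \<gamma>) \<le> emeasure (density \<mu> h) (E \<gamma>)" .
  qed
  also have "\<dots> = emeasure (density \<mu> h) (\<Union>\<gamma>. E \<gamma>)"
    using disj by (intro emeasure_UN_countable[symmetric]) auto
  also have "\<dots> \<le> emeasure (density \<mu> h) ?S"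
    by (intro emeasure_mono) (auto simp: E_def)
  also have "\<dots> = ennreal (P (real n * of_int \<gamma>0)) * u \<gamma>0 x0"
    by (subst emeasure_density) (auto simp: nn_integral_pball u_def)
  also have "\<dots> \<le> ennreal (P (real n * of_int \<gamma>0)) * ennreal D"
    using u0[of x0] x0 by (intro mult_left_mono) auto
  finally have E_le: "ennreal (2 * D) * emeasure \<mu> (\<Union>\<gamma>. E \<gamma>) \<le> ennreal (P (real n * of_int \<gamma>0)) * ennreal D" .
  have "emeasure \<mu> (\<Union>\<gamma>. E \<gamma>) = ennreal (1 / (2 * D)) * (ennreal (2 * D) * emeasure \<mu> (\<Union>\<gamma>. E \<gamma>))"
    using D by (simp add: mult.assoc[symmetric] ennreal_mult'[symmetric])
  also have "\<dots> \<le> ennreal (1 / (2 * D)) * (ennreal (P (real n * of_int \<gamma>0)) * ennreal D)"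
    by (intro mult_left_mono E_le) auto
  also have "\<dots> = ennreal (1/2 * P (real n * of_int \<gamma>0))"
    using D by (simp add: ennreal_mult'[symmetric] field_simps)
  finally have "emeasure \<mu> Bad \<le> ennreal ((1/2)^m) * ennreal (1/2 * P (real n * of_int \<gamma>0))"
    using Bad_le by (meson mult_left_mono order_trans zero_le)
  also have "\<dots> = ennreal (P (real n * of_int \<gamma>0)) * ennreal ((1/2) ^ Suc m)"
    by (simp add: ennreal_mult'[symmetric] mult.commute)
  finally have fin: "emeasure \<mu> Bad \<le> ennreal (P (real n * of_int \<gamma>0)) * ennreal ((1/2) ^ Suc m)" .
  have "nnavg \<gamma>0 (\<lambda>y. indicator {y. real (Suc m) * T < \<bar>b y - a\<bar>} y) x0
    = ennreal (P (- (real n * of_int \<gamma>0))) * emeasure \<mu> Bad"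
  proof -
    have "(\<integral>\<^sup>+y\<in>?S. indicator {y. real (Suc m) * T < \<bar>b y - a\<bar>} y \<partial>\<mu>) = (\<integral>\<^sup>+y. indicator Bad y \<partial>\<mu>)"
      using pball_subset[of \<gamma>0 x0] by (intro nn_integral_cong) (auto simp: indicator_def Bad_def)
    then show ?thesis unfolding nnavg_def by simp
  qed
  also have "\<dots> \<le> ennreal (P (- (real n * of_int \<gamma>0))) * (ennreal (P (real n * of_int \<gamma>0)) * ennreal ((1/2) ^ Suc m))"
    by (intro mult_left_mono fin) auto
  also have "\<dots> = ennreal ((1/2) ^ Suc m)" unfolding mult.assoc[symmetric] by simp
  finally show ?case unfolding a_def T_def .
qed

text \<open>Layer-cake sum: v^k is at most the sum over m of ((m + 1) T)^k times the indicator of v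
  > m T, whose average is at most 2^(-m).\<close>

lemma bmo_moments:
  assumes b: "loc_integrable p n b" and D: "0 < D"
    and bmo: "\<And>\<gamma> x. x \<in> X \<Longrightarrow> nnavg \<gamma> (\<lambda>y. ennreal \<bar>b y - pavg p n b (B \<gamma> x)\<bar>) x \<le> ennreal D"
    and k: "0 < k"
  obtains C where "0 \<le> C" "\<And>\<gamma> x. x \<in> X \<Longrightarrow> nnavg \<gamma> (\<lambda>y. ennreal (\<bar>b y - pavg p n b (B \<gamma> x)\<bar> powr k)) x \<le> ennreal C"
proof -
  note [measurable] = b[THEN loc_integrable_measurable]
  define T where "T = 2 * P (real n) * D"
  have T: "0 < T" using D by (simp add: T_def)
  define c where "c m = ((real m + 1) * T) powr k" for m
  have c: "0 \<le> c m" for m by (simp add: c_def)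
  have sm: "summable (\<lambda>m. c m * (1/2) ^ m)"
    unfolding c_def by (rule summable_powr_geometric) (use T in auto)
  show ?thesis
  proof (rule that)
    show "0 \<le> (\<Sum>m. c m * (1/2) ^ m)" using sm c by (intro suminf_nonneg) auto
    fix \<gamma> x assume x: "x \<in> X"
    define v where "v y = \<bar>b y - pavg p n b (B \<gamma> x)\<bar>" for y
    let ?I = "\<lambda>m y. indicator {y. real m * T < v y} y :: ennreal"
    have [measurable]: "v \<in> borel_measurable \<mu>" unfolding v_def by measurable
    have pt: "ennreal (v y powr k) \<le> (\<Sum>m. ennreal (c m) * ?I m y)" for y
    proof (cases "v y = 0")
      case True
      then show ?thesis using k by simp
    next
      case False
      then have v: "0 < v y" by (simp add: v_def)
      \<comment> \<open>Ceiling minus one rather than floor: m T < v has to be strict, as in the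
        level sets of \<open>john_nirenberg\<close>.\<close>
      define m where "m = nat (\<lceil>v y / T\<rceil> - 1)"
      have "1 \<le> \<lceil>v y / T\<rceil>" using v T by (simp add: one_le_ceiling)
      then have rm: "real m = real_of_int \<lceil>v y / T\<rceil> - 1" by (simp add: m_def)
      then have "real m < v y / T" "v y / T \<le> real m + 1" by linarith+
      then have m: "real m * T < v y" "v y \<le> (real m + 1) * T"
        using T by (auto simp: field_simps)
      have "ennreal (v y powr k) \<le> ennreal (c m)"
        unfolding c_def using m v k by (intro ennreal_leI powr_mono2) auto
      also have "\<dots> = sum (\<lambda>m. ennreal (c m) * ?I m y) {m}" using m by simp
      also have "\<dots> \<le> (\<Sum>m. ennreal (c m) * ?I m y)" by (rule sum_le_suminf) auto
      finally show ?thesis .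
    qed
    have "nnavg \<gamma> (\<lambda>y. ennreal (v y powr k)) x \<le> nnavg \<gamma> (\<lambda>y. \<Sum>m. ennreal (c m) * ?I m y) x"
      by (rule nnavg_mono[OF x]) (rule pt)
    also have "\<dots> = (\<Sum>m. ennreal (c m) * nnavg \<gamma> (?I m) x)"
      using x unfolding nnavg_def
      by (simp add: ennreal_suminf_multc[symmetric] nn_integral_suminf ennreal_suminf_cmult[symmetric]
          mult.assoc nn_integral_cmult mult.left_commute)
    also have "\<dots> \<le> (\<Sum>m. ennreal (c m) * ennreal ((1/2) ^ m))"
      using john_nirenberg[OF b D bmo x] unfolding T_def v_def
      by (intro suminf_le mult_left_mono) auto
    also have "\<dots> = (\<Sum>m. ennreal (c m * (1/2) ^ m))" using c by (simp add: ennreal_mult')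
    also have "\<dots> = ennreal (\<Sum>m. c m * (1/2) ^ m)"
      using sm c by (intro suminf_ennreal2) auto
    finally show "nnavg \<gamma> (\<lambda>y. ennreal (\<bar>b y - pavg p n b (B \<gamma> x)\<bar> powr k)) x \<le> ennreal (\<Sum>m. c m * (1/2) ^ m)"
      unfolding v_def .
  qed
qed

end

text \<open>Elementary stand-in for Hoelder's inequality between powers, with a free height
  \<open>t\<close>. When \<open>t\<close> is chosen so that both terms have equal integrals, only a
  factor 2 is lost.\<close>

lemma powr_le_interpolate:
  fixes y t s r :: real
  assumes "0 \<le> y" "0 < t" "0 < s" "s \<le> r"
  shows "y powr s \<le> t powr s + t powr (s - r) * y powr r"
proof (cases "y \<le> t")
  case True
  then have "y powr s \<le> t powr s" using assms by (intro powr_mono2) auto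
  moreover have "0 \<le> t powr (s - r) * y powr r" by simp
  ultimately show ?thesis by linarith
next
  case False
  then have "y powr s = y powr (s - r) * y powr r" using assms by (simp add: powr_add[symmetric])
  also have "\<dots> \<le> t powr (s - r) * y powr r"
    using False assms by (intro mult_right_mono powr_mono2') auto
  finally show ?thesis by (simp add: add_increasing)
qed

lemma powr_add_le:
  fixes u v k :: real
  assumes "0 \<le> u" "0 \<le> v" "0 < k"
  shows "(u + v) powr k \<le> 2 powr k * (u powr k + v powr k)"
proof -
  have "(u + v) powr k \<le> (2 * max u v) powr k"
    using assms by (intro powr_mono2) auto
  also have "\<dots> = 2 powr k * max u v powr k" using assms by (simp add: powr_mult)
  also have "max u v powr k \<le> u powr k + v powr k" by (simp add: max_def)
  finally show ?thesis by simp
qed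

text \<open>Young's inequality with constants 1: the cases decide which of h and y^(s - 1)
  dominates.\<close>

lemma mult_le_powr_add_powr:
  fixes h y s :: real
  assumes "0 \<le> h" "0 \<le> y" "1 < s"
  shows "h * y \<le> h powr (s / (s - 1)) + y powr s"
proof (cases "h \<le> y powr (s - 1)")
  case True
  have "h * y \<le> y powr (s - 1) * y" using True assms by (intro mult_right_mono) auto
  also have "\<dots> = y powr s"
    using assms powr_add[of y "s - 1" 1] by (cases "y = 0") auto
  finally show ?thesis by (simp add: add_increasing)
next
  case False
  then have h: "0 < h" using assms by (smt (verit) powr_ge_zero)
  have "y = (y powr (s - 1)) powr (1 / (s - 1))" using assms by (cases "y = 0") (auto simp: powr_powr)
  also have "\<dots> \<le> h powr (1 / (s - 1))" using False assms by (intro powr_mono2) auto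
  finally have "h * y \<le> h * h powr (1 / (s - 1))" using h by (intro mult_left_mono) auto
  also have "\<dots> = h powr (1 + 1 / (s - 1))" using h by (simp add: powr_add)
  also have "1 + 1 / (s - 1) = s / (s - 1)" using assms by (simp add: field_simps)
  finally show ?thesis by (simp add: add_increasing2)
qed

section \<open>A Jensen-type inequality and a truncated geometric series\<close>

context padic begin

text \<open>Jensen's inequality up to the factor 2^k: interpolation at height t = u / 2 lets the
  constant term absorb only half of the average \<open>u\<close>.\<close>

lemma nnavg_powr_le:
  assumes x: "x \<in> X" and [measurable]: "h \<in> borel_measurable \<mu>" and h: "\<And>y. 0 \<le> h y"
    and u: "nnavg \<gamma> (\<lambda>y. ennreal (h y)) x = ennreal u" "0 \<le> u" and k: "1 \<le> k"
  shows "ennreal (u powr k) \<le> ennreal (2 powr k) * nnavg \<gamma> (\<lambda>y. ennreal (h y powr k)) x"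
proof (cases "u = 0")
  case False
  define t where "t = u / 2"
  have t: "0 < t" "u = t + t" using u False by (auto simp: t_def)
  have "ennreal u \<le> nnavg \<gamma> (\<lambda>y. ennreal t + ennreal (t powr (1 - k)) * ennreal (h y powr k)) x"
    unfolding u(1)[symmetric]
  proof (rule nnavg_mono[OF x])
    fix y
    have "h y \<le> t + t powr (1 - k) * h y powr k"
      using powr_le_interpolate[of "h y" t 1 k] h[of y] t k by simp
    then show "ennreal (h y) \<le> ennreal t + ennreal (t powr (1 - k)) * ennreal (h y powr k)"
      using t by (simp add: ennreal_mult'[symmetric] ennreal_plus[symmetric] del: ennreal_plus)
  qed
  also have "\<dots> = ennreal t + ennreal (t powr (1 - k)) * nnavg \<gamma> (\<lambda>y. ennreal (h y powr k)) x"
    using x by (simp add: nnavg_add nnavg_cmult)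
  finally have "ennreal t + ennreal t \<le> ennreal t + ennreal (t powr (1 - k)) * nnavg \<gamma> (\<lambda>y. ennreal (h y powr k)) x"
    using t by (simp add: ennreal_plus[symmetric] del: ennreal_plus)
  then have "ennreal t \<le> ennreal (t powr (1 - k)) * nnavg \<gamma> (\<lambda>y. ennreal (h y powr k)) x"
    by (simp add: ennreal_add_left_cancel_le)
  then have "ennreal (2 powr k * t powr (k - 1)) * ennreal t \<le>
      ennreal (2 powr k * t powr (k - 1)) * (ennreal (t powr (1 - k)) * nnavg \<gamma> (\<lambda>y. ennreal (h y powr k)) x)"
    by (rule mult_left_mono) auto
  also have "\<dots> = ennreal (2 powr k * t powr (k - 1) * t powr (1 - k)) * nnavg \<gamma> (\<lambda>y. ennreal (h y powr k)) x"
    by (simp add: mult.assoc[symmetric] ennreal_mult'[symmetric])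
  also have "2 powr k * t powr (k - 1) * t powr (1 - k) = 2 powr k"
    using t by (simp add: mult.assoc powr_add[symmetric])
  also have "ennreal (2 powr k * t powr (k - 1)) * ennreal t = ennreal (u powr k)"
  proof -
    have "2 powr k * t powr (k - 1) * t = 2 powr k * (t powr (k - 1) * t powr 1)" using t by simp
    also have "\<dots> = 2 powr k * t powr k" unfolding powr_add[symmetric] by simp
    also have "\<dots> = u powr k" using t by (simp add: powr_mult[symmetric])
    finally show ?thesis by (simp add: ennreal_mult'[symmetric])
  qed
  finally show ?thesis .
qed simp

text \<open>The terms not exceeding \<open>T\<close> form a one-sided geometric series whose largest
  term, at level \<open>g\<close>, is at most \<open>T\<close>.\<close>

lemma nn_integral_geometric_int:
  assumes c: "0 < c" and T: "0 < T"
  shows "(\<integral>\<^sup>+\<gamma>. ennreal (if P (of_int \<gamma> * c) \<le> T then P (of_int \<gamma> * c) else 0) \<partial>count_space UNIV)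
    \<le> ennreal (1 / (1 - P (- c)) * T)" (is "(\<integral>\<^sup>+\<gamma>. ?F \<gamma> \<partial>_) \<le> _")
proof -
  define g where "g = \<lfloor>log (real p) T / c\<rfloor>"
  have iff: "P (of_int \<gamma> * c) \<le> T \<longleftrightarrow> \<gamma> \<le> g" for \<gamma>
  proof -
    have "P (of_int \<gamma> * c) \<le> T \<longleftrightarrow> real_of_int \<gamma> * c \<le> log (real p) T"
      using T p_ge_2 by (simp add: le_log_iff)
    also have "\<dots> \<longleftrightarrow> \<gamma> \<le> g" using c by (simp add: g_def le_floor_iff field_simps)
    finally show ?thesis .
  qed
  have z: "0 < P (- c)" "P (- c) < 1"
    using c P_less_iff[of "- c" 0] by auto
  have "(\<integral>\<^sup>+\<gamma>. ?F \<gamma> \<partial>count_space UNIV) = (\<integral>\<^sup>+\<gamma>. ?F \<gamma> \<partial>count_space {..g})"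
    by (intro nn_integral_count_space_eq) (auto simp: iff)
  also have "\<dots> = (\<integral>\<^sup>+j. ?F (g - int j) \<partial>count_space UNIV)"
  proof (rule nn_integral_bij_count_space[symmetric])
    show "bij_betw (\<lambda>j. g - int j) UNIV {..g}"
      by (rule bij_betwI[where g = "\<lambda>\<gamma>. nat (g - \<gamma>)"]) auto
  qed
  also have "\<dots> = (\<Sum>j. ennreal (P (of_int g * c) * P (- c) ^ j))"
    unfolding nn_integral_count_space_nat
  proof (rule suminf_cong)
    fix j :: nat
    have "P (of_int (g - int j) * c) = P (of_int g * c) * P (- c) ^ j"
      by (simp add: powr_power powr_add[symmetric] algebra_simps)
    then show "?F (g - int j) = ennreal (P (of_int g * c) * P (- c) ^ j)"
      using iff[of "g - int j"] by simp
  qed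
  also have "\<dots> = ennreal (\<Sum>j. P (of_int g * c) * P (- c) ^ j)"
    using z by (intro suminf_ennreal2 summable_mult summable_geometric) auto
  also have "(\<Sum>j. P (of_int g * c) * P (- c) ^ j) = 1 / (1 - P (- c)) * P (of_int g * c)"
    using z by (subst suminf_mult) (auto simp: suminf_geometric summable_geometric)
  also have "\<dots> \<le> 1 / (1 - P (- c)) * T"
    using c z iff[of g] by (intro mult_left_mono) auto
  finally show ?thesis by (simp add: ennreal_leI)
qed

end

section \<open>Averages of a function of Morrey norm at most one\<close>

locale padic_morrey = padic +
  fixes \<alpha> r lam q :: real
  assumes \<alpha>_pos: "0 < \<alpha>" and r_gt_1: "1 < r" and lam_nonneg: "0 \<le> lam"
    and lam_less: "lam < real n - \<alpha> * r"
    and q_eq: "1 / q = 1 / r - \<alpha> / (real n - lam)"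
begin

text \<open>Decay rate of averages: a function of Morrey norm at most one has r-th mean at most
  p^(-\<gamma> \<rho>) on \<gamma>-balls. The hypothesis \<open>lam_less\<close> says \<alpha> <
  \<rho>.\<close>

definition \<rho> :: real where "\<rho> = (real n - lam) / r"
text \<open>The midpoint is an arbitrary choice strictly between 1 and \<open>r\<close>; both strict
  inequalities matter.\<close>

definition s :: real where "s = (1 + r) / 2"

lemma s_bounds: "1 < s" "s < r" "0 < s" "0 < r"
  using r_gt_1 by (auto simp: s_def)

lemma \<rho>_gt: "\<alpha> < \<rho>" "0 < \<rho>"
proof -
  show "\<alpha> < \<rho>" using lam_less r_gt_1 unfolding \<rho>_def by (simp add: field_simps)
  then show "0 < \<rho>" using \<alpha>_pos by linarith
qed

text \<open>\<open>q_eq\<close> amounts to the scaling relation (\<rho> - \<alpha>) q = \<rho> r.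
  The form with q - r sets the weight at small levels, the form with n - lam the decay at large
  ones.\<close>

lemma q_alt: "r < q" "\<alpha> * q = \<rho> * (q - r)" "(\<rho> - \<alpha>) * q = real n - lam" "\<rho> * r = real n - lam"
proof -
  show 1: "\<rho> * r = real n - lam" using r_gt_1 by (simp add: \<rho>_def)
  have "1 / q = 1 / r - \<alpha> / (\<rho> * r)" using q_eq 1 by simp
  also have "\<dots> = (\<rho> - \<alpha>) / (\<rho> * r)" using \<rho>_gt r_gt_1 by (simp add: field_simps)
  finally have "q = \<rho> * r / (\<rho> - \<alpha>)" by (metis inverse_divide inverse_eq_divide inverse_inverse_eq)
  then show 2: "(\<rho> - \<alpha>) * q = real n - lam" using \<rho>_gt 1 by simp
  then have "\<alpha> * q = \<rho> * q - \<rho> * r" unfolding 1[symmetric] by (simp add: algebra_simps)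
  then show 3: "\<alpha> * q = \<rho> * (q - r)" by (simp add: algebra_simps)
  have "0 < q" using 2 1 \<rho>_gt s_bounds by (metis diff_gt_0_iff_gt mult_pos_pos zero_less_mult_pos)
  then have "0 < \<rho> * (q - r)" using 3 \<alpha>_pos by (metis mult_pos_pos)
  then show "r < q" using \<rho>_gt by (simp add: zero_less_mult_iff)
qed

definition unit_morrey :: "((nat \<Rightarrow> int \<Rightarrow> nat) \<Rightarrow> real) \<Rightarrow> bool" where
  "unit_morrey f \<longleftrightarrow> f \<in> borel_measurable \<mu> \<and>
     (\<forall>\<gamma>. \<forall>x\<in>X. (\<integral>\<^sup>+y\<in>B \<gamma> x. ennreal (\<bar>f y\<bar> powr r) \<partial>\<mu>) \<le> ennreal (P (of_int \<gamma> * lam)))"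

lemma unit_morrey_measurable [measurable_dest]: "unit_morrey f \<Longrightarrow> f \<in> borel_measurable \<mu>"
  by (simp add: unit_morrey_def)

lemma unit_morrey_nnavg:
  assumes "unit_morrey f" "x \<in> X"
  shows "nnavg \<gamma> (\<lambda>y. ennreal (\<bar>f y\<bar> powr r)) x \<le> ennreal (P (- (real_of_int \<gamma> * \<rho> * r)))"
proof -
  have "nnavg \<gamma> (\<lambda>y. ennreal (\<bar>f y\<bar> powr r)) x \<le>
      ennreal (P (- (real n * of_int \<gamma>))) * ennreal (P (of_int \<gamma> * lam))"
    unfolding nnavg_def using assms by (intro mult_left_mono) (auto simp: unit_morrey_def)
  also have "\<dots> = ennreal (P (- (real_of_int \<gamma> * (\<rho> * r))))"
    unfolding q_alt by (simp add: ennreal_mult'[symmetric] powr_add[symmetric] algebra_simps)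
  finally show ?thesis by (simp add: mult.assoc)
qed

definition avs :: "((nat \<Rightarrow> int \<Rightarrow> nat) \<Rightarrow> real) \<Rightarrow> int \<Rightarrow> (nat \<Rightarrow> int \<Rightarrow> nat) \<Rightarrow> real" where
  "avs f \<gamma> x = enn2real (nnavg \<gamma> (\<lambda>y. ennreal (\<bar>f y\<bar> powr s)) x)"

lemma avs_nonneg [simp]: "0 \<le> avs f \<gamma> x"
  by (simp add: avs_def)

lemma avs_level_const: "level_const \<gamma> (avs f \<gamma>)"
  unfolding avs_def[abs_def] by (rule level_const_compose[OF nnavg_level_const])

lemma avs_measurable [measurable]: "avs f \<gamma> \<in> borel_measurable \<mu>"
  by (rule level_const_borel_measurable[OF avs_level_const])

text \<open>Interpolation between s and r at the height p^(-\<gamma> \<rho>), where the bounds for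
  both terms coincide.\<close>

lemma nnavg_powr_s_le:
  assumes f: "unit_morrey f" and x: "x \<in> X"
  shows "nnavg \<gamma> (\<lambda>y. ennreal (\<bar>f y\<bar> powr s)) x \<le> ennreal (2 * P (- (real_of_int \<gamma> * \<rho> * s)))"
proof -
  note [measurable] = unit_morrey_measurable[OF f]
  define t where "t = P (- (real_of_int \<gamma> * \<rho>))"
  have t: "0 < t" by (simp add: t_def)
  have "nnavg \<gamma> (\<lambda>y. ennreal (\<bar>f y\<bar> powr s)) x \<le>
      nnavg \<gamma> (\<lambda>y. ennreal (t powr s) + ennreal (t powr (s - r)) * ennreal (\<bar>f y\<bar> powr r)) x"
  proof (rule nnavg_mono[OF x])
    fix y
    show "ennreal (\<bar>f y\<bar> powr s) \<le> ennreal (t powr s) + ennreal (t powr (s - r)) * ennreal (\<bar>f y\<bar> powr r)"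
      using powr_le_interpolate[of "\<bar>f y\<bar>" t s r] t s_bounds
      by (simp add: ennreal_mult'[symmetric] ennreal_plus[symmetric] del: ennreal_plus)
  qed
  also have "\<dots> = ennreal (t powr s) + ennreal (t powr (s - r)) * nnavg \<gamma> (\<lambda>y. ennreal (\<bar>f y\<bar> powr r)) x"
    using x by (simp add: nnavg_add nnavg_cmult)
  also have "\<dots> \<le> ennreal (t powr s) + ennreal (t powr (s - r)) * ennreal (P (- (real_of_int \<gamma> * \<rho> * r)))"
    by (intro add_left_mono mult_left_mono unit_morrey_nnavg f x) auto
  also have "\<dots> = ennreal (2 * P (- (real_of_int \<gamma> * \<rho> * s)))"
    by (simp add: t_def powr_powr ennreal_mult'[symmetric] powr_add[symmetric] ennreal_plus[symmetric] algebra_simps del: ennreal_plus)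
  finally show ?thesis .
qed

lemma nnavg_powr_s_eq:
  assumes "unit_morrey f" "x \<in> X"
  shows "nnavg \<gamma> (\<lambda>y. ennreal (\<bar>f y\<bar> powr s)) x = ennreal (avs f \<gamma> x)"
  using nnavg_powr_s_le[OF assms, of \<gamma>] unfolding avs_def
  by (metis ennreal_enn2real ennreal_less_top order_le_less_trans)

lemma avs_le:
  assumes "unit_morrey f" "x \<in> X"
  shows "avs f \<gamma> x \<le> 2 * P (- (real_of_int \<gamma> * \<rho> * s))"
  using nnavg_powr_s_le[OF assms, of \<gamma>] unfolding nnavg_powr_s_eq[OF assms]
  by (simp add: ennreal_le_iff)

text \<open>Hoelder's inequality, from Young's inequality for h and |f| / c with c = avs^(1/s).
  Keeping \<open>c\<close> free also covers a vanishing average, by letting c tend to 0.\<close>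

lemma nnavg_mult_le:
  assumes f: "unit_morrey f" and x: "x \<in> X" and [measurable]: "h \<in> borel_measurable \<mu>"
    and h: "\<And>y. 0 \<le> h y" and C: "0 \<le> C"
    and le: "nnavg \<gamma> (\<lambda>y. ennreal (h y powr (s / (s - 1)))) x \<le> ennreal C"
  shows "nnavg \<gamma> (\<lambda>y. ennreal (h y * \<bar>f y\<bar>)) x \<le> ennreal ((C + 1) * avs f \<gamma> x powr (1 / s))"
proof -
  note [measurable] = unit_morrey_measurable[OF f]
  have *: "nnavg \<gamma> (\<lambda>y. ennreal (h y * \<bar>f y\<bar>)) x \<le> ennreal ((C + 1) * c)"
    if c: "0 < c" "avs f \<gamma> x \<le> c powr s" for c
  proof -
    have "nnavg \<gamma> (\<lambda>y. ennreal (h y * \<bar>f y\<bar>)) x \<le>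
      nnavg \<gamma> (\<lambda>y. ennreal c * (ennreal (h y powr (s / (s - 1))) + ennreal (1 / c powr s) * ennreal (\<bar>f y\<bar> powr s))) x"
    proof (rule nnavg_mono[OF x])
      fix y
      have "h y * (\<bar>f y\<bar> / c) \<le> h y powr (s / (s - 1)) + (\<bar>f y\<bar> / c) powr s"
        using c h s_bounds by (intro mult_le_powr_add_powr) auto
      then have "h y * \<bar>f y\<bar> \<le> c * (h y powr (s / (s - 1)) + (1 / c powr s) * \<bar>f y\<bar> powr s)"
        using c by (simp add: powr_divide field_simps)
      then show "ennreal (h y * \<bar>f y\<bar>) \<le> ennreal c * (ennreal (h y powr (s / (s - 1))) + ennreal (1 / c powr s) * ennreal (\<bar>f y\<bar> powr s))"
        using c by (simp add: ennreal_mult'[symmetric] ennreal_plus[symmetric] ennreal_leI del: ennreal_plus)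
    qed
    also have "\<dots> = ennreal c * (nnavg \<gamma> (\<lambda>y. ennreal (h y powr (s / (s - 1)))) x + ennreal (1 / c powr s) * ennreal (avs f \<gamma> x))"
      using x by (simp add: nnavg_add nnavg_cmult nnavg_powr_s_eq[OF f x])
    also have "\<dots> \<le> ennreal c * (ennreal C + ennreal 1)"
      using le c by (intro mult_left_mono add_mono) (auto simp: ennreal_mult'[symmetric] divide_le_eq_1 intro!: ennreal_leI simp del: ennreal_1)
    also have "\<dots> = ennreal ((C + 1) * c)"
      using c C by (simp add: ennreal_mult'[symmetric] ennreal_plus[symmetric] mult.commute del: ennreal_plus ennreal_1)
    finally show ?thesis .
  qed
  show ?thesis
  proof (cases "avs f \<gamma> x = 0")
    case False
    then have "0 < avs f \<gamma> x" by (simp add: less_le)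
    then show ?thesis using s_bounds by (intro *) (auto simp: powr_powr)
  next
    case True
    have "nnavg \<gamma> (\<lambda>y. ennreal (h y * \<bar>f y\<bar>)) x \<le> 0"
    proof (rule ennreal_le_epsilon)
      fix e :: real assume e: "0 < e"
      have "nnavg \<gamma> (\<lambda>y. ennreal (h y * \<bar>f y\<bar>)) x \<le> ennreal ((C + 1) * (e / (C + 1)))"
        using e C True by (intro *) auto
      then show "nnavg \<gamma> (\<lambda>y. ennreal (h y * \<bar>f y\<bar>)) x \<le> 0 + ennreal e" using C by simp
    qed
    then show ?thesis using True by simp
  qed
qed

text \<open>What remains to be averaged in a bound for p^(\<gamma> \<alpha> q) avs^(q/s): below the
  height |f|^q with the full weight, above it only |f|^s, since \<open>f\<close> need not be locally
  q-integrable. The missing power is paid by p^(-\<gamma> \<rho>), which changes the weight.\<close>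

definition split_fn :: "((nat \<Rightarrow> int \<Rightarrow> nat) \<Rightarrow> real) \<Rightarrow> int \<Rightarrow> (nat \<Rightarrow> int \<Rightarrow> nat) \<Rightarrow> real" where
  "split_fn f \<gamma> y = (if \<bar>f y\<bar> \<le> P (- (real_of_int \<gamma> * \<rho>))
     then P (of_int \<gamma> * (\<rho> * (q - r))) * \<bar>f y\<bar> powr q
     else P (of_int (- \<gamma>) * (\<rho> * (r - s))) * \<bar>f y\<bar> powr s)"

lemma split_fn_nonneg [simp]: "0 \<le> split_fn f \<gamma> y"
  by (simp add: split_fn_def)

lemma split_fn_measurable [measurable (raw)]:
  assumes [measurable]: "f \<in> borel_measurable \<mu>"
  shows "split_fn f \<gamma> \<in> borel_measurable \<mu>"
  unfolding split_fn_def[abs_def] by measurable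

text \<open>Each branch is a one-sided geometric series in \<gamma>: the weight p^(\<gamma> c1)
  never exceeds |f y|^(r - q) in the first, and p^(-\<gamma> c2) never exceeds |f y|^(r - s) in the
  second.\<close>

lemma sum_split_fn_le:
  obtains C where "0 \<le> C" 
    "\<And>f y. (\<integral>\<^sup>+\<gamma>. ennreal (split_fn f \<gamma> y) \<partial>count_space UNIV) \<le> ennreal (C * \<bar>f y\<bar> powr r)"
proof -
  define c1 c2 where "c1 = \<rho> * (q - r)" and "c2 = \<rho> * (r - s)"
  have c: "0 < c1" "0 < c2" using \<rho>_gt q_alt(1) s_bounds by (auto simp: c1_def c2_def)
  define C1 C2 where "C1 = 1 / (1 - P (- c1))" and "C2 = 1 / (1 - P (- c2))"
  have "P (- c1) < 1" "P (- c2) < 1" using c P_less_iff[of "- c1" 0] P_less_iff[of "- c2" 0] by auto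
  then have C: "0 \<le> C1" "0 \<le> C2" using c by (auto simp: C1_def C2_def)
  show ?thesis
  proof (rule that[of "C1 + C2"])
    show "0 \<le> C1 + C2" using C by simp
    fix f :: "(nat \<Rightarrow> int \<Rightarrow> nat) \<Rightarrow> real" and y
    show "(\<integral>\<^sup>+\<gamma>. ennreal (split_fn f \<gamma> y) \<partial>count_space UNIV) \<le> ennreal ((C1 + C2) * \<bar>f y\<bar> powr r)"
    proof (cases "f y = 0")
      case True
      then show ?thesis using q_alt(1) s_bounds by (simp add: split_fn_def)
    next
      case False
      define v where "v = \<bar>f y\<bar>"
      have v: "0 < v" using False by (simp add: v_def)
      let ?F = "\<lambda>c T \<gamma>. if P (of_int \<gamma> * c) \<le> T then P (of_int \<gamma> * c) else 0"
      have le: "split_fn f \<gamma> y \<le> v powr q * ?F c1 (v powr (r - q)) \<gamma> + v powr s * ?F c2 (v powr (r - s)) (- \<gamma>)" for \<gamma>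
      proof (cases "v \<le> P (- (real_of_int \<gamma> * \<rho>))")
        case True
        then have "P (- (real_of_int \<gamma> * \<rho>)) powr (r - q) \<le> v powr (r - q)"
          using v q_alt(1) by (intro powr_mono2') auto
        then have "P (of_int \<gamma> * c1) \<le> v powr (r - q)"
          by (simp add: powr_powr c1_def algebra_simps)
        then show ?thesis using True by (simp add: split_fn_def v_def c1_def)
      next
        case False
        then have "P (- (real_of_int \<gamma> * \<rho>)) powr (r - s) \<le> v powr (r - s)"
          using v s_bounds by (intro powr_mono2) auto
        then have "P (of_int (- \<gamma>) * c2) \<le> v powr (r - s)"
          by (simp add: powr_powr c2_def algebra_simps)
        then show ?thesis using False by (simp add: split_fn_def v_def c2_def)
      qed
      have "(\<integral>\<^sup>+\<gamma>. ennreal (split_fn f \<gamma> y) \<partial>count_space UNIV) \<le>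
        (\<integral>\<^sup>+\<gamma>. ennreal (v powr q) * ennreal (?F c1 (v powr (r - q)) \<gamma>) + ennreal (v powr s) * ennreal (?F c2 (v powr (r - s)) (- \<gamma>)) \<partial>count_space UNIV)"
      proof (rule nn_integral_mono)
        fix \<gamma>
        have nn: "0 \<le> ?F c1 (v powr (r - q)) \<gamma>" "0 \<le> ?F c2 (v powr (r - s)) (- \<gamma>)" by simp_all
        have "ennreal (split_fn f \<gamma> y) \<le> ennreal (v powr q * ?F c1 (v powr (r - q)) \<gamma> + v powr s * ?F c2 (v powr (r - s)) (- \<gamma>))"
          by (rule ennreal_leI[OF le])
        also have "\<dots> = ennreal (v powr q) * ennreal (?F c1 (v powr (r - q)) \<gamma>) + ennreal (v powr s) * ennreal (?F c2 (v powr (r - s)) (- \<gamma>))"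
          using nn by (subst ennreal_plus) (auto simp only: ennreal_mult' powr_ge_zero mult_nonneg_nonneg)
        finally show "ennreal (split_fn f \<gamma> y) \<le> \<dots>" .
      qed
      also have "\<dots> = ennreal (v powr q) * (\<integral>\<^sup>+\<gamma>. ennreal (?F c1 (v powr (r - q)) \<gamma>) \<partial>count_space UNIV)
          + ennreal (v powr s) * (\<integral>\<^sup>+\<gamma>. ennreal (?F c2 (v powr (r - s)) (- \<gamma>)) \<partial>count_space UNIV)"
        by (simp add: nn_integral_add nn_integral_cmult del: of_int_minus)
      also have "(\<integral>\<^sup>+\<gamma>. ennreal (?F c2 (v powr (r - s)) (- \<gamma>)) \<partial>count_space UNIV) =
          (\<integral>\<^sup>+\<gamma>. ennreal (?F c2 (v powr (r - s)) \<gamma>) \<partial>count_space UNIV)"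
        by (rule nn_integral_bij_count_space) (rule bij_uminus)
      also have "ennreal (v powr q) * (\<integral>\<^sup>+\<gamma>. ennreal (?F c1 (v powr (r - q)) \<gamma>) \<partial>count_space UNIV) +
          ennreal (v powr s) * (\<integral>\<^sup>+\<gamma>. ennreal (?F c2 (v powr (r - s)) \<gamma>) \<partial>count_space UNIV)
        \<le> ennreal (v powr q) * ennreal (C1 * v powr (r - q)) + ennreal (v powr s) * ennreal (C2 * v powr (r - s))"
        unfolding C1_def C2_def using c v
        by (intro add_mono mult_left_mono nn_integral_geometric_int) auto
      also have "\<dots> = ennreal (C1 * (v powr q * v powr (r - q)) + C2 * (v powr s * v powr (r - s)))"
        using C by (simp add: ennreal_mult'[symmetric] ennreal_plus[symmetric] ac_simps del: ennreal_plus)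
      also have "\<dots> = ennreal ((C1 + C2) * v powr r)"
        by (simp add: powr_add[symmetric] algebra_simps)
      finally show ?thesis by (simp add: v_def)
    qed
  qed
qed

lemma avs_powr_le_split:
  assumes f: "unit_morrey f" and x: "x \<in> X"
  shows "ennreal (P (of_int \<gamma> * \<alpha> * q) * avs f \<gamma> x powr (q / s)) \<le>
    ennreal (4 powr (q / s)) * nnavg \<gamma> (\<lambda>y. ennreal (split_fn f \<gamma> y)) x"
proof -
  note [measurable] = unit_morrey_measurable[OF f]
  define t where "t = P (- (real_of_int \<gamma> * \<rho>))"
  have t: "0 < t" by (simp add: t_def)
  define k where "k = q / s"
  have k: "1 < k" "s * k = q" using q_alt(1) s_bounds by (auto simp: k_def)
  define fs fl where "fs y = (if \<bar>f y\<bar> \<le> t then \<bar>f y\<bar> powr s else 0)"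
    and "fl y = (if \<bar>f y\<bar> \<le> t then 0 else \<bar>f y\<bar> powr s)" for y
  have [measurable]: "fs \<in> borel_measurable \<mu>" "fl \<in> borel_measurable \<mu>"
    unfolding fs_def[abs_def] fl_def[abs_def] by measurable
  have nn: "0 \<le> fs y" "0 \<le> fl y" for y by (auto simp: fs_def fl_def)
  define U V where "U = nnavg \<gamma> (\<lambda>y. ennreal (fs y)) x" and "V = nnavg \<gamma> (\<lambda>y. ennreal (fl y)) x"
  have UV: "ennreal (avs f \<gamma> x) = U + V"
    unfolding U_def V_def nnavg_powr_s_eq[OF f x, symmetric]
    by (subst nnavg_add[OF x, symmetric]) (auto simp: fs_def fl_def intro!: nnavg_cong[OF x])
  have "U \<le> ennreal (avs f \<gamma> x)" "V \<le> ennreal (avs f \<gamma> x)" unfolding UV by simp_all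
  then have fin: "U < top" "V < top" by (auto intro: order_le_less_trans)
  define u v where "u = enn2real U" and "v = enn2real V"
  have uv: "U = ennreal u" "V = ennreal v" "0 \<le> u" "0 \<le> v" using fin by (auto simp: u_def v_def)
  have a: "avs f \<gamma> x = u + v" using UV uv by (simp add: ennreal_plus[symmetric] del: ennreal_plus)
  have vle: "v \<le> 2 * t powr s"
    using avs_le[OF f x, of \<gamma>] a uv by (simp add: t_def powr_powr)
  have 1: "ennreal (u powr k) \<le> ennreal (2 powr k) * nnavg \<gamma> (\<lambda>y. ennreal (fs y powr k)) x"
    by (rule nnavg_powr_le[OF x _ nn(1)]) (use uv k in \<open>auto simp: U_def\<close>)
  \<comment> \<open>Jensen would ask for |f|^q where \<open>f\<close> is large. Instead k - 1 of the
    k powers of \<open>v\<close> use the bound v <= 2 t^s, and one power is kept.\<close>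
  have 2: "v powr k \<le> 2 powr k * (t powr (q - s) * v)"
  proof (cases "v = 0")
    case False
    then have "v powr k = v powr (k - 1) * v" using uv powr_add[of v "k - 1" 1] by simp
    also have "\<dots> \<le> (2 * t powr s) powr (k - 1) * v"
      using vle uv k by (intro mult_right_mono powr_mono2) auto
    also have "\<dots> = 2 powr (k - 1) * (t powr (q - s) * v)"
      using t k by (simp add: powr_mult powr_powr algebra_simps)
    also have "\<dots> \<le> 2 powr k * (t powr (q - s) * v)"
      using uv by (intro mult_right_mono powr_mono) auto
    finally show ?thesis .
  qed (use k in simp)
  define A where "A = P (of_int \<gamma> * \<alpha> * q)"
  have A: "A = P (of_int \<gamma> * (\<rho> * (q - r)))" unfolding A_def q_alt(2)[symmetric] by (simp add: mult.assoc)
  have "A * (u + v) powr k \<le> A * (2 powr k * (u powr k + v powr k))"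
    using uv k by (intro mult_left_mono powr_add_le) (auto simp: A_def)
  also have "\<dots> \<le> A * (2 powr k * (u powr k + 2 powr k * (t powr (q - s) * v)))"
    using 2 by (intro mult_left_mono add_left_mono) (auto simp: A_def)
  finally have "ennreal (A * (u + v) powr k) \<le> ennreal (A * (2 powr k * (u powr k + 2 powr k * (t powr (q - s) * v))))"
    by (rule ennreal_leI)
  also have "\<dots> = ennreal A * (ennreal (2 powr k) * (ennreal (u powr k) + ennreal (2 powr k) * (ennreal (t powr (q - s)) * V)))"
    using uv by (simp add: ennreal_mult' A_def)
  also have "\<dots> \<le> ennreal A * (ennreal (2 powr k) * (ennreal (2 powr k) * nnavg \<gamma> (\<lambda>y. ennreal (fs y powr k)) x + ennreal (2 powr k) * (ennreal (t powr (q - s)) * V)))"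
    by (intro mult_left_mono add_right_mono 1) auto
  also have "\<dots> = (ennreal (2 powr k) * ennreal (2 powr k)) * 
      (ennreal A * nnavg \<gamma> (\<lambda>y. ennreal (fs y powr k)) x + ennreal (A * t powr (q - s)) * V)"
    by (simp add: distrib_left ac_simps ennreal_mult' A_def)
  also have "\<dots> = ennreal (4 powr k) * nnavg \<gamma> (\<lambda>y. ennreal A * ennreal (fs y powr k) + ennreal (A * t powr (q - s)) * ennreal (fl y)) x"
  proof -
    have "(4::real) powr k = 2 powr k * 2 powr k" by (simp add: powr_mult[symmetric])
    then show ?thesis unfolding V_def using x by (simp add: nnavg_add nnavg_cmult ennreal_mult'[symmetric])
  qed
  also have "nnavg \<gamma> (\<lambda>y. ennreal A * ennreal (fs y powr k) + ennreal (A * t powr (q - s)) * ennreal (fl y)) x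
     = nnavg \<gamma> (\<lambda>y. ennreal (split_fn f \<gamma> y)) x"
  proof (rule nnavg_cong[OF x])
    fix y
    have At: "A * t powr (q - s) = P (of_int (- \<gamma>) * (\<rho> * (r - s)))"
      unfolding A t_def by (simp add: powr_powr powr_add[symmetric] algebra_simps)
    show "ennreal A * ennreal (fs y powr k) + ennreal (A * t powr (q - s)) * ennreal (fl y) = ennreal (split_fn f \<gamma> y)"
      unfolding At using k by (simp add: split_fn_def fs_def fl_def t_def[symmetric] A powr_powr ennreal_mult'[symmetric])
  qed
  finally show ?thesis unfolding a A_def k_def .
qed

text \<open>For \<gamma> <= \<gamma>0 the ball \<open>B \<gamma>0 x0\<close> is a union of
  \<gamma>-balls, so the averaging disappears under the integral. After exchanging sum and integral,
  \<open>sum_split_fn_le\<close> leaves |f|^r.\<close>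

lemma sum_small_scales:
  obtains C where "0 \<le> C"
    "\<And>f \<gamma>0 x0. unit_morrey f \<Longrightarrow> x0 \<in> X \<Longrightarrow>
      (\<integral>\<^sup>+\<gamma>. (\<integral>\<^sup>+x\<in>B \<gamma>0 x0. ennreal (P (of_int \<gamma> * \<alpha> * q) * avs f \<gamma> x powr (q / s)) \<partial>\<mu>) \<partial>count_space {..\<gamma>0})
        \<le> ennreal (C * P (of_int \<gamma>0 * lam))"
proof -
  obtain C where C: "0 \<le> C"
    "\<And>f y. (\<integral>\<^sup>+\<gamma>. ennreal (split_fn f \<gamma> y) \<partial>count_space UNIV) \<le> ennreal (C * \<bar>f y\<bar> powr r)"
    using sum_split_fn_le by blast
  show ?thesis
  proof (rule that[of "4 powr (q / s) * C"])
    fix f \<gamma>0 x0 assume f: "unit_morrey f" and x0: "x0 \<in> X"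
    note [measurable] = unit_morrey_measurable[OF f]
    have [measurable]: "B \<gamma>0 x0 \<in> sets \<mu>" using x0 by simp
    let ?S = "B \<gamma>0 x0" and ?c = "ennreal (4 powr (q / s))"
    have "(\<integral>\<^sup>+\<gamma>. (\<integral>\<^sup>+x\<in>?S. ennreal (P (of_int \<gamma> * \<alpha> * q) * avs f \<gamma> x powr (q / s)) \<partial>\<mu>) \<partial>count_space {..\<gamma>0})
      \<le> (\<integral>\<^sup>+\<gamma>. (\<integral>\<^sup>+x\<in>?S. ?c * ennreal (split_fn f \<gamma> x) \<partial>\<mu>) \<partial>count_space {..\<gamma>0})"
    proof (rule nn_integral_mono)
      fix \<gamma> assume "\<gamma> \<in> space (count_space {..\<gamma>0})"
      then have \<gamma>: "\<gamma> \<le> \<gamma>0" by simp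
      have "(\<integral>\<^sup>+x\<in>?S. ennreal (P (of_int \<gamma> * \<alpha> * q) * avs f \<gamma> x powr (q / s)) \<partial>\<mu>)
        \<le> (\<integral>\<^sup>+x. ?c * (indicator ?S x * nnavg \<gamma> (\<lambda>y. ennreal (split_fn f \<gamma> y)) x) \<partial>\<mu>)"
        using avs_powr_le_split[OF f] by (intro nn_integral_mono) (auto simp: indicator_def)
      also have "\<dots> = ?c * (\<integral>\<^sup>+x. indicator ?S x * nnavg \<gamma> (\<lambda>y. ennreal (split_fn f \<gamma> y)) x \<partial>\<mu>)"
        by (rule nn_integral_cmult) auto
      also have "(\<integral>\<^sup>+x. indicator ?S x * nnavg \<gamma> (\<lambda>y. ennreal (split_fn f \<gamma> y)) x \<partial>\<mu>) =
         (\<integral>\<^sup>+x. indicator ?S x * ennreal (split_fn f \<gamma> x) \<partial>\<mu>)"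
        by (rule nn_integral_level_const_mult[symmetric, OF _ level_const_indicator_pball[OF x0 \<gamma>]]) auto
      also have "?c * \<dots> = (\<integral>\<^sup>+x. ?c * (indicator ?S x * ennreal (split_fn f \<gamma> x)) \<partial>\<mu>)"
        by (rule nn_integral_cmult[symmetric]) auto
      finally show "(\<integral>\<^sup>+x\<in>?S. ennreal (P (of_int \<gamma> * \<alpha> * q) * avs f \<gamma> x powr (q / s)) \<partial>\<mu>)
        \<le> (\<integral>\<^sup>+x\<in>?S. ?c * ennreal (split_fn f \<gamma> x) \<partial>\<mu>)" by (simp add: ac_simps)
    qed
    also have "\<dots> = (\<integral>\<^sup>+x. (\<integral>\<^sup>+\<gamma>. ?c * ennreal (split_fn f \<gamma> x) * indicator ?S x \<partial>count_space {..\<gamma>0}) \<partial>\<mu>)"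
      by (rule nn_integral_count_space_nn_integral[symmetric]) auto
    also have "\<dots> \<le> (\<integral>\<^sup>+x. ennreal (4 powr (q / s) * C) * (ennreal (\<bar>f x\<bar> powr r) * indicator ?S x) \<partial>\<mu>)"
    proof (rule nn_integral_mono)
      fix x
      have "(\<integral>\<^sup>+\<gamma>. ennreal (split_fn f \<gamma> x) \<partial>count_space {..\<gamma>0}) \<le> (\<integral>\<^sup>+\<gamma>. ennreal (split_fn f \<gamma> x) \<partial>count_space UNIV)"
        by (subst nn_integral_count_space_indicator) (auto intro!: nn_integral_mono simp: indicator_def)
      also have "\<dots> \<le> ennreal (C * \<bar>f x\<bar> powr r)" by (rule C)
      finally have "?c * (\<integral>\<^sup>+\<gamma>. ennreal (split_fn f \<gamma> x) \<partial>count_space {..\<gamma>0}) * indicator ?S x \<le> ?c * ennreal (C * \<bar>f x\<bar> powr r) * indicator ?S x"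
        by (intro mult_left_mono mult_right_mono) auto
      then show "(\<integral>\<^sup>+\<gamma>. ?c * ennreal (split_fn f \<gamma> x) * indicator ?S x \<partial>count_space {..\<gamma>0})
        \<le> ennreal (4 powr (q / s) * C) * (ennreal (\<bar>f x\<bar> powr r) * indicator ?S x)"
        using C(1) by (simp add: nn_integral_multc nn_integral_cmult ennreal_mult' mult.assoc)
    qed
    also have "\<dots> = ennreal (4 powr (q / s) * C) * (\<integral>\<^sup>+x\<in>?S. ennreal (\<bar>f x\<bar> powr r) \<partial>\<mu>)"
      by (rule nn_integral_cmult) auto
    also have "\<dots> \<le> ennreal (4 powr (q / s) * C) * ennreal (P (of_int \<gamma>0 * lam))"
      using f x0 by (intro mult_left_mono) (auto simp: unit_morrey_def)
    also have "\<dots> = ennreal (4 powr (q / s) * C * P (of_int \<gamma>0 * lam))"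
      using C(1) by (simp add: ennreal_mult')
    finally show "(\<integral>\<^sup>+\<gamma>. (\<integral>\<^sup>+x\<in>?S. ennreal (P (of_int \<gamma> * \<alpha> * q) * avs f \<gamma> x powr (q / s)) \<partial>\<mu>) \<partial>count_space {..\<gamma>0})
        \<le> \<dots>" .
  qed (use C in simp)
qed

end

section \<open>Contributions of single scales with a BMO weight\<close>

locale padic_morrey_bmo = padic_morrey +
  fixes b :: "(nat \<Rightarrow> int \<Rightarrow> nat) \<Rightarrow> real" and D :: real
  assumes b_loc: "loc_integrable p n b" and D: "1 \<le> D"
    and bmo: "\<And>\<gamma> x. x \<in> X \<Longrightarrow> nnavg \<gamma> (\<lambda>y. ennreal \<bar>b y - pavg p n b (B \<gamma> x)\<bar>) x \<le> ennreal D"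
begin

lemma b_measurable [measurable]: "b \<in> borel_measurable \<mu>"
  by (rule loc_integrable_measurable[OF b_loc])

definition bavg :: "int \<Rightarrow> (nat \<Rightarrow> int \<Rightarrow> nat) \<Rightarrow> real" where
  "bavg \<gamma> x = pavg p n b (B \<gamma> x)"

lemma bavg_level_const: "level_const \<gamma> (bavg \<gamma>)"
  unfolding bavg_def[abs_def] by (rule level_const_ball)

lemma bavg_measurable [measurable]: "bavg \<gamma> \<in> borel_measurable \<mu>"
  by (rule level_const_borel_measurable[OF bavg_level_const])

text \<open>Passing to the ball one level up moves the average by at most p^n D, by comparison with
  the larger ball.\<close>

lemma bavg_telescope:
  assumes x: "x \<in> X"
  shows "\<bar>bavg \<gamma> x - bavg (\<gamma> + int j) x\<bar> \<le> real j * (P (real n) * D)"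
proof (induction j)
  case (Suc j)
  let ?\<gamma> = "\<gamma> + int j"
  have "ennreal \<bar>bavg ?\<gamma> x - bavg (?\<gamma> + 1) x\<bar> \<le> nnavg ?\<gamma> (\<lambda>y. ennreal \<bar>b y - bavg (?\<gamma> + 1) x\<bar>) x"
    unfolding bavg_def by (rule pavg_diff_le[OF b_loc x])
  also have "\<dots> \<le> ennreal (P (real n)) * nnavg (?\<gamma> + 1) (\<lambda>y. ennreal \<bar>b y - bavg (?\<gamma> + 1) x\<bar>) x"
    using nnavg_le_nnavg_larger[OF x, of ?\<gamma> "?\<gamma> + 1"] by simp
  also have "\<dots> \<le> ennreal (P (real n)) * ennreal D"
    unfolding bavg_def by (intro mult_left_mono bmo x) auto
  also have "\<dots> = ennreal (P (real n) * D)" by (simp add: ennreal_mult')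
  finally have "\<bar>bavg ?\<gamma> x - bavg (?\<gamma> + 1) x\<bar> \<le> P (real n) * D"
    using D by (simp add: ennreal_le_iff)
  moreover have "\<gamma> + int (Suc j) = ?\<gamma> + 1" by simp
  ultimately show ?case using Suc by (simp add: algebra_simps)
qed simp

text \<open>The summand 1 lets one weight serve both the maximal function and the maximal
  commutator.\<close>

lemma weight_moment:
  obtains C where "0 \<le> C"
    "\<And>\<gamma> x. x \<in> X \<Longrightarrow> nnavg \<gamma> (\<lambda>y. ennreal ((1 + \<bar>b y - bavg \<gamma> x\<bar>) powr q)) x \<le> ennreal C"
proof -
  have q: "0 < q" using q_alt(1) s_bounds by linarith
  obtain C where C: "0 \<le> C"
    "\<And>\<gamma> x. x \<in> X \<Longrightarrow> nnavg \<gamma> (\<lambda>y. ennreal (\<bar>b y - pavg p n b (B \<gamma> x)\<bar> powr q)) x \<le> ennreal C"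
    using bmo_moments[OF b_loc _ bmo q] D by auto
  show ?thesis
  proof (rule that)
    show "0 \<le> 2 powr q * (1 + C)" using C by simp
    fix \<gamma> x assume x: "x \<in> X"
    have "nnavg \<gamma> (\<lambda>y. ennreal ((1 + \<bar>b y - bavg \<gamma> x\<bar>) powr q)) x \<le>
      nnavg \<gamma> (\<lambda>y. ennreal (2 powr q) * (1 + ennreal (\<bar>b y - bavg \<gamma> x\<bar> powr q))) x"
    proof (rule nnavg_mono[OF x])
      fix y
      have "(1 + \<bar>b y - bavg \<gamma> x\<bar>) powr q \<le> 2 powr q * (1 + \<bar>b y - bavg \<gamma> x\<bar> powr q)"
        using powr_add_le[of 1 "\<bar>b y - bavg \<gamma> x\<bar>" q] q by simp
      then have "ennreal ((1 + \<bar>b y - bavg \<gamma> x\<bar>) powr q) \<le> ennreal (2 powr q * (1 + \<bar>b y - bavg \<gamma> x\<bar> powr q))"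
        by (rule ennreal_leI)
      then show "ennreal ((1 + \<bar>b y - bavg \<gamma> x\<bar>) powr q) \<le> ennreal (2 powr q) * (1 + ennreal (\<bar>b y - bavg \<gamma> x\<bar> powr q))"
        by (simp add: ennreal_mult')
    qed
    also have "\<dots> = ennreal (2 powr q) * (1 + nnavg \<gamma> (\<lambda>y. ennreal (\<bar>b y - bavg \<gamma> x\<bar> powr q)) x)"
      using x by (simp add: nnavg_cmult nnavg_add)
    also have "\<dots> \<le> ennreal (2 powr q) * (1 + ennreal C)"
      using C(2)[OF x] unfolding bavg_def by (intro mult_left_mono add_left_mono) auto
    also have "\<dots> = ennreal (2 powr q * (1 + C))"
      using C(1) by (simp add: ennreal_mult')
    finally show "nnavg \<gamma> (\<lambda>y. ennreal ((1 + \<bar>b y - bavg \<gamma> x\<bar>) powr q)) x \<le> ennreal (2 powr q * (1 + C))" .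
  qed
qed

text \<open>Up to a constant factor, \<open>scale_bound f \<gamma> x\<close> dominates the contribution of the ball of
  radius \<open>p\<^sup>\<gamma>\<close> about \<open>x\<close> to both maximal operators.\<close>
definition scale_bound :: "((nat \<Rightarrow> int \<Rightarrow> nat) \<Rightarrow> real) \<Rightarrow> int \<Rightarrow> (nat \<Rightarrow> int \<Rightarrow> nat) \<Rightarrow> real" where
  "scale_bound f \<gamma> x = (1 + \<bar>b x - bavg \<gamma> x\<bar>) * (P (of_int \<gamma> * \<alpha>) * avs f \<gamma> x powr (1 / s))"

lemma scale_bound_nonneg [simp]: "0 \<le> scale_bound f \<gamma> x"
  by (simp add: scale_bound_def)

lemma scale_bound_measurable [measurable]: "scale_bound f \<gamma> \<in> borel_measurable \<mu>"
  unfolding scale_bound_def[abs_def] by measurable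

lemma scale_bound_powr:
  "scale_bound f \<gamma> x powr q =
    (1 + \<bar>b x - bavg \<gamma> x\<bar>) powr q * (P (of_int \<gamma> * \<alpha> * q) * avs f \<gamma> x powr (q / s))"
  by (simp add: scale_bound_def powr_mult powr_powr)

text \<open>Up to \<gamma>0 the factor \<open>avs\<close> is constant on \<gamma>-balls, so the
  weight is replaced by its bounded average. Above \<gamma>0 the bounds are pointwise: at level
  \<gamma>0 + j the weight has grown by a factor linear in j, against a decay of p^(-(n - lam) j)
  for the q-th power.\<close>

lemma sum_scale_bounds:
  obtains C where "0 \<le> C"
    "\<And>f \<gamma>0 x0. unit_morrey f \<Longrightarrow> x0 \<in> X \<Longrightarrow>
      (\<integral>\<^sup>+x\<in>B \<gamma>0 x0. (\<integral>\<^sup>+\<gamma>. ennreal (scale_bound f \<gamma> x powr q) \<partial>count_space UNIV) \<partial>\<mu>)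
        \<le> ennreal (C * P (of_int \<gamma>0 * lam))"
proof -
  have q: "0 < q" using q_alt(1) s_bounds by linarith
  obtain C1 where C1: "0 \<le> C1"
    "\<And>\<gamma> x. x \<in> X \<Longrightarrow> nnavg \<gamma> (\<lambda>y. ennreal ((1 + \<bar>b y - bavg \<gamma> x\<bar>) powr q)) x \<le> ennreal C1"
    using weight_moment by blast
  obtain C2 where C2: "0 \<le> C2"
    "\<And>f \<gamma>0 x0. unit_morrey f \<Longrightarrow> x0 \<in> X \<Longrightarrow>
      (\<integral>\<^sup>+\<gamma>. (\<integral>\<^sup>+x\<in>B \<gamma>0 x0. ennreal (P (of_int \<gamma> * \<alpha> * q) * avs f \<gamma> x powr (q / s)) \<partial>\<mu>) \<partial>count_space {..\<gamma>0})
        \<le> ennreal (C2 * P (of_int \<gamma>0 * lam))"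
    using sum_small_scales by blast
  define c where "c = P (real n) * D"
  have c: "1 \<le> c" unfolding c_def using D mult_mono[of 1 "P (real n)" 1 D] by simp
  define z where "z = P (- (real n - lam))"
  have z: "0 \<le> z" "z < 1"
    using P_less_iff[of "- (real n - lam)" 0] mult_pos_pos[of \<rho> r] \<rho>_gt s_bounds unfolding z_def q_alt(4)
    by auto
  define C3 where "C3 = (\<Sum>j. ((real j + 1) * c) powr q * z ^ j)"
  have sm: "summable (\<lambda>j. ((real j + 1) * c) powr q * z ^ j)"
    using z c by (intro summable_powr_geometric) auto
  have C3: "0 \<le> C3" unfolding C3_def using sm z by (intro suminf_nonneg) auto
  show ?thesis
  proof (rule that[of "C1 * C2 + 2 powr q * C1 * C3"])
    show "0 \<le> C1 * C2 + 2 powr q * C1 * C3" using C1(1) C2(1) C3 by simp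
    fix f \<gamma>0 x0 assume f: "unit_morrey f" and x0: "x0 \<in> X"
    note [measurable] = unit_morrey_measurable[OF f]
    let ?S = "B \<gamma>0 x0"
    have [measurable]: "?S \<in> sets \<mu>" using x0 by simp
    define F where "F \<gamma> = (\<integral>\<^sup>+x\<in>?S. ennreal (scale_bound f \<gamma> x powr q) \<partial>\<mu>)" for \<gamma>
    have small: "F \<gamma> \<le> ennreal C1 * (\<integral>\<^sup>+x\<in>?S. ennreal (P (of_int \<gamma> * \<alpha> * q) * avs f \<gamma> x powr (q / s)) \<partial>\<mu>)"
      if \<gamma>: "\<gamma> \<le> \<gamma>0" for \<gamma>
    proof -
      define g where "g x = indicator ?S x * ennreal (P (of_int \<gamma> * \<alpha> * q) * avs f \<gamma> x powr (q / s))" for x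
      have g: "level_const \<gamma> g"
        unfolding g_def[abs_def]
        by (rule level_const_compose2[OF level_const_indicator_pball[OF x0 \<gamma>] avs_level_const,
              where F = "\<lambda>i a. i * ennreal (P (of_int \<gamma> * \<alpha> * q) * a powr (q / s))"])
      have [measurable]: "g \<in> borel_measurable \<mu>" by (rule level_const_borel_measurable[OF g])
      have "F \<gamma> = (\<integral>\<^sup>+x. g x * ennreal ((1 + \<bar>b x - bavg \<gamma> x\<bar>) powr q) \<partial>\<mu>)"
        unfolding F_def g_def scale_bound_powr
        by (intro nn_integral_cong) (simp add: ennreal_mult' ac_simps)
      also have "\<dots> = (\<integral>\<^sup>+x. g x * nnavg \<gamma> (\<lambda>y. ennreal ((1 + \<bar>b y - bavg \<gamma> y\<bar>) powr q)) x \<partial>\<mu>)"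
        by (rule nn_integral_level_const_mult[OF _ g]) measurable
      also have "\<dots> \<le> (\<integral>\<^sup>+x. ennreal C1 * g x \<partial>\<mu>)"
      proof (rule nn_integral_mono)
        fix x assume "x \<in> space \<mu>"
        then have x: "x \<in> X" by simp
        have "nnavg \<gamma> (\<lambda>y. ennreal ((1 + \<bar>b y - bavg \<gamma> y\<bar>) powr q)) x =
            nnavg \<gamma> (\<lambda>y. ennreal ((1 + \<bar>b y - bavg \<gamma> x\<bar>) powr q)) x"
          by (intro nnavg_cong[OF x]) (simp add: level_constD[OF bavg_level_const x])
        then show "g x * nnavg \<gamma> (\<lambda>y. ennreal ((1 + \<bar>b y - bavg \<gamma> y\<bar>) powr q)) x \<le> ennreal C1 * g x"
          using mult_right_mono[OF C1(2)[OF x, of \<gamma>], of "g x"] by (simp add: mult.commute)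
      qed
      also have "\<dots> = ennreal C1 * (\<integral>\<^sup>+x. g x \<partial>\<mu>)" by (rule nn_integral_cmult) measurable
      finally show ?thesis by (simp add: g_def mult.commute)
    qed
    have large: "F (\<gamma>0 + int j) \<le>
        ennreal (2 powr q * C1 * P (of_int \<gamma>0 * lam)) * ennreal (((real j + 1) * c) powr q * z ^ j)" for j
    proof -
      define \<gamma> where "\<gamma> = \<gamma>0 + int j"
      define H where "H = P (of_int \<gamma> * (\<alpha> - \<rho>) * q)"
      let ?w = "\<lambda>x. (1 + \<bar>b x - bavg \<gamma>0 x0\<bar>) powr q"
      have pt: "scale_bound f \<gamma> x powr q \<le> 2 powr q * H * ((real j + 1) * c) powr q * ?w x" if "x \<in> ?S" for x
      proof -
        have x: "x \<in> X" using that pball_subset by blast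
        have "bavg \<gamma> x = bavg \<gamma> x0"
          using pball_cong'[OF x0 that, of \<gamma>] by (simp add: bavg_def \<gamma>_def)
        moreover have "\<bar>bavg \<gamma>0 x0 - bavg \<gamma> x0\<bar> \<le> real j * c"
          using bavg_telescope[OF x0, of \<gamma>0 j] by (simp add: \<gamma>_def c_def)
        ultimately have W: "\<bar>b x - bavg \<gamma> x\<bar> \<le> \<bar>b x - bavg \<gamma>0 x0\<bar> + real j * c" by simp
        \<comment> \<open>Applied with k = (j + 1) c, so k - c = j c: the drift of the average
          becomes a factor in front of the weight of level \<gamma>0.\<close>
        have arith: "1 + W \<le> k * (1 + A)" if "W \<le> A + (k - c)" "0 \<le> A" "1 \<le> k" for W A k
          using that c mult_right_mono[of 1 k A] by (simp add: distrib_left)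
        have "1 \<le> (real j + 1) * c" using c mult_mono[of 1 "real j + 1" 1 c] by simp
        then have w: "1 + \<bar>b x - bavg \<gamma> x\<bar> \<le> (real j + 1) * c * (1 + \<bar>b x - bavg \<gamma>0 x0\<bar>)"
          using W by (intro arith) (auto simp: algebra_simps)
        have "avs f \<gamma> x powr (1 / s) \<le> (2 * P (- (real_of_int \<gamma> * \<rho> * s))) powr (1 / s)"
          using s_bounds by (intro powr_mono2 avs_le[OF f x]) auto
        also have "\<dots> = 2 powr (1 / s) * P (- (real_of_int \<gamma> * \<rho>))"
          using s_bounds by (simp add: powr_mult powr_powr)
        also have "\<dots> \<le> 2 powr 1 * P (- (real_of_int \<gamma> * \<rho>))"
          using s_bounds by (intro mult_right_mono powr_mono) auto
        finally have "P (of_int \<gamma> * \<alpha>) * avs f \<gamma> x powr (1 / s) \<le> P (of_int \<gamma> * \<alpha>) * (2 * P (- (real_of_int \<gamma> * \<rho>)))"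
          by (intro mult_left_mono) auto
        also have "\<dots> = 2 * P (of_int \<gamma> * (\<alpha> - \<rho>))"
          by (simp add: powr_add[symmetric] algebra_simps)
        finally have av: "P (of_int \<gamma> * \<alpha>) * avs f \<gamma> x powr (1 / s) \<le> 2 * P (of_int \<gamma> * (\<alpha> - \<rho>))" .
        have "scale_bound f \<gamma> x \<le> ((real j + 1) * c * (1 + \<bar>b x - bavg \<gamma>0 x0\<bar>)) * (2 * P (of_int \<gamma> * (\<alpha> - \<rho>)))"
          unfolding scale_bound_def by (rule mult_mono[OF w av]) (use c in auto)
        then have "scale_bound f \<gamma> x powr q \<le> (((real j + 1) * c * (1 + \<bar>b x - bavg \<gamma>0 x0\<bar>)) * (2 * P (of_int \<gamma> * (\<alpha> - \<rho>)))) powr q"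
          using q by (intro powr_mono2) auto
        also have "\<dots> = 2 powr q * H * ((real j + 1) * c) powr q * ?w x"
          using c by (simp add: powr_mult powr_powr H_def ac_simps)
        finally show ?thesis .
      qed
      have "F \<gamma> \<le> (\<integral>\<^sup>+x\<in>?S. ennreal (2 powr q * H * ((real j + 1) * c) powr q) * ennreal (?w x) \<partial>\<mu>)"
        unfolding F_def using pt
        by (intro nn_integral_mono) (auto simp: indicator_def ennreal_mult'[symmetric] H_def intro!: ennreal_leI)
      also have "\<dots> = ennreal (P (real n * of_int \<gamma>0)) * (ennreal (2 powr q * H * ((real j + 1) * c) powr q) * nnavg \<gamma>0 (\<lambda>x. ennreal (?w x)) x0)"
        unfolding nn_integral_pball using x0 by (simp add: nnavg_cmult)
      also have "\<dots> \<le> ennreal (P (real n * of_int \<gamma>0)) * (ennreal (2 powr q * H * ((real j + 1) * c) powr q) * ennreal C1)"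
        by (intro mult_left_mono C1 x0) auto
      also have "\<dots> = ennreal (2 powr q * C1 * (P (real n * of_int \<gamma>0) * H) * ((real j + 1) * c) powr q)"
        using C1(1) by (simp add: ennreal_mult'[symmetric] H_def ac_simps)
      also have "P (real n * of_int \<gamma>0) * H = P (of_int \<gamma>0 * lam) * z ^ j"
      proof -
        have "(\<alpha> - \<rho>) * q = lam - real n" using q_alt(3) by (simp add: algebra_simps)
        then have "H = P (of_int \<gamma> * (lam - real n))" by (simp add: H_def mult.assoc)
        then show ?thesis
          by (simp add: z_def powr_power powr_add[symmetric] \<gamma>_def algebra_simps)
      qed
      also have "ennreal (2 powr q * C1 * (P (of_int \<gamma>0 * lam) * z ^ j) * ((real j + 1) * c) powr q)
        = ennreal (2 powr q * C1 * P (of_int \<gamma>0 * lam)) * ennreal (((real j + 1) * c) powr q * z ^ j)"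
        using z by (simp add: ennreal_mult'[symmetric] ac_simps)
      finally show ?thesis by (simp add: \<gamma>_def)
    qed
    have "(\<integral>\<^sup>+x\<in>?S. (\<integral>\<^sup>+\<gamma>. ennreal (scale_bound f \<gamma> x powr q) \<partial>count_space UNIV) \<partial>\<mu>)
      = (\<integral>\<^sup>+x. (\<integral>\<^sup>+\<gamma>. ennreal (scale_bound f \<gamma> x powr q) * indicator ?S x \<partial>count_space UNIV) \<partial>\<mu>)"
      by (simp add: nn_integral_multc)
    also have "\<dots> = (\<integral>\<^sup>+\<gamma>. F \<gamma> \<partial>count_space UNIV)"
      unfolding F_def by (rule nn_integral_count_space_nn_integral) auto
    \<comment> \<open>The level \<gamma>0 is counted twice, which an upper bound can afford.\<close>
    also have "\<dots> \<le> (\<integral>\<^sup>+\<gamma>. F \<gamma> * indicator {..\<gamma>0} \<gamma> + F \<gamma> * indicator {\<gamma>0..} \<gamma> \<partial>count_space UNIV)"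
      by (intro nn_integral_mono) (auto simp: indicator_def)
    also have "\<dots> = (\<integral>\<^sup>+\<gamma>. F \<gamma> \<partial>count_space {..\<gamma>0}) + (\<integral>\<^sup>+\<gamma>. F \<gamma> \<partial>count_space {\<gamma>0..})"
      by (subst (1 2) nn_integral_count_space_indicator) (auto simp: nn_integral_add)
    also have "(\<integral>\<^sup>+\<gamma>. F \<gamma> \<partial>count_space {\<gamma>0..}) = (\<integral>\<^sup>+j. F (\<gamma>0 + int j) \<partial>count_space UNIV)"
    proof (rule nn_integral_bij_count_space[symmetric])
      show "bij_betw (\<lambda>j. \<gamma>0 + int j) UNIV {\<gamma>0..}"
        by (rule bij_betwI[where g = "\<lambda>\<gamma>. nat (\<gamma> - \<gamma>0)"]) auto
    qed
    also have "\<dots> = (\<Sum>j. F (\<gamma>0 + int j))" by (rule nn_integral_count_space_nat)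
    also have "\<dots> \<le> (\<Sum>j. ennreal (2 powr q * C1 * P (of_int \<gamma>0 * lam)) * ennreal (((real j + 1) * c) powr q * z ^ j))"
      by (intro suminf_le large) auto
    also have "\<dots> = ennreal (2 powr q * C1 * P (of_int \<gamma>0 * lam)) * (\<Sum>j. ennreal (((real j + 1) * c) powr q * z ^ j))"
      by (rule ennreal_suminf_cmult)
    also have "(\<Sum>j. ennreal (((real j + 1) * c) powr q * z ^ j)) = ennreal C3"
      unfolding C3_def using sm z by (intro suminf_ennreal2) auto
    also have "(\<integral>\<^sup>+\<gamma>. F \<gamma> \<partial>count_space {..\<gamma>0}) \<le>
        (\<integral>\<^sup>+\<gamma>. ennreal C1 * (\<integral>\<^sup>+x\<in>?S. ennreal (P (of_int \<gamma> * \<alpha> * q) * avs f \<gamma> x powr (q / s)) \<partial>\<mu>) \<partial>count_space {..\<gamma>0})"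
      by (intro nn_integral_mono small) auto
    also have "\<dots> \<le> ennreal C1 * ennreal (C2 * P (of_int \<gamma>0 * lam))"
      by (subst nn_integral_cmult) (auto intro!: mult_left_mono C2(2) f x0)
    finally have "(\<integral>\<^sup>+x\<in>?S. (\<integral>\<^sup>+\<gamma>. ennreal (scale_bound f \<gamma> x powr q) \<partial>count_space UNIV) \<partial>\<mu>)
      \<le> ennreal C1 * ennreal (C2 * P (of_int \<gamma>0 * lam)) + ennreal (2 powr q * C1 * P (of_int \<gamma>0 * lam)) * ennreal C3"
      by (simp add: add_right_mono)
    also have "\<dots> = ennreal ((C1 * C2 + 2 powr q * C1 * C3) * P (of_int \<gamma>0 * lam))"
      using C1(1) C2(1) C3
      by (simp add: ennreal_mult'[symmetric] ennreal_plus[symmetric] algebra_simps del: ennreal_plus)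
    finally show "(\<integral>\<^sup>+x\<in>?S. (\<integral>\<^sup>+\<gamma>. ennreal (scale_bound f \<gamma> x powr q) \<partial>count_space UNIV) \<partial>\<mu>)
      \<le> ennreal ((C1 * C2 + 2 powr q * C1 * C3) * P (of_int \<gamma>0 * lam))" .
  qed
qed

end

context padic begin

subsection \<open>The fractional maximal operator\<close>

lemma frac_max_eq:
  assumes "x \<in> X"
  shows "frac_max p n \<alpha> f x = (SUP \<gamma>. ennreal (P (of_int \<gamma> * \<alpha>)) * nnavg \<gamma> (\<lambda>y. ennreal \<bar>f y\<bar>) x)"
proof -
  have "ennreal (measure \<mu> (B \<gamma> x) powr (\<alpha> / real n - 1)) =
      ennreal (P (of_int \<gamma> * \<alpha>)) * ennreal (P (- (real n * of_int \<gamma>)))" for \<gamma>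
  proof -
    have "real n * of_int \<gamma> * (\<alpha> / real n - 1) = real_of_int \<gamma> * \<alpha> + - (real n * of_int \<gamma>)"
      using n_ge_1 by (simp add: field_simps)
    then show ?thesis
      using assms by (simp only: measure_pball powr_powr powr_add ennreal_mult' P_pos)
  qed
  then show ?thesis unfolding frac_max_def nnavg_def by (simp add: mult.assoc)
qed

text \<open>Each term depends on the point only through its ball, hence is measurable whatever
  \<open>f\<close> is; the supremum runs over countably many levels.\<close>

lemma frac_max_measurable [measurable]: "frac_max p n \<alpha> f \<in> borel_measurable \<mu>"
proof -
  have [measurable]: "(\<lambda>x. ennreal (measure \<mu> (B \<gamma> x) powr (\<alpha> / real n - 1)) *
      (\<integral>\<^sup>+ y\<in>B \<gamma> x. ennreal \<bar>f y\<bar> \<partial>\<mu>)) \<in> borel_measurable \<mu>" for \<gamma>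
    using level_const_ball[of \<gamma> "\<lambda>S. ennreal (measure \<mu> S powr (\<alpha> / real n - 1)) * (\<integral>\<^sup>+ y\<in>S. ennreal \<bar>f y\<bar> \<partial>\<mu>)"]
    by (rule level_const_borel_measurable)
  show ?thesis unfolding frac_max_def[abs_def] by (intro borel_measurable_SUP) auto
qed

lemma frac_max_comm_measurable:
  assumes [measurable]: "b \<in> borel_measurable \<mu>"
  shows "frac_max_comm p n \<alpha> b f \<in> borel_measurable \<mu>"
  unfolding frac_max_comm_def[abs_def] by measurable

lemma frac_max_cmult:
  assumes x: "x \<in> X" and [measurable]: "f \<in> borel_measurable \<mu>"
  shows "frac_max p n \<alpha> (\<lambda>y. k * f y) x = ennreal \<bar>k\<bar> * frac_max p n \<alpha> f x"
  unfolding frac_max_eq[OF x]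
  by (simp add: SUP_mult_left_ennreal abs_mult ennreal_mult' nnavg_cmult[OF x] mult.left_commute)

lemma frac_max_le_add:
  assumes x: "x \<in> X"
    and [measurable]: "f \<in> borel_measurable \<mu>" "g \<in> borel_measurable \<mu>" "h \<in> borel_measurable \<mu>"
    and le: "\<And>y. \<bar>f y\<bar> \<le> \<bar>g y\<bar> + \<bar>h y\<bar>"
  shows "frac_max p n \<alpha> f x \<le> frac_max p n \<alpha> g x + frac_max p n \<alpha> h x"
  unfolding frac_max_eq[OF x]
proof (rule SUP_least)
  fix \<gamma> :: int
  let ?c = "ennreal (P (of_int \<gamma> * \<alpha>))"
  have "nnavg \<gamma> (\<lambda>y. ennreal \<bar>f y\<bar>) x \<le> nnavg \<gamma> (\<lambda>y. ennreal \<bar>g y\<bar> + ennreal \<bar>h y\<bar>) x"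
    using le by (intro nnavg_mono[OF x]) (simp add: ennreal_plus[symmetric] ennreal_leI del: ennreal_plus)
  also have "\<dots> = nnavg \<gamma> (\<lambda>y. ennreal \<bar>g y\<bar>) x + nnavg \<gamma> (\<lambda>y. ennreal \<bar>h y\<bar>) x"
    using x by (intro nnavg_add) auto
  finally have "?c * nnavg \<gamma> (\<lambda>y. ennreal \<bar>f y\<bar>) x \<le>
      ?c * nnavg \<gamma> (\<lambda>y. ennreal \<bar>g y\<bar>) x + ?c * nnavg \<gamma> (\<lambda>y. ennreal \<bar>h y\<bar>) x"
    unfolding distrib_left[symmetric] by (rule mult_left_mono) auto
  also have "\<dots> \<le> (SUP \<gamma>. ennreal (P (of_int \<gamma> * \<alpha>)) * nnavg \<gamma> (\<lambda>y. ennreal \<bar>g y\<bar>) x) +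
      (SUP \<gamma>. ennreal (P (of_int \<gamma> * \<alpha>)) * nnavg \<gamma> (\<lambda>y. ennreal \<bar>h y\<bar>) x)"
    by (intro add_mono SUP_upper) auto
  finally show "?c * nnavg \<gamma> (\<lambda>y. ennreal \<bar>f y\<bar>) x \<le> \<dots>" .
qed

text \<open>\<open>M(b f)\<close> only sees \<open>\<bar>b\<bar>\<close>, so \<open>[\<bar>b\<bar>, M]\<close> is controlled by the maximal commutator, and it
  differs from \<open>[b, M]\<close> by \<open>(\<bar>b\<bar> - b) M f = 2 b\<^sup>- M f\<close>.\<close>
lemma abs_frac_max_comm_le:
  assumes x: "x \<in> X" and [measurable]: "b \<in> borel_measurable \<mu>" "f \<in> borel_measurable \<mu>"
    and m: "frac_max p n \<alpha> f x \<le> ennreal m" and \<nu>: "frac_max p n \<alpha> (\<lambda>y. (b x - b y) * f y) x \<le> ennreal \<nu>"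
    and nn: "0 \<le> m" "0 \<le> \<nu>" and \<beta>: "- min (b x) 0 \<le> \<beta>"
  shows "frac_max p n \<alpha> (\<lambda>y. b y * f y) x < \<infinity>"
    and "\<bar>frac_max_comm p n \<alpha> b f x\<bar> \<le> \<nu> + 2 * \<beta> * m"
proof -
  let ?M = "frac_max p n \<alpha> f x" and ?M' = "frac_max p n \<alpha> (\<lambda>y. b y * f y) x"
  let ?N = "frac_max p n \<alpha> (\<lambda>y. (b x - b y) * f y) x"
  have tri: "\<bar>b y * f y\<bar> \<le> \<bar>(b x - b y) * f y\<bar> + \<bar>b x * f y\<bar>" 
     "\<bar>b x * f y\<bar> \<le> \<bar>(b x - b y) * f y\<bar> + \<bar>b y * f y\<bar>" for y
    by (auto simp: algebra_simps)
  have 1: "?M' \<le> ?N + ennreal \<bar>b x\<bar> * ?M"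
    using frac_max_le_add[OF x, of "\<lambda>y. b y * f y" "\<lambda>y. (b x - b y) * f y" "\<lambda>y. b x * f y" \<alpha>, OF _ _ _ tri(1)]
    by (simp add: frac_max_cmult[OF x])
  have 2: "ennreal \<bar>b x\<bar> * ?M \<le> ?N + ?M'"
    using frac_max_le_add[OF x, of "\<lambda>y. b x * f y" "\<lambda>y. (b x - b y) * f y" "\<lambda>y. b y * f y" \<alpha>, OF _ _ _ tri(2)]
    by (simp add: frac_max_cmult[OF x])
  have "?M < top" "?N < top" using m \<nu> by (auto intro: order_le_less_trans)
  moreover from this show "?M' < \<infinity>"
    using 1 by (auto intro!: order_le_less_trans[OF 1] simp: ennreal_mult_less_top)
  ultimately obtain M M' N where eq: "?M = ennreal M" "?M' = ennreal M'" "?N = ennreal N" "0 \<le> M" "0 \<le> M'" "0 \<le> N"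
    by (intro that[of "enn2real ?M" "enn2real ?M'" "enn2real ?N"]) auto
  have "M' \<le> N + \<bar>b x\<bar> * M" "\<bar>b x\<bar> * M \<le> N + M'"
    using 1 2 eq by (simp_all add: ennreal_mult'[symmetric] ennreal_plus[symmetric] ennreal_le_iff del: ennreal_plus)
  moreover have "M \<le> m" "N \<le> \<nu>" using m \<nu> eq nn by (auto simp: ennreal_le_iff)
  moreover have "\<bar>b x\<bar> * M = b x * M + 2 * (- min (b x) 0) * M" by (auto simp: min_def)
  moreover have "(- min (b x) 0) * M \<le> \<beta> * m" "0 \<le> (- min (b x) 0) * M"
  proof -
    have "0 \<le> - min (b x) 0" by simp
    then show "0 \<le> (- min (b x) 0) * M" "(- min (b x) 0) * M \<le> \<beta> * m"
      using mult_mono[OF \<beta> \<open>M \<le> m\<close>] \<beta> eq(4) by (auto simp only: mult_nonneg_nonneg)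
  qed
  ultimately have "\<bar>b x * M - M'\<bar> \<le> \<nu> + 2 * \<beta> * m" by linarith
  then show "\<bar>frac_max_comm p n \<alpha> b f x\<bar> \<le> \<nu> + 2 * \<beta> * m"
    using eq by (simp add: frac_max_comm_def)
qed

subsection \<open>Morrey bounds\<close>

text \<open>Morrey bound with root and weight cleared. It includes finiteness, which a bound on
  \<open>morrey_norm\<close> alone does not, since \<open>enn2real\<close> sends infinity to
  0.\<close>

definition morrey_le :: "real \<Rightarrow> real \<Rightarrow> ((nat \<Rightarrow> int \<Rightarrow> nat) \<Rightarrow> real) \<Rightarrow> real \<Rightarrow> bool" where
  "morrey_le q lam f K \<longleftrightarrow> (\<forall>\<gamma>. \<forall>x\<in>X. (\<integral>\<^sup>+y\<in>B \<gamma> x. ennreal (\<bar>f y\<bar> powr q) \<partial>\<mu>) \<le> ennreal (K powr q * P (of_int \<gamma> * lam)))"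

lemma morrey_sup_le_iff:
  "morrey_sup p n q lam f \<le> ennreal (K powr q) \<longleftrightarrow> morrey_le q lam f K"
proof -
  have "ennreal (measure \<mu> (B \<gamma> x) powr (- lam / real n)) * I \<le> ennreal (K powr q)
     \<longleftrightarrow> I \<le> ennreal (K powr q * P (of_int \<gamma> * lam))" if x: "x \<in> X" for \<gamma> x I
  proof -
    have e: "measure \<mu> (B \<gamma> x) powr (- lam / real n) = P (- (real_of_int \<gamma> * lam))"
      using x n_ge_1 by (simp add: measure_pball powr_powr)
    show ?thesis unfolding e
    proof
      assume "ennreal (P (- (real_of_int \<gamma> * lam))) * I \<le> ennreal (K powr q)"
      then have "ennreal (P (of_int \<gamma> * lam)) * (ennreal (P (- (real_of_int \<gamma> * lam))) * I) \<le> ennreal (P (of_int \<gamma> * lam)) * ennreal (K powr q)"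
        by (rule mult_left_mono) auto
      then show "I \<le> ennreal (K powr q * P (of_int \<gamma> * lam))"
        unfolding mult.assoc[symmetric] by (simp add: ennreal_mult'[symmetric] mult.commute)
    next
      assume "I \<le> ennreal (K powr q * P (of_int \<gamma> * lam))"
      then have "ennreal (P (- (real_of_int \<gamma> * lam))) * I \<le> ennreal (P (- (real_of_int \<gamma> * lam))) * ennreal (K powr q * P (of_int \<gamma> * lam))"
        by (rule mult_left_mono) auto
      also have "\<dots> = ennreal (P (- (real_of_int \<gamma> * lam))) * ennreal (P (of_int \<gamma> * lam)) * ennreal (K powr q)"
        by (simp add: ennreal_mult' ac_simps)
      finally show "ennreal (P (- (real_of_int \<gamma> * lam))) * I \<le> ennreal (K powr q)" by simp
    qed
  qed
  then show ?thesis unfolding morrey_sup_def morrey_le_def by (auto simp: SUP_le_iff)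
qed

lemma morrey_norm_le:
  assumes "morrey_le q lam f K" "0 \<le> K" "0 < q"
  shows "morrey_sup p n q lam f < \<infinity>" "morrey_norm p n q lam f \<le> K"
proof -
  have le: "morrey_sup p n q lam f \<le> ennreal (K powr q)" using assms by (simp add: morrey_sup_le_iff)
  then show "morrey_sup p n q lam f < \<infinity>" by (auto intro: order_le_less_trans)
  have "enn2real (morrey_sup p n q lam f) \<le> K powr q" by (rule enn2real_leI[OF _ le]) simp
  then have "morrey_norm p n q lam f \<le> (K powr q) powr (1 / q)"
    unfolding morrey_norm_def using assms by (intro powr_mono2) auto
  then show "morrey_norm p n q lam f \<le> K" using assms by (simp add: powr_powr)
qed

lemma morrey_leI:
  assumes "morrey_sup p n q lam f < \<infinity>" "morrey_norm p n q lam f \<le> K" "0 < q"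
  shows "morrey_le q lam f K"
proof -
  have "enn2real (morrey_sup p n q lam f) = morrey_norm p n q lam f powr q"
    using assms(3) by (simp add: morrey_norm_def powr_powr)
  also have "\<dots> \<le> K powr q"
    using assms by (intro powr_mono2) (auto simp: morrey_norm_def)
  finally have "ennreal (enn2real (morrey_sup p n q lam f)) \<le> ennreal (K powr q)" by (rule ennreal_leI)
  moreover have "ennreal (enn2real (morrey_sup p n q lam f)) = morrey_sup p n q lam f"
    using assms(1) by (intro ennreal_enn2real) simp
  ultimately show ?thesis by (simp only: morrey_sup_le_iff)
qed

text \<open>Hoelder on each ball, by interpolation at t = K p^(-\<gamma> e). The common scaling
  exponent \<open>e\<close> makes both terms equal, and q2 >= 1 allows the resulting factor 2 to be
  written as at most 2^q2.\<close>

lemma morrey_le_embed: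
  assumes [measurable]: "g \<in> borel_measurable \<mu>" and K: "0 < K" and g: "morrey_le q1 lam g K"
    and q: "1 \<le> q2" "q2 \<le> q1" and eq: "(real n - mu) / q2 = (real n - lam) / q1"
  shows "morrey_le q2 mu g (2 * K)"
  unfolding morrey_le_def
proof (intro allI ballI)
  fix \<gamma> x assume x: "x \<in> X"
  have [measurable]: "B \<gamma> x \<in> sets \<mu>" using x by simp
  define e where "e = (real n - lam) / q1"
  have e: "e * q1 = real n - lam" "e * q2 = real n - mu" using q eq by (auto simp: e_def field_simps)
  define t where "t = K * P (- (real_of_int \<gamma> * e))"
  have t: "0 < t" using K by (simp add: t_def)
  have "(\<integral>\<^sup>+y\<in>B \<gamma> x. ennreal (\<bar>g y\<bar> powr q2) \<partial>\<mu>) \<le>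
    (\<integral>\<^sup>+y. ennreal (t powr q2) * indicator (B \<gamma> x) y + ennreal (t powr (q2 - q1)) * (ennreal (\<bar>g y\<bar> powr q1) * indicator (B \<gamma> x) y) \<partial>\<mu>)"
  proof (rule nn_integral_mono)
    fix y
    show "ennreal (\<bar>g y\<bar> powr q2) * indicator (B \<gamma> x) y \<le>
      ennreal (t powr q2) * indicator (B \<gamma> x) y + ennreal (t powr (q2 - q1)) * (ennreal (\<bar>g y\<bar> powr q1) * indicator (B \<gamma> x) y)"
      using powr_le_interpolate[of "\<bar>g y\<bar>" t q2 q1] t q
      by (auto simp: indicator_def ennreal_mult'[symmetric] ennreal_plus[symmetric] ennreal_leI simp del: ennreal_plus)
  qed
  also have "\<dots> = ennreal (t powr q2) * ennreal (P (real n * of_int \<gamma>)) +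
      ennreal (t powr (q2 - q1)) * (\<integral>\<^sup>+y\<in>B \<gamma> x. ennreal (\<bar>g y\<bar> powr q1) \<partial>\<mu>)"
    by (subst nn_integral_add) (auto simp: nn_integral_cmult nn_integral_cmult_indicator emeasure_pball x)
  also have "\<dots> \<le> ennreal (t powr q2) * ennreal (P (real n * of_int \<gamma>)) +
      ennreal (t powr (q2 - q1)) * ennreal (K powr q1 * P (of_int \<gamma> * lam))"
    using g x by (intro add_left_mono mult_left_mono) (auto simp: morrey_le_def)
  also have "\<dots> = ennreal (t powr q2 * P (real n * of_int \<gamma>) + t powr (q2 - q1) * (K powr q1 * P (of_int \<gamma> * lam)))"
    using K by (simp add: ennreal_mult'[symmetric] ennreal_plus[symmetric] del: ennreal_plus)
  also have "t powr q2 * P (real n * of_int \<gamma>) = K powr q2 * P (of_int \<gamma> * mu)"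
  proof -
    have "P (- (real_of_int \<gamma> * e)) powr q2 * P (real n * of_int \<gamma>) = P (- (real_of_int \<gamma> * (e * q2)) + real n * of_int \<gamma>)"
      by (simp only: powr_powr powr_add) (simp add: mult.assoc)
    then show ?thesis using K unfolding e t_def by (simp add: powr_mult algebra_simps)
  qed
  also have "t powr (q2 - q1) * (K powr q1 * P (of_int \<gamma> * lam)) = K powr q2 * P (of_int \<gamma> * mu)"
  proof -
    have "P (- (real_of_int \<gamma> * e)) powr (q2 - q1) * P (of_int \<gamma> * lam)
        = P (- (real_of_int \<gamma> * (e * q2)) + real_of_int \<gamma> * (e * q1) + real_of_int \<gamma> * lam)"
      by (simp only: powr_powr powr_add[symmetric]) (simp add: algebra_simps)
    moreover have "K powr (q2 - q1) * K powr q1 = K powr q2" by (simp add: powr_add[symmetric])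
    moreover have "t powr (q2 - q1) = K powr (q2 - q1) * P (- (real_of_int \<gamma> * e)) powr (q2 - q1)"
      using K by (simp add: t_def powr_mult)
    moreover have "P (- (real_of_int \<gamma> * (e * q2)) + real_of_int \<gamma> * (e * q1) + real_of_int \<gamma> * lam) = P (of_int \<gamma> * mu)"
      unfolding e by (simp add: algebra_simps)
    ultimately show ?thesis by (metis mult.assoc mult.left_commute)
  qed
  also have "K powr q2 * P (of_int \<gamma> * mu) + K powr q2 * P (of_int \<gamma> * mu) \<le> (2 * K) powr q2 * P (of_int \<gamma> * mu)"
  proof -
    have "2 powr 1 \<le> (2::real) powr q2" using q by (intro powr_mono) auto
    then have "2 * (K powr q2 * P (of_int \<gamma> * mu)) \<le> 2 powr q2 * (K powr q2 * P (of_int \<gamma> * mu))"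
      by (intro mult_right_mono) auto
    then show ?thesis using K by (simp add: powr_mult)
  qed
  finally show "(\<integral>\<^sup>+y\<in>B \<gamma> x. ennreal (\<bar>g y\<bar> powr q2) \<partial>\<mu>) \<le> ennreal ((2 * K) powr q2 * P (of_int \<gamma> * mu))"
    by (simp add: ennreal_leI)
qed

text \<open>Phrased with a bound K > 0 in place of the norm of \<open>f\<close>, so that a proof may
  divide \<open>f\<close> by \<open>K\<close>.\<close>

definition comm_estimate :: "real \<Rightarrow> ((nat \<Rightarrow> int \<Rightarrow> nat) \<Rightarrow> real) \<Rightarrow> real \<Rightarrow> real \<Rightarrow> real \<Rightarrow> real \<Rightarrow> real \<Rightarrow> bool" where
  "comm_estimate \<alpha> b r lam q mu C \<longleftrightarrow>
    (\<forall>f K. f \<in> borel_measurable \<mu> \<and> 0 < K \<and> morrey_le r lam f K \<longrightarrow>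
      (AE x in \<mu>. frac_max p n \<alpha> f x < \<infinity> \<and> frac_max p n \<alpha> (\<lambda>y. b y * f y) x < \<infinity>) \<and>
      morrey_le q mu (frac_max_comm p n \<alpha> b f) (C * K))"

text \<open>The norm of \<open>f\<close> may be 0 although the estimate asks for K > 0. It is
  applied to K = norm + e / C, where the excess contributes just e, and e is arbitrary.\<close>

lemma comm_bounded_of_estimate:
  assumes [measurable]: "b \<in> borel_measurable \<mu>" and C: "0 < C" and r: "0 < r" and q: "0 < q"
    and est: "comm_estimate \<alpha> b r lam q mu C"
  shows "comm_bounded p n \<alpha> b r lam q mu"
  unfolding comm_bounded_def
proof (intro exI[of _ C] allI impI)
  fix f assume "in_morrey p n r lam f"
  then have f: "f \<in> borel_measurable \<mu>" "morrey_sup p n r lam f < \<infinity>" by (auto simp: in_morrey_def)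
  let ?N = "morrey_norm p n r lam f" and ?g = "frac_max_comm p n \<alpha> b f"
  have N: "0 \<le> ?N" by (simp add: morrey_norm_def)
  have *: "(AE x in \<mu>. frac_max p n \<alpha> f x < \<infinity> \<and> frac_max p n \<alpha> (\<lambda>y. b y * f y) x < \<infinity>) \<and>
      morrey_le q mu ?g (C * K)" if "?N < K" for K
    using est[unfolded comm_estimate_def, rule_format, of f K] f morrey_leI[OF f(2) _ r, of K] that N
    by (meson le_less_trans less_imp_le)
  have K1: "?N < ?N + 1" by simp
  have "morrey_norm p n q mu ?g \<le> C * ?N"
  proof (rule field_le_epsilon)
    fix e :: real assume "0 < e"
    then have "morrey_le q mu ?g (C * (?N + e / C))" using * C by auto
    then have "morrey_norm p n q mu ?g \<le> C * (?N + e / C)"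
      using morrey_norm_le(2)[OF _ _ q] C N \<open>0 < e\<close> by auto
    then show "morrey_norm p n q mu ?g \<le> C * ?N + e" using C by (simp add: distrib_left)
  qed
  moreover have "in_morrey p n q mu ?g"
    using morrey_norm_le(1)[OF _ _ q, of mu ?g "C * (?N + 1)"] *[OF K1] C N frac_max_comm_measurable
    by (simp add: in_morrey_def)
  ultimately show "(AE x in \<mu>. frac_max p n \<alpha> f x < \<infinity> \<and> frac_max p n \<alpha> (\<lambda>y. b y * f y) x < \<infinity>) \<and>
        in_morrey p n q mu ?g \<and> morrey_norm p n q mu ?g \<le> C * ?N"
    using *[OF K1] by blast
qed

end

section \<open>The commutator estimate for the first target space\<close>

context padic_morrey_bmo begin

text \<open>The sum \<open>T\<close> of the q-th powers of the scale bounds dominates each of them,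
  so \<open>\<sigma>\<close> = T^(1/q) bounds both maximal operators, and hence the commutator, at
  almost every point. The integral of \<open>T\<close> over a ball is bounded by
  \<open>sum_scale_bounds\<close>.\<close>

lemma comm_estimate:
  assumes \<beta>: "0 \<le> \<beta>" "AE x in \<mu>. - min (b x) 0 \<le> \<beta>"
  obtains C where "0 < C" "comm_estimate \<alpha> b r lam q lam C"
proof -
  have q: "0 < q" using q_alt(1) s_bounds by linarith
  have s': "0 < s / (s - 1)" using s_bounds by simp
  obtain C0 where C0: "0 \<le> C0"
    "\<And>\<gamma> x. x \<in> X \<Longrightarrow> nnavg \<gamma> (\<lambda>y. ennreal (\<bar>b y - pavg p n b (B \<gamma> x)\<bar> powr (s / (s - 1)))) x \<le> ennreal C0"
    using bmo_moments[OF b_loc _ bmo s'] D by auto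
  obtain C1 where C1: "0 \<le> C1"
    "\<And>f \<gamma>0 x0. unit_morrey f \<Longrightarrow> x0 \<in> X \<Longrightarrow>
      (\<integral>\<^sup>+x\<in>B \<gamma>0 x0. (\<integral>\<^sup>+\<gamma>. ennreal (scale_bound f \<gamma> x powr q) \<partial>count_space UNIV) \<partial>\<mu>)
        \<le> ennreal (C1 * P (of_int \<gamma>0 * lam))"
    using sum_scale_bounds by blast
  \<comment> \<open>The plain average costs a factor 2, the one with b minus its average C0 + 1;
    this \<open>c\<close> gives 2 w + (C0 + 1) <= c (1 + w).\<close>
  define c where "c = C0 + 2"
  have c: "2 \<le> c" using C0 by (simp add: c_def)
  have M_le: "frac_max p n \<alpha> f x \<le> ennreal (c * \<sigma>)" "frac_max p n \<alpha> (\<lambda>y. (b x - b y) * f y) x \<le> ennreal (c * \<sigma>)"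
    if f: "unit_morrey f" and x: "x \<in> X" and \<sigma>: "\<And>\<gamma>. scale_bound f \<gamma> x \<le> \<sigma>" for f x \<sigma>
  proof -
    note [measurable] = unit_morrey_measurable[OF f]
    have 1: "nnavg \<gamma> (\<lambda>y. ennreal \<bar>f y\<bar>) x \<le> ennreal (2 * avs f \<gamma> x powr (1 / s))" for \<gamma>
      using nnavg_mult_le[OF f x, of "\<lambda>_. 1" 1] x by simp
    have 2: "nnavg \<gamma> (\<lambda>y. ennreal (\<bar>b y - bavg \<gamma> x\<bar> * \<bar>f y\<bar>)) x \<le> ennreal ((C0 + 1) * avs f \<gamma> x powr (1 / s))" for \<gamma>
      using C0 x by (intro nnavg_mult_le[OF f x]) (auto simp: bavg_def)
    have b1: "ennreal (P (of_int \<gamma> * \<alpha>)) * nnavg \<gamma> (\<lambda>y. ennreal \<bar>f y\<bar>) x \<le> ennreal (c * \<sigma>)" for \<gamma>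
    proof -
      define G where "G = P (of_int \<gamma> * \<alpha>) * avs f \<gamma> x powr (1 / s)"
      have "ennreal (P (of_int \<gamma> * \<alpha>)) * nnavg \<gamma> (\<lambda>y. ennreal \<bar>f y\<bar>) x \<le>
          ennreal (P (of_int \<gamma> * \<alpha>)) * ennreal (2 * avs f \<gamma> x powr (1 / s))"
        by (intro mult_left_mono 1) auto
      also have "\<dots> = ennreal (2 * G)" by (simp add: ennreal_mult'[symmetric] G_def ac_simps)
      also have "2 * G \<le> c * scale_bound f \<gamma> x"
      proof -
        have "1 * G \<le> scale_bound f \<gamma> x"
          unfolding scale_bound_def G_def by (intro mult_right_mono) auto
        then show ?thesis using c by (intro mult_mono) (auto simp: G_def)
      qed
      also have "c * scale_bound f \<gamma> x \<le> c * \<sigma>" using c \<sigma> by (intro mult_left_mono) auto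
      finally show ?thesis by (simp add: ennreal_leI)
    qed
    have b2: "ennreal (P (of_int \<gamma> * \<alpha>)) * nnavg \<gamma> (\<lambda>y. ennreal \<bar>(b x - b y) * f y\<bar>) x \<le> ennreal (c * \<sigma>)" for \<gamma>
    proof -
      define G where "G = P (of_int \<gamma> * \<alpha>) * avs f \<gamma> x powr (1 / s)"
      define w where "w = \<bar>b x - bavg \<gamma> x\<bar>"
      have "nnavg \<gamma> (\<lambda>y. ennreal \<bar>(b x - b y) * f y\<bar>) x \<le>
        nnavg \<gamma> (\<lambda>y. ennreal w * ennreal \<bar>f y\<bar> + ennreal (\<bar>b y - bavg \<gamma> x\<bar> * \<bar>f y\<bar>)) x"
      proof (rule nnavg_mono[OF x])
        fix y
        have "\<bar>b x - b y\<bar> * \<bar>f y\<bar> \<le> (w + \<bar>b y - bavg \<gamma> x\<bar>) * \<bar>f y\<bar>"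
          unfolding w_def by (intro mult_right_mono) auto
        then have "\<bar>(b x - b y) * f y\<bar> \<le> w * \<bar>f y\<bar> + \<bar>b y - bavg \<gamma> x\<bar> * \<bar>f y\<bar>"
          by (simp add: abs_mult distrib_right)
        then show "ennreal \<bar>(b x - b y) * f y\<bar> \<le> ennreal w * ennreal \<bar>f y\<bar> + ennreal (\<bar>b y - bavg \<gamma> x\<bar> * \<bar>f y\<bar>)"
          by (simp add: ennreal_mult'[symmetric] ennreal_plus[symmetric] w_def ennreal_leI del: ennreal_plus)
      qed
      also have "\<dots> = ennreal w * nnavg \<gamma> (\<lambda>y. ennreal \<bar>f y\<bar>) x + nnavg \<gamma> (\<lambda>y. ennreal (\<bar>b y - bavg \<gamma> x\<bar> * \<bar>f y\<bar>)) x"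
        using x by (simp add: nnavg_add nnavg_cmult)
      also have "\<dots> \<le> ennreal w * ennreal (2 * avs f \<gamma> x powr (1 / s)) + ennreal ((C0 + 1) * avs f \<gamma> x powr (1 / s))"
        by (intro add_mono mult_left_mono 1 2) auto
      finally have "ennreal (P (of_int \<gamma> * \<alpha>)) * nnavg \<gamma> (\<lambda>y. ennreal \<bar>(b x - b y) * f y\<bar>) x \<le>
          ennreal (P (of_int \<gamma> * \<alpha>)) * (ennreal w * ennreal (2 * avs f \<gamma> x powr (1 / s)) + ennreal ((C0 + 1) * avs f \<gamma> x powr (1 / s)))"
        by (intro mult_left_mono) auto
      also have "\<dots> = ennreal ((2 * w + (C0 + 1)) * G)"
        using C0 by (simp add: ennreal_mult'[symmetric] ennreal_plus[symmetric] G_def w_def algebra_simps del: ennreal_plus)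
      also have "(2 * w + (C0 + 1)) * G \<le> (c * (1 + w)) * G"
      proof (rule mult_right_mono)
        have "0 \<le> C0 * w" using C0 by (simp add: w_def)
        then show "2 * w + (C0 + 1) \<le> c * (1 + w)" by (simp add: c_def algebra_simps)
      qed (simp add: G_def)
      also have "\<dots> = c * scale_bound f \<gamma> x" by (simp add: scale_bound_def G_def w_def)
      also have "c * scale_bound f \<gamma> x \<le> c * \<sigma>" using c \<sigma> by (intro mult_left_mono) auto
      finally show ?thesis by (simp add: ennreal_leI)
    qed
    show "frac_max p n \<alpha> f x \<le> ennreal (c * \<sigma>)" "frac_max p n \<alpha> (\<lambda>y. (b x - b y) * f y) x \<le> ennreal (c * \<sigma>)"
      unfolding frac_max_eq[OF x] by (intro SUP_least b1 b2)+
  qed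
  \<comment> \<open>\<open>c\<close> from the maximal commutator plus 2 \<beta> c from the term with
    b^-.\<close>
  define E where "E = c * (1 + 2 * \<beta>)"
  have E: "0 < E" using c \<beta> by (simp add: E_def)
  have unit: "(AE x in \<mu>. frac_max p n \<alpha> f x < \<infinity> \<and> frac_max p n \<alpha> (\<lambda>y. b y * f y) x < \<infinity>) \<and>
      morrey_le q lam (frac_max_comm p n \<alpha> b f) (E * (C1 + 1) powr (1 / q))"
    if f: "unit_morrey f" for f
  proof -
    note [measurable] = unit_morrey_measurable[OF f]
    define T where "T x = (\<integral>\<^sup>+\<gamma>. ennreal (scale_bound f \<gamma> x powr q) \<partial>count_space UNIV)" for x
    have [measurable]: "T \<in> borel_measurable \<mu>"
    proof -
      \<comment> \<open>Enumerating the integers turns the integral over the counting measure into a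
        series of measurable functions.\<close>
      have "T = (\<lambda>x. \<Sum>j. ennreal (scale_bound f (int_decode j) x powr q))"
        unfolding T_def[abs_def] nn_integral_count_space_nat[symmetric]
        by (intro ext nn_integral_bij_count_space[symmetric] bij_int_decode)
      then show ?thesis by simp
    qed
    have T_fin: "AE x in \<mu>. T x < \<infinity>"
    proof -
      have "AE x in \<mu>. \<forall>z\<in>centre 0 ` X. x \<in> B 0 z \<longrightarrow> T x < \<infinity>"
      proof (subst AE_ball_countable[OF countable_centres], intro ballI)
        fix z assume "z \<in> centre 0 ` X"
        then have z: "z \<in> X" by auto
        have [measurable]: "B 0 z \<in> sets \<mu>" using z by simp
        have "(\<integral>\<^sup>+x. T x * indicator (B 0 z) x \<partial>\<mu>) \<noteq> \<infinity>"
          using C1(2)[OF f z, of 0] unfolding T_def[symmetric] by (auto simp: top_unique)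
        then have "AE x in \<mu>. T x * indicator (B 0 z) x \<noteq> \<infinity>"
          by (intro nn_integral_PInf_AE) auto
        then show "AE x in \<mu>. x \<in> B 0 z \<longrightarrow> T x < \<infinity>"
          by (rule AE_mp) (intro AE_I2, auto simp: less_top)
      qed
      then show ?thesis by (rule AE_mp) (intro AE_I2, auto simp: mem_pball_iff_centre)
    qed
    have pt: "frac_max p n \<alpha> f x < \<infinity> \<and> frac_max p n \<alpha> (\<lambda>y. b y * f y) x < \<infinity> \<and>
        ennreal (\<bar>frac_max_comm p n \<alpha> b f x\<bar> powr q) \<le> ennreal (E powr q) * T x"
      if x: "x \<in> X" and fin: "T x < \<infinity>" and bx: "- min (b x) 0 \<le> \<beta>" for x
    proof -
      define \<sigma> where "\<sigma> = enn2real (T x) powr (1 / q)"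
      have \<sigma>: "0 \<le> \<sigma>" "ennreal (\<sigma> powr q) = T x"
        using q fin by (auto simp: \<sigma>_def powr_powr)
      have "scale_bound f \<gamma> x \<le> \<sigma>" for \<gamma>
      proof -
        have "ennreal (scale_bound f \<gamma> x powr q) \<le> T x"
          unfolding T_def by (rule nn_integral_ge_point) simp
        then have "scale_bound f \<gamma> x powr q \<le> \<sigma> powr q"
          unfolding \<sigma>(2)[symmetric] by (simp add: ennreal_le_iff)
        then show ?thesis
          using powr_less_mono2[OF q \<sigma>(1), of "scale_bound f \<gamma> x"] by (meson not_le)
      qed
      note M = M_le[OF f x this]
      have c\<sigma>: "0 \<le> c * \<sigma>" using c \<sigma> by simp
      have fin': "frac_max p n \<alpha> f x < \<infinity>" using M(1) by (auto intro: order_le_less_trans)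
      note K = abs_frac_max_comm_le[OF x _ _ M c\<sigma> c\<sigma> bx]
      have "\<bar>frac_max_comm p n \<alpha> b f x\<bar> \<le> E * \<sigma>"
        using K(2) by (simp add: E_def algebra_simps)
      then have "\<bar>frac_max_comm p n \<alpha> b f x\<bar> powr q \<le> (E * \<sigma>) powr q"
        using q by (intro powr_mono2) auto
      also have "\<dots> = E powr q * \<sigma> powr q" using E \<sigma> by (simp add: powr_mult)
      finally have "ennreal (\<bar>frac_max_comm p n \<alpha> b f x\<bar> powr q) \<le> ennreal (E powr q) * T x"
        unfolding \<sigma>(2)[symmetric] by (simp add: ennreal_mult'[symmetric] ennreal_leI)
      then show ?thesis using fin' K(1) by simp
    qed
    have ae: "AE x in \<mu>. frac_max p n \<alpha> f x < \<infinity> \<and> frac_max p n \<alpha> (\<lambda>y. b y * f y) x < \<infinity> \<and>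
        ennreal (\<bar>frac_max_comm p n \<alpha> b f x\<bar> powr q) \<le> ennreal (E powr q) * T x"
      using T_fin \<beta>(2) AE_space[of \<mu>] by eventually_elim (use pt in auto)
    have "morrey_le q lam (frac_max_comm p n \<alpha> b f) (E * (C1 + 1) powr (1 / q))"
      unfolding morrey_le_def
    proof (intro allI ballI)
      fix \<gamma>0 x0 assume x0: "x0 \<in> X"
      have [measurable]: "B \<gamma>0 x0 \<in> sets \<mu>" using x0 by simp
      have "(\<integral>\<^sup>+y\<in>B \<gamma>0 x0. ennreal (\<bar>frac_max_comm p n \<alpha> b f y\<bar> powr q) \<partial>\<mu>) \<le>
        (\<integral>\<^sup>+y. ennreal (E powr q) * (T y * indicator (B \<gamma>0 x0) y) \<partial>\<mu>)"
        by (rule nn_integral_mono_AE) (use ae in eventually_elim, auto simp: indicator_def)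
      also have "\<dots> = ennreal (E powr q) * (\<integral>\<^sup>+y\<in>B \<gamma>0 x0. T y \<partial>\<mu>)"
        by (rule nn_integral_cmult) auto
      also have "\<dots> \<le> ennreal (E powr q) * ennreal (C1 * P (of_int \<gamma>0 * lam))"
        unfolding T_def by (intro mult_left_mono C1(2) f x0) auto
      also have "\<dots> = ennreal (E powr q * C1 * P (of_int \<gamma>0 * lam))"
        using C1(1) by (simp add: ennreal_mult'[symmetric] mult.assoc)
      \<comment> \<open>C1 may be 0; C1 + 1 keeps the final constant positive.\<close>
      also have "\<dots> \<le> ennreal ((E * (C1 + 1) powr (1 / q)) powr q * P (of_int \<gamma>0 * lam))"
      proof (intro ennreal_leI mult_right_mono)
        have "(E * (C1 + 1) powr (1 / q)) powr q = E powr q * (C1 + 1)"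
          using E q C1(1) by (simp add: powr_mult powr_powr)
        then show "E powr q * C1 \<le> (E * (C1 + 1) powr (1 / q)) powr q" by (simp add: distrib_left)
      qed simp
      finally show "(\<integral>\<^sup>+y\<in>B \<gamma>0 x0. ennreal (\<bar>frac_max_comm p n \<alpha> b f y\<bar> powr q) \<partial>\<mu>) \<le> \<dots>" .
    qed
    then show ?thesis using ae by auto
  qed
  show ?thesis
  proof (rule that)
    show "0 < E * (C1 + 1) powr (1 / q)" using E C1(1) by simp
    show "comm_estimate \<alpha> b r lam q lam (E * (C1 + 1) powr (1 / q))"
      unfolding comm_estimate_def
    proof (intro allI impI)
      fix f K assume "f \<in> borel_measurable \<mu> \<and> 0 < K \<and> morrey_le r lam f K"
      then have [measurable]: "f \<in> borel_measurable \<mu>" and K: "0 < K" and fK: "morrey_le r lam f K" by auto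
      \<comment> \<open>Normalisation to Morrey norm at most one; the maximal functions and the
        commutator are positively homogeneous in \<open>f\<close>.\<close>
      define g where "g y = f y / K" for y
      have [measurable]: "g \<in> borel_measurable \<mu>" unfolding g_def[abs_def] by measurable
      have fg: "f = (\<lambda>y. K * g y)" using K by (simp add: g_def)
      have g: "unit_morrey g"
        unfolding unit_morrey_def
      proof (intro conjI allI ballI)
        fix \<gamma> x assume x: "x \<in> X"
        have [measurable]: "B \<gamma> x \<in> sets \<mu>" using x by simp
        have "(\<integral>\<^sup>+y\<in>B \<gamma> x. ennreal (\<bar>g y\<bar> powr r) \<partial>\<mu>) = (\<integral>\<^sup>+y. ennreal (1 / K powr r) * (ennreal (\<bar>f y\<bar> powr r) * indicator (B \<gamma> x) y) \<partial>\<mu>)"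
          using K by (intro nn_integral_cong) (auto simp: g_def indicator_def powr_divide ennreal_mult'[symmetric])
        also have "\<dots> = ennreal (1 / K powr r) * (\<integral>\<^sup>+y\<in>B \<gamma> x. ennreal (\<bar>f y\<bar> powr r) \<partial>\<mu>)"
          by (rule nn_integral_cmult) auto
        also have "\<dots> \<le> ennreal (1 / K powr r) * ennreal (K powr r * P (of_int \<gamma> * lam))"
          using fK x by (intro mult_left_mono) (auto simp: morrey_le_def)
        also have "\<dots> = ennreal (P (of_int \<gamma> * lam))"
          using K by (simp add: ennreal_mult'[symmetric])
        finally show "(\<integral>\<^sup>+y\<in>B \<gamma> x. ennreal (\<bar>g y\<bar> powr r) \<partial>\<mu>) \<le> ennreal (P (of_int \<gamma> * lam))" .
      qed simp
      have Mf: "frac_max p n \<alpha> f x = ennreal K * frac_max p n \<alpha> g x"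
        "frac_max p n \<alpha> (\<lambda>y. b y * f y) x = ennreal K * frac_max p n \<alpha> (\<lambda>y. b y * g y) x" if x: "x \<in> X" for x
        using frac_max_cmult[OF x, of g \<alpha> K] frac_max_cmult[OF x, of "\<lambda>y. b y * g y" \<alpha> K] K
        by (simp_all add: fg mult.left_commute)
      have comm: "frac_max_comm p n \<alpha> b f x = K * frac_max_comm p n \<alpha> b g x" if x: "x \<in> X" for x
        using K unfolding frac_max_comm_def Mf[OF x] by (simp add: enn2real_mult algebra_simps)
      have "AE x in \<mu>. frac_max p n \<alpha> f x < \<infinity> \<and> frac_max p n \<alpha> (\<lambda>y. b y * f y) x < \<infinity>"
        using conjunct1[OF unit[OF g]] AE_space[of \<mu>]
        by eventually_elim (auto simp: Mf ennreal_mult_less_top)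
      moreover have "morrey_le q lam (frac_max_comm p n \<alpha> b f) (E * (C1 + 1) powr (1 / q) * K)"
        unfolding morrey_le_def
      proof (intro allI ballI)
        fix \<gamma> x assume x: "x \<in> X"
        have [measurable]: "B \<gamma> x \<in> sets \<mu>" "frac_max_comm p n \<alpha> b g \<in> borel_measurable \<mu>"
          using x by (auto intro: frac_max_comm_measurable)
        have "(\<integral>\<^sup>+y\<in>B \<gamma> x. ennreal (\<bar>frac_max_comm p n \<alpha> b f y\<bar> powr q) \<partial>\<mu>) =
          (\<integral>\<^sup>+y. ennreal (K powr q) * (ennreal (\<bar>frac_max_comm p n \<alpha> b g y\<bar> powr q) * indicator (B \<gamma> x) y) \<partial>\<mu>)"
          using K by (intro nn_integral_cong) (auto simp: comm abs_mult powr_mult ennreal_mult' indicator_def)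
        also have "\<dots> = ennreal (K powr q) * (\<integral>\<^sup>+y\<in>B \<gamma> x. ennreal (\<bar>frac_max_comm p n \<alpha> b g y\<bar> powr q) \<partial>\<mu>)"
          by (rule nn_integral_cmult) auto
        also have "\<dots> \<le> ennreal (K powr q) * ennreal ((E * (C1 + 1) powr (1 / q)) powr q * P (of_int \<gamma> * lam))"
          using conjunct2[OF unit[OF g]] x by (intro mult_left_mono) (auto simp: morrey_le_def)
        also have "\<dots> = ennreal ((E * (C1 + 1) powr (1 / q) * K) powr q * P (of_int \<gamma> * lam))"
          using K E C1(1) by (simp add: ennreal_mult'[symmetric] powr_mult ac_simps)
        finally show "(\<integral>\<^sup>+y\<in>B \<gamma> x. ennreal (\<bar>frac_max_comm p n \<alpha> b f y\<bar> powr q) \<partial>\<mu>) \<le> \<dots>" .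
      qed
      ultimately show "(AE x in \<mu>. frac_max p n \<alpha> f x < \<infinity> \<and> frac_max p n \<alpha> (\<lambda>y. b y * f y) x < \<infinity>) \<and>
          morrey_le q lam (frac_max_comm p n \<alpha> b f) (E * (C1 + 1) powr (1 / q) * K)" by blast
    qed
  qed
qed

end

context padic begin

subsection \<open>Necessity\<close>

text \<open>The intersection of two balls is no larger than the smaller one. Since 0 <= lam <= n,
  the exponent \<gamma>0 (n - lam) + \<gamma> lam is at least n times the smaller of \<gamma> and
  \<gamma>0.\<close>

lemma morrey_le_indicator_pball:
  assumes x0: "x0 \<in> X" and lam: "0 \<le> lam" "lam \<le> real n" and r: "0 < r"
  shows "morrey_le r lam (indicator (B \<gamma>0 x0)) (P (of_int \<gamma>0 * (real n - lam) / r))"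
  unfolding morrey_le_def
proof (intro allI ballI)
  fix \<gamma> x assume x: "x \<in> X"
  have [measurable]: "B \<gamma> x \<in> sets \<mu>" "B \<gamma>0 x0 \<in> sets \<mu>" using x x0 by auto
  have "(\<integral>\<^sup>+y\<in>B \<gamma> x. ennreal (\<bar>indicator (B \<gamma>0 x0) y\<bar> powr r) \<partial>\<mu>) = (\<integral>\<^sup>+y. indicator (B \<gamma> x \<inter> B \<gamma>0 x0) y \<partial>\<mu>)"
    by (intro nn_integral_cong) (auto simp: indicator_def)
  also have "\<dots> = emeasure \<mu> (B \<gamma> x \<inter> B \<gamma>0 x0)" by simp
  also have "\<dots> \<le> ennreal (P (of_int \<gamma>0 * (real n - lam) + real_of_int \<gamma> * lam))"
  proof (cases "\<gamma> \<le> \<gamma>0")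
    case True
    have "emeasure \<mu> (B \<gamma> x \<inter> B \<gamma>0 x0) \<le> emeasure \<mu> (B \<gamma> x)" by (rule emeasure_mono) auto
    also have "\<dots> = ennreal (P (real n * of_int \<gamma>))" using x by (rule emeasure_pball)
    also have "\<dots> \<le> ennreal (P (of_int \<gamma>0 * (real n - lam) + real_of_int \<gamma> * lam))"
      using mult_right_mono[of "real_of_int \<gamma>" "real_of_int \<gamma>0" "real n - lam"] True lam
      by (intro ennreal_leI) (simp add: algebra_simps)
    finally show ?thesis .
  next
    case False
    have "emeasure \<mu> (B \<gamma> x \<inter> B \<gamma>0 x0) \<le> emeasure \<mu> (B \<gamma>0 x0)" by (rule emeasure_mono) auto
    also have "\<dots> = ennreal (P (real n * of_int \<gamma>0))" using x0 by (rule emeasure_pball)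
    also have "\<dots> \<le> ennreal (P (of_int \<gamma>0 * (real n - lam) + real_of_int \<gamma> * lam))"
      using mult_right_mono[of "real_of_int \<gamma>0" "real_of_int \<gamma>" lam] False lam
      by (intro ennreal_leI) (simp add: algebra_simps)
    finally show ?thesis .
  qed
  also have "P (of_int \<gamma>0 * (real n - lam) + real_of_int \<gamma> * lam) =
      P (of_int \<gamma>0 * (real n - lam) / r) powr r * P (of_int \<gamma> * lam)"
    using r by (simp add: powr_powr powr_add)
  finally show "(\<integral>\<^sup>+y\<in>B \<gamma> x. ennreal (\<bar>indicator (B \<gamma>0 x0) y\<bar> powr r) \<partial>\<mu>) \<le> ennreal \<dots>" .
qed

text \<open>Below \<gamma>0 the average is at most 1 and p^(\<gamma> \<alpha>) increases with
  \<gamma>; above \<gamma>0 the average is at most p^(n (\<gamma>0 - \<gamma>)), which outweighs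
  that growth because \<alpha> <= n. The supremum sits at \<gamma>0.\<close>

lemma frac_max_indicator_pball:
  assumes x0: "x0 \<in> X" and x: "x \<in> B \<gamma>0 x0" and \<alpha>: "0 \<le> \<alpha>" "\<alpha> \<le> real n"
  shows "frac_max p n \<alpha> (indicator (B \<gamma>0 x0)) x = ennreal (P (of_int \<gamma>0 * \<alpha>))"
proof -
  have xX: "x \<in> X" using x pball_subset by blast
  have [measurable]: "B \<gamma> x \<in> sets \<mu>" "B \<gamma>0 x0 \<in> sets \<mu>" for \<gamma> using xX x0 by auto
  have av: "nnavg \<gamma> (\<lambda>y. ennreal \<bar>indicator (B \<gamma>0 x0) y\<bar>) x =
      ennreal (P (- (real n * of_int \<gamma>))) * emeasure \<mu> (B \<gamma> x \<inter> B \<gamma>0 x0)" for \<gamma>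
  proof -
    have "(\<integral>\<^sup>+y\<in>B \<gamma> x. ennreal \<bar>indicator (B \<gamma>0 x0) y\<bar> \<partial>\<mu>) = (\<integral>\<^sup>+y. indicator (B \<gamma> x \<inter> B \<gamma>0 x0) y \<partial>\<mu>)"
      by (intro nn_integral_cong) (auto simp: indicator_def)
    then show ?thesis by (simp add: nnavg_def)
  qed
  show ?thesis
    unfolding frac_max_eq[OF xX]
  proof (rule antisym, rule SUP_least)
    fix \<gamma> :: int
    let ?c = "ennreal (P (of_int \<gamma> * \<alpha>))"
    show "?c * nnavg \<gamma> (\<lambda>y. ennreal \<bar>indicator (B \<gamma>0 x0) y\<bar>) x \<le> ennreal (P (of_int \<gamma>0 * \<alpha>))"
    proof (cases "\<gamma> \<le> \<gamma>0")
      case True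
      have "nnavg \<gamma> (\<lambda>y. ennreal \<bar>indicator (B \<gamma>0 x0) y\<bar>) x \<le> nnavg \<gamma> (\<lambda>_. 1) x"
        by (intro nnavg_mono[OF xX]) (auto simp: indicator_def)
      then have "?c * nnavg \<gamma> (\<lambda>y. ennreal \<bar>indicator (B \<gamma>0 x0) y\<bar>) x \<le> ?c * 1"
        using xX by (intro mult_left_mono) auto
      also have "\<dots> \<le> ennreal (P (of_int \<gamma>0 * \<alpha>))"
        using True \<alpha> by (auto intro!: ennreal_leI mult_right_mono)
      finally show ?thesis .
    next
      case False
      have "emeasure \<mu> (B \<gamma> x \<inter> B \<gamma>0 x0) \<le> emeasure \<mu> (B \<gamma>0 x0)" by (rule emeasure_mono) auto
      then have "?c * nnavg \<gamma> (\<lambda>y. ennreal \<bar>indicator (B \<gamma>0 x0) y\<bar>) x \<le>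
          ?c * (ennreal (P (- (real n * of_int \<gamma>))) * ennreal (P (real n * of_int \<gamma>0)))"
        unfolding av by (intro mult_left_mono) (auto simp: emeasure_pball x0)
      also have "\<dots> = ennreal (P (of_int \<gamma> * \<alpha> - real n * of_int \<gamma> + real n * of_int \<gamma>0))"
        by (simp add: ennreal_mult'[symmetric] powr_add[symmetric] algebra_simps)
      also have "\<dots> \<le> ennreal (P (of_int \<gamma>0 * \<alpha>))"
        using mult_right_mono[of "real_of_int \<gamma>0" "real_of_int \<gamma>" "real n - \<alpha>"] False \<alpha>
        by (intro ennreal_leI) (simp add: algebra_simps)
      finally show ?thesis .
    qed
  next
    have "B \<gamma>0 x \<inter> B \<gamma>0 x0 = B \<gamma>0 x0" using pball_cong[OF x0 x] by simp
    then have "nnavg \<gamma>0 (\<lambda>y. ennreal \<bar>indicator (B \<gamma>0 x0) y\<bar>) x = 1"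
      unfolding av by (simp add: emeasure_pball x0)
    then show "ennreal (P (of_int \<gamma>0 * \<alpha>)) \<le>
      (SUP \<gamma>. ennreal (P (of_int \<gamma> * \<alpha>)) * nnavg \<gamma> (\<lambda>y. ennreal \<bar>indicator (B \<gamma>0 x0) y\<bar>) x)"
      by (intro SUP_upper2[of \<gamma>0]) auto
  qed
qed

lemma set_integrable_const_pball: "x \<in> X \<Longrightarrow> set_integrable \<mu> (B \<gamma> x) (\<lambda>_. c :: real)"
  by (simp add: set_integrable_def emeasure_pball)

lemma pavg_const: "x \<in> X \<Longrightarrow> pavg p n (\<lambda>_. c) (B \<gamma> x) = c"
  by (simp add: pavg_def set_lebesgue_integral_def measure_pball Int_absorb2[OF pball_subset])

lemma pavg_diff:
  assumes "set_integrable \<mu> S u" "set_integrable \<mu> S v"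
  shows "pavg p n (\<lambda>y. u y - v y) S = pavg p n u S - pavg p n v S"
  unfolding pavg_def set_integral_diff(2)[OF assms] by (rule diff_divide_distrib)

lemma pavg_mult: "pavg p n (\<lambda>y. c * u y) S = c * pavg p n u S"
  by (simp add: pavg_def)

lemma ennreal_pavg:
  assumes x: "x \<in> X" and u: "set_integrable \<mu> (B \<gamma> x) u" "\<And>y. 0 \<le> u y"
  shows "ennreal (pavg p n u (B \<gamma> x)) = nnavg \<gamma> (\<lambda>y. ennreal (u y)) x"
proof -
  have "(\<integral>\<^sup>+y\<in>B \<gamma> x. ennreal (u y) \<partial>\<mu>) = ennreal (LINT y:B \<gamma> x|\<mu>. u y)"
    using u unfolding set_lebesgue_integral_def set_integrable_def
    by (subst nn_integral_eq_integral[symmetric]) (auto intro!: nn_integral_cong simp: indicator_def)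
  then show ?thesis unfolding nnavg_def pavg_def measure_pball[OF x]
    by (simp add: ennreal_mult'[symmetric] powr_minus_divide)
qed

lemma pavg_mono:
  assumes "set_integrable \<mu> S u" "set_integrable \<mu> S v" "\<And>y. u y \<le> v y"
  shows "pavg p n u S \<le> pavg p n v S"
  unfolding pavg_def using assms by (intro divide_right_mono set_integral_mono) auto

text \<open>The scaling relation \<open>eq\<close> makes all powers of p^\<gamma>0 cancel, which is
  why the bound does not depend on the ball.\<close>

lemma local_bounds_of_comm_bounded:
  assumes b: "loc_integrable p n b"
    and \<alpha>: "0 < \<alpha>" "\<alpha> < real n" and lam: "0 \<le> lam" "lam \<le> real n" and r: "0 < r" and q: "1 \<le> q"
    and eq: "(real n - mu) / q = (real n - lam) / r - \<alpha>"
    and bd: "comm_bounded p n \<alpha> b r lam q mu"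
  obtains E where "0 < E"
    "\<And>\<gamma> x. x \<in> X \<Longrightarrow> nnavg \<gamma> (\<lambda>y. ennreal (max (pavg p n (\<lambda>y. \<bar>b y\<bar>) (B \<gamma> x) - b y) 0)) x \<le> ennreal E"
proof -
  note [measurable] = loc_integrable_measurable[OF b]
  obtain C0 where C0: "\<And>f. in_morrey p n r lam f \<Longrightarrow>
        (AE x in \<mu>. frac_max p n \<alpha> f x < \<infinity> \<and> frac_max p n \<alpha> (\<lambda>y. b y * f y) x < \<infinity>) \<and>
        in_morrey p n q mu (frac_max_comm p n \<alpha> b f) \<and>
        morrey_norm p n q mu (frac_max_comm p n \<alpha> b f) \<le> C0 * morrey_norm p n r lam f"
    using bd unfolding comm_bounded_def by blast
  \<comment> \<open>The constant in the boundedness notion may be negative; the maximum makes it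
    usable as a monotone factor.\<close>
  define C where "C = max C0 0"
  have q0: "0 < q" using q by simp
  show ?thesis
  proof (rule that[of "1 + C powr q"])
    show "0 < 1 + C powr q" by (simp add: add_pos_nonneg)
    fix \<gamma>0 x0 assume x0: "x0 \<in> X"
    let ?S = "B \<gamma>0 x0"
    have [measurable]: "?S \<in> sets \<mu>" using x0 by simp
    define f :: "(nat \<Rightarrow> int \<Rightarrow> nat) \<Rightarrow> real" where "f = indicator ?S"
    have [measurable]: "f \<in> borel_measurable \<mu>" unfolding f_def by measurable
    define K where "K = P (of_int \<gamma>0 * (real n - lam) / r)"
    have fK: "morrey_le r lam f K" unfolding f_def K_def by (rule morrey_le_indicator_pball[OF x0 lam r])
    have N: "morrey_sup p n r lam f < \<infinity>" "morrey_norm p n r lam f \<le> K"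
      using morrey_norm_le[OF fK _ r] by (auto simp: K_def)
    then have "in_morrey p n r lam f" by (simp add: in_morrey_def)
    note C0 = C0[OF this]
    have "morrey_norm p n q mu (frac_max_comm p n \<alpha> b f) \<le> C0 * morrey_norm p n r lam f" using C0 by simp
    also have "\<dots> \<le> C * K"
      using N(2) by (intro mult_mono) (auto simp: C_def morrey_norm_def)
    finally have g: "morrey_le q mu (frac_max_comm p n \<alpha> b f) (C * K)"
      using C0 by (intro morrey_leI[OF _ _ q0]) (auto simp: in_morrey_def)
    define A where "A = pavg p n (\<lambda>y. \<bar>b y\<bar>) ?S"
    have int: "set_integrable \<mu> ?S b" using b x0 by (simp add: loc_integrable_def)
    have A: "ennreal A = nnavg \<gamma>0 (\<lambda>y. ennreal \<bar>b y\<bar>) x0"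
      unfolding A_def using set_integrable_abs[OF int] by (intro ennreal_pavg[OF x0]) auto
    define c where "c = P (of_int \<gamma>0 * \<alpha>)"
    have c: "0 < c" by (simp add: c_def)
    have pt: "max (A - b y) 0 \<le> 1 + 1 / c powr q * \<bar>frac_max_comm p n \<alpha> b f y\<bar> powr q"
      if y: "y \<in> ?S" and fin: "frac_max p n \<alpha> (\<lambda>y. b y * f y) y < \<infinity>" for y
    proof -
      have yX: "y \<in> X" using y pball_subset by blast
      define h where "h = enn2real (frac_max p n \<alpha> (\<lambda>y. b y * f y) y)"
      have "ennreal (c * A) = ennreal c * nnavg \<gamma>0 (\<lambda>y. ennreal \<bar>b y\<bar>) x0"
        unfolding A[symmetric] using c by (simp add: ennreal_mult')
      also have "nnavg \<gamma>0 (\<lambda>y. ennreal \<bar>b y\<bar>) x0 = nnavg \<gamma>0 (\<lambda>y. ennreal \<bar>b y\<bar>) y"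
        using level_constD[OF nnavg_level_const x0 y] by simp
      also have "\<dots> = nnavg \<gamma>0 (\<lambda>y. ennreal \<bar>b y * f y\<bar>) y"
        by (rule nnavg_cong[OF yX]) (simp add: f_def pball_cong[OF x0 y])
      also have "ennreal c * \<dots> \<le> frac_max p n \<alpha> (\<lambda>y. b y * f y) y"
        unfolding frac_max_eq[OF yX] c_def by (rule SUP_upper) simp
      also have "\<dots> = ennreal h" using fin by (simp add: h_def)
      finally have "c * A \<le> h" by (simp add: h_def ennreal_le_iff)
      have comm: "frac_max_comm p n \<alpha> b f y = b y * c - h"
        using frac_max_indicator_pball[OF x0 y, of \<alpha>] \<alpha> by (simp add: frac_max_comm_def f_def h_def c_def)
      have "c * max (A - b y) 0 \<le> \<bar>frac_max_comm p n \<alpha> b f y\<bar>"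
        unfolding comm using \<open>c * A \<le> h\<close> c by (auto simp: max_def algebra_simps)
      then have "max (A - b y) 0 \<le> \<bar>frac_max_comm p n \<alpha> b f y\<bar> / c"
        using c by (simp only: pos_le_divide_eq mult.commute)
      \<comment> \<open>z <= 1 + z^q in place of Hoelder's inequality; the average of z^q is what
        the Morrey bound controls.\<close>
      also have "\<dots> \<le> 1 + (\<bar>frac_max_comm p n \<alpha> b f y\<bar> / c) powr q"
        using powr_le_interpolate[of "\<bar>frac_max_comm p n \<alpha> b f y\<bar> / c" 1 1 q] q c by simp
      finally show ?thesis using c by (simp add: powr_divide)
    qed
    have [measurable]: "frac_max_comm p n \<alpha> b f \<in> borel_measurable \<mu>"
      by (rule frac_max_comm_measurable) measurable
    have "nnavg \<gamma>0 (\<lambda>y. ennreal (max (A - b y) 0)) x0 \<le>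
      nnavg \<gamma>0 (\<lambda>y. 1 + ennreal (1 / c powr q) * ennreal (\<bar>frac_max_comm p n \<alpha> b f y\<bar> powr q)) x0"
      unfolding nnavg_def
    proof (intro mult_left_mono nn_integral_mono_AE)
      have "AE y in \<mu>. frac_max p n \<alpha> (\<lambda>y. b y * f y) y < \<infinity>" using C0 by auto
      then show "AE y in \<mu>. ennreal (max (A - b y) 0) * indicator ?S y \<le>
          (1 + ennreal (1 / c powr q) * ennreal (\<bar>frac_max_comm p n \<alpha> b f y\<bar> powr q)) * indicator ?S y"
      proof eventually_elim
        case (elim y)
        have "ennreal (max (A - b y) 0) \<le> ennreal (1 + 1 / c powr q * \<bar>frac_max_comm p n \<alpha> b f y\<bar> powr q)" if "y \<in> ?S"
          using pt[OF that elim] by (rule ennreal_leI)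
        also have "ennreal (1 + 1 / c powr q * \<bar>frac_max_comm p n \<alpha> b f y\<bar> powr q) =
            1 + ennreal (1 / c powr q) * ennreal (\<bar>frac_max_comm p n \<alpha> b f y\<bar> powr q)"
          by (simp add: ennreal_mult'[symmetric])
        finally show ?case by (simp add: indicator_def)
      qed
    qed simp
    also have "\<dots> = 1 + ennreal (1 / c powr q) * nnavg \<gamma>0 (\<lambda>y. ennreal (\<bar>frac_max_comm p n \<alpha> b f y\<bar> powr q)) x0"
      using x0 by (simp add: nnavg_add nnavg_cmult)
    also have "\<dots> \<le> 1 + ennreal (1 / c powr q) * (ennreal (P (- (real n * of_int \<gamma>0))) * ennreal ((C * K) powr q * P (of_int \<gamma>0 * mu)))"
      unfolding nnavg_def using g x0 by (intro add_left_mono mult_left_mono) (auto simp: morrey_le_def)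
    also have "\<dots> = ennreal (1 + 1 / c powr q * (P (- (real n * of_int \<gamma>0)) * ((C * K) powr q * P (of_int \<gamma>0 * mu))))"
      by (simp add: ennreal_mult'[symmetric])
    also have "1 / c powr q * (P (- (real n * of_int \<gamma>0)) * ((C * K) powr q * P (of_int \<gamma>0 * mu))) = C powr q"
    proof -
      have "real n - mu = ((real n - lam) / r - \<alpha>) * q" using eq q by (simp add: field_simps)
      then have e: "- (\<alpha> * q) - real n + (real n - lam) / r * q + mu = 0" by (simp add: algebra_simps)
      have "1 / c powr q * (P (- (real n * of_int \<gamma>0)) * ((C * K) powr q * P (of_int \<gamma>0 * mu)))
        = C powr q * (P (- (real_of_int \<gamma>0 * \<alpha> * q)) * P (- (real n * of_int \<gamma>0)) *
            P (of_int \<gamma>0 * (real n - lam) / r * q) * P (of_int \<gamma>0 * mu))"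
        by (simp add: c_def K_def C_def powr_mult powr_powr powr_minus_divide)
      also have "P (- (real_of_int \<gamma>0 * \<alpha> * q)) * P (- (real n * of_int \<gamma>0)) *
            P (of_int \<gamma>0 * (real n - lam) / r * q) * P (of_int \<gamma>0 * mu)
          = P (of_int \<gamma>0 * (- (\<alpha> * q) - real n + (real n - lam) / r * q + mu))"
        unfolding powr_add[symmetric] by (simp add: algebra_simps)
      also have "\<dots> = 1" unfolding e by simp
      finally show ?thesis by simp
    qed
    finally show "nnavg \<gamma>0 (\<lambda>y. ennreal (max (pavg p n (\<lambda>y. \<bar>b y\<bar>) ?S - b y) 0)) x0 \<le> ennreal (1 + C powr q)"
      unfolding A_def .
  qed
qed

text \<open>Let m be the average of b and A that of |b|. Since m - b has mean 0, the mean of |b - m|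
  is twice that of (m - b)^+, and m <= A puts the latter below (A - b)^+. Moreover b^- <= |b| - b,
  whose mean equals that of A - b.\<close>

lemma bmo_of_comm_bounded:
  assumes b: "loc_integrable p n b"
    and \<alpha>: "0 < \<alpha>" "\<alpha> < real n" and lam: "0 \<le> lam" "lam \<le> real n" and r: "0 < r" and q: "1 \<le> q"
    and eq: "(real n - mu) / q = (real n - lam) / r - \<alpha>"
    and bd: "comm_bounded p n \<alpha> b r lam q mu"
  shows "pBMO p n b" "pLinf p n (\<lambda>x. - min (b x) 0)"
proof -
  note [measurable] = loc_integrable_measurable[OF b]
  obtain E where E: "0 < E" 
    "\<And>\<gamma> x. x \<in> X \<Longrightarrow> nnavg \<gamma> (\<lambda>y. ennreal (max (pavg p n (\<lambda>y. \<bar>b y\<bar>) (B \<gamma> x) - b y) 0)) x \<le> ennreal E"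
    using local_bounds_of_comm_bounded[OF assms] by blast
  have main: "nnavg \<gamma> (\<lambda>y. ennreal \<bar>b y - pavg p n b (B \<gamma> x)\<bar>) x \<le> ennreal (2 * E)"
    "nnavg \<gamma> (\<lambda>y. ennreal (- min (b y) 0)) x \<le> ennreal E" if x: "x \<in> X" for \<gamma> x
  proof -
    let ?S = "B \<gamma> x"
    define m where "m = pavg p n b ?S"
    define A where "A = pavg p n (\<lambda>y. \<bar>b y\<bar>) ?S"
    have int: "set_integrable \<mu> ?S b" using b x by (simp add: loc_integrable_def)
    have cint: "set_integrable \<mu> ?S (\<lambda>_. c)" for c :: real by (rule set_integrable_const_pball[OF x])
    have aint: "set_integrable \<mu> ?S (\<lambda>y. \<bar>b y\<bar>)" by (rule set_integrable_abs[OF int])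
    have mA: "m \<le> A" unfolding m_def A_def by (rule pavg_mono[OF int aint]) simp
    define U where "U y = max (A - b y) 0" for y
    have Ueq: "U y = (\<bar>A - b y\<bar> + (A - b y)) / 2" for y by (auto simp: U_def max_def)
    have dint: "set_integrable \<mu> ?S (\<lambda>y. c - b y)" for c by (rule set_integral_diff(1)[OF cint int])
    have Uint: "set_integrable \<mu> ?S U"
      unfolding Ueq[abs_def] by (intro set_integrable_divide set_integral_add(1) set_integrable_abs dint)
    have UE: "pavg p n U ?S \<le> E"
    proof -
      have "ennreal (pavg p n U ?S) \<le> ennreal E"
        using E(2)[OF x, of \<gamma>] by (subst ennreal_pavg[OF x Uint]) (auto simp: U_def A_def)
      then show ?thesis using E(1) by (simp add: ennreal_le_iff)
    qed
    have mint: "set_integrable \<mu> ?S (\<lambda>y. \<bar>b y - m\<bar>)"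
      by (intro set_integrable_abs set_integral_diff(1)[OF int cint])
    have "pavg p n (\<lambda>y. \<bar>b y - m\<bar>) ?S \<le> pavg p n (\<lambda>y. 2 * U y - (m - b y)) ?S"
    proof (rule pavg_mono[OF mint])
      show "set_integrable \<mu> ?S (\<lambda>y. 2 * U y - (m - b y))"
        by (intro set_integral_diff(1) set_integrable_mult_right Uint dint)
      \<comment> \<open>The identity |z| = 2 z^+ - z for z = m - b y, with z^+ enlarged to
        \<open>U y\<close>.\<close>
      show "\<bar>b y - m\<bar> \<le> 2 * U y - (m - b y)" for y using mA by (auto simp: U_def max_def)
    qed
    also have "\<dots> = 2 * pavg p n U ?S - (m - m)"
      using x by (simp add: pavg_diff pavg_mult pavg_const Uint dint cint int m_def[symmetric])
    finally have "pavg p n (\<lambda>y. \<bar>b y - m\<bar>) ?S \<le> 2 * E" using UE by simp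
    then have "ennreal (pavg p n (\<lambda>y. \<bar>b y - m\<bar>) ?S) \<le> ennreal (2 * E)" by (rule ennreal_leI)
    then show "nnavg \<gamma> (\<lambda>y. ennreal \<bar>b y - pavg p n b ?S\<bar>) x \<le> ennreal (2 * E)"
      by (subst (asm) ennreal_pavg[OF x mint]) (auto simp: m_def)
    have nint: "set_integrable \<mu> ?S (\<lambda>y. - min (b y) 0)"
    proof -
      have "- min (b y) 0 = (\<bar>b y\<bar> - b y) / 2" for y by (auto simp: min_def)
      then show ?thesis by (simp only:) (intro set_integrable_divide set_integral_diff(1) aint int)
    qed
    have "pavg p n (\<lambda>y. - min (b y) 0) ?S \<le> pavg p n (\<lambda>y. \<bar>b y\<bar> - b y) ?S"
      by (rule pavg_mono[OF nint set_integral_diff(1)[OF aint int]]) (auto simp: min_def)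
    also have "\<dots> = pavg p n (\<lambda>y. A - b y) ?S"
      using x by (simp add: pavg_diff pavg_const aint int cint A_def)
    also have "\<dots> \<le> pavg p n U ?S" by (rule pavg_mono[OF dint Uint]) (simp add: U_def)
    finally have "ennreal (pavg p n (\<lambda>y. - min (b y) 0) ?S) \<le> ennreal E"
      using UE by (intro ennreal_leI) simp
    then show "nnavg \<gamma> (\<lambda>y. ennreal (- min (b y) 0)) x \<le> ennreal E"
      by (subst (asm) ennreal_pavg[OF x nint]) auto
  qed
  show "pBMO p n b"
    unfolding pBMO_iff using b main(1) E(1) by (intro conjI exI[of _ "2 * E"]) auto
  have "AE x in \<mu>. ennreal (- min (b x) 0) \<le> ennreal E"
    using main(2) E(1) by (intro AE_le_of_ball_averages) auto
  then have "AE x in \<mu>. \<bar>- min (b x) 0\<bar> \<le> E"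
    by (rule AE_mp) (intro AE_I2, use E(1) in \<open>auto simp: ennreal_le_iff min_def split: if_splits\<close>)
  then show "pLinf p n (\<lambda>x. - min (b x) 0)"
    unfolding pLinf_def by auto
qed

text \<open>\<open>q1\<close> is the exponent of the first target space, where the commutator
  estimate holds with parameter \<open>lam\<close>. Every pair (q, mu) with 1 <= q <= q1 on the same
  scaling line is then reached by \<open>morrey_le_embed\<close>.\<close>

lemma comm_bounded_of_bmo:
  assumes \<alpha>: "0 < \<alpha>" and r: "1 < r" and lam: "0 \<le> lam" "lam < real n - \<alpha> * r"
    and bmo: "pBMO p n b" and bneg: "pLinf p n (\<lambda>x. - min (b x) 0)"
    and q: "0 < q" "1 / q \<le> 1" "1 / r - \<alpha> / (real n - lam) \<le> 1 / q"
    and eq: "(real n - mu) / q = (real n - lam) / r - \<alpha>"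
  shows "comm_bounded p n \<alpha> b r lam q mu"
proof -
  define q1 where "q1 = 1 / (1 / r - \<alpha> / (real n - lam))"
  interpret padic_morrey p n \<alpha> r lam q1
    by unfold_locales (use \<alpha> r lam in \<open>auto simp: q1_def\<close>)
  obtain D where loc: "loc_integrable p n b" and D: "0 < D"
    "\<And>\<gamma> x. x \<in> X \<Longrightarrow> nnavg \<gamma> (\<lambda>y. ennreal \<bar>b y - pavg p n b (B \<gamma> x)\<bar>) x \<le> ennreal D"
    using bmo unfolding pBMO_iff by blast
  \<comment> \<open>The oscillation bound is raised to at least 1, so that the drift p^n D per level
    is at least 1 and can be used as a factor of the weight.\<close>
  interpret padic_morrey_bmo p n \<alpha> r lam q1 b "max D 1"
  proof unfold_locales
    show "nnavg \<gamma> (\<lambda>y. ennreal \<bar>b y - pavg p n b (B \<gamma> x)\<bar>) x \<le> ennreal (max D 1)" if "x \<in> X" for \<gamma> x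
      using D(2)[OF that, of \<gamma>] by (rule order_trans) (simp add: ennreal_leI)
  qed (use loc in auto)
  obtain \<beta> where \<beta>: "AE x in \<mu>. \<bar>- min (b x) 0\<bar> \<le> \<beta>" using bneg unfolding pLinf_def by blast
  have "AE x in \<mu>. - min (b x) 0 \<le> max \<beta> 0" using \<beta> by (rule AE_mp) (intro AE_I2, auto)
  then obtain C where C: "0 < C" "comm_estimate \<alpha> b r lam q1 lam C"
    using comm_estimate[of "max \<beta> 0"] by auto
  have q1: "r < q1" "0 < q1" using q_alt(1) s_bounds by linarith+
  have "1 / q1 \<le> 1 / q" using q by (simp add: q1_def)
  then have qq1: "q \<le> q1" using q(1) q1 by (simp add: field_simps)
  have eq': "(real n - mu) / q = (real n - lam) / q1"
    unfolding eq using q_alt(3) q1 by (simp add: \<rho>_def[symmetric] nonzero_eq_divide_eq)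
  have "comm_estimate \<alpha> b r lam q mu (2 * C)"
    unfolding comm_estimate_def
  proof (intro allI impI)
    fix f K assume f: "f \<in> borel_measurable \<mu> \<and> 0 < K \<and> morrey_le r lam f K"
    have q': "1 \<le> q" using q by (simp add: field_simps)
    have *: "(AE x in \<mu>. frac_max p n \<alpha> f x < \<infinity> \<and> frac_max p n \<alpha> (\<lambda>y. b y * f y) x < \<infinity>) \<and>
        morrey_le q1 lam (frac_max_comm p n \<alpha> b f) (C * K)"
      using C(2)[unfolded comm_estimate_def, rule_format, OF f] .
    then have "morrey_le q mu (frac_max_comm p n \<alpha> b f) (2 * (C * K))"
      using f C(1) q' qq1 eq' frac_max_comm_measurable[OF b_measurable]
      by (intro morrey_le_embed[of _ "C * K" q1 lam]) auto
    then show "(AE x in \<mu>. frac_max p n \<alpha> f x < \<infinity> \<and> frac_max p n \<alpha> (\<lambda>y. b y * f y) x < \<infinity>) \<and>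
        morrey_le q mu (frac_max_comm p n \<alpha> b f) (2 * C * K)" using * by (simp add: mult.assoc)
  qed
  then show ?thesis using C(1) r q(1) by (intro comm_bounded_of_estimate[OF b_measurable]) auto
qed

end

theorem theorem3:
  fixes p n :: nat and \<alpha> r lam :: real and b :: "(nat \<Rightarrow> int \<Rightarrow> nat) \<Rightarrow> real"
  assumes "prime p"
    and "loc_integrable p n b"
    and "0 < \<alpha>" and "\<alpha> < real n"
    and "1 < r" and "r < real n / \<alpha>"
    and "0 < lam" and "lam < real n - \<alpha> * r"
  shows "(\<forall>q::real. 1 / q = 1 / r - \<alpha> / (real n - lam) \<longrightarrow>
            ((pBMO p n b \<and> pLinf p n (\<lambda>x. - min (b x) 0)) \<longleftrightarrow>
             comm_bounded p n \<alpha> b r lam q lam))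
       \<and> (\<forall>q mu::real. 1 / q = 1 / r - \<alpha> / real n \<and> lam / r = mu / q \<longrightarrow>
            ((pBMO p n b \<and> pLinf p n (\<lambda>x. - min (b x) 0)) \<longleftrightarrow>
             comm_bounded p n \<alpha> b r lam q mu))"
proof -
  have "2 \<le> p" using \<open>prime p\<close> by (rule prime_ge_2_nat)
  moreover have "1 \<le> n" using assms(3,4) by (cases n) auto
  ultimately interpret padic p n by unfold_locales
  have lam_n: "0 < real n - lam" "real n - lam < real n" using assms mult_pos_pos[of \<alpha> r] by linarith+
  have "\<alpha> * r < real n - lam" using assms(8) by simp
  then have pos: "0 < 1 / r - \<alpha> / (real n - lam)" using lam_n assms(5) by (simp add: field_simps)
  have less: "1 / r - \<alpha> / (real n - lam) < 1 / r - \<alpha> / real n"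
    using lam_n assms(3) by (simp add: frac_less2)
  \<comment> \<open>The two claims differ only in where \<open>q\<close> lies between
    \<open>r\<close> and the exponent of the first claim: the lower bound on 1 / q permits the
    embedding, the upper bound gives q >= 1, and \<open>eq\<close> determines
    \<open>mu\<close>.\<close>
  have equiv: "(pBMO p n b \<and> pLinf p n (\<lambda>x. - min (b x) 0)) \<longleftrightarrow> comm_bounded p n \<alpha> b r lam q mu"
    if q: "1 / r - \<alpha> / (real n - lam) \<le> 1 / q" "1 / q \<le> 1 / r"
      and eq: "(real n - mu) / q = (real n - lam) / r - \<alpha>" for q mu
  proof -
    have "0 < 1 / q" using pos q(1) by linarith
    then have q0: "0 < q" by simp
    have "1 / r < 1" using assms(5) by simp
    then have "1 / q \<le> 1" using q(2) by linarith
    then have q1: "1 \<le> q" using q0 by (simp add: field_simps)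
    have lam_r: "0 \<le> lam" "lam \<le> real n" "0 < r" using assms(5,7) lam_n by linarith+
    show ?thesis
    proof
      assume "pBMO p n b \<and> pLinf p n (\<lambda>x. - min (b x) 0)"
      then show "comm_bounded p n \<alpha> b r lam q mu"
        using comm_bounded_of_bmo[OF assms(3,5) lam_r(1) assms(8) _ _ q0 \<open>1 / q \<le> 1\<close> q(1) eq] by blast
    next
      assume "comm_bounded p n \<alpha> b r lam q mu"
      note bmo_of_comm_bounded[OF assms(2-4) lam_r q1 eq this]
      then show "pBMO p n b \<and> pLinf p n (\<lambda>x. - min (b x) 0)" by blast
    qed
  qed
  show ?thesis
  proof (intro conjI allI impI)
    fix q :: real assume q: "1 / q = 1 / r - \<alpha> / (real n - lam)"
    have "(real n - lam) / q = (real n - lam) * (1 / q)" by simp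
    also have "\<dots> = (real n - lam) / r - \<alpha>" unfolding q using lam_n by (simp add: right_diff_distrib)
    finally show "(pBMO p n b \<and> pLinf p n (\<lambda>x. - min (b x) 0)) \<longleftrightarrow> comm_bounded p n \<alpha> b r lam q lam"
      using q lam_n assms(3) by (intro equiv) auto
  next
    fix q mu :: real assume *: "1 / q = 1 / r - \<alpha> / real n \<and> lam / r = mu / q"
    then have q: "1 / q = 1 / r - \<alpha> / real n" by simp
    have "(real n - mu) / q = real n * (1 / q) - mu / q" by (simp add: diff_divide_distrib)
    also have "mu / q = lam / r" using * by simp
    also have "real n * (1 / q) - lam / r = (real n - lam) / r - \<alpha>" unfolding q using lam_n assms(7)
      by (simp add: right_diff_distrib diff_divide_distrib)
    finally show "(pBMO p n b \<and> pLinf p n (\<lambda>x. - min (b x) 0)) \<longleftrightarrow> comm_bounded p n \<alpha> b r lam q mu"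
      using q less assms(3,4) by (intro equiv) auto
  qed
qed

end
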